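(* Let $|t|<1$. Then $$\varphi_3(x;s|q,t)=\sum_{k\ge0}\frac{(q/t;q)_k(q/t;q)_k}{(q;q)_k(t;q)_k}\left(\frac{qx_3s_3}{x_1s_1}\right)^k\prod_{1\le i<j\le3}\frac{(t;q)_\infty(qx_js_j/x_is_i;q)_\infty}{(qx_j/tx_i;q)_\infty(qs_j/ts_i;q)_\infty}\;{}_2\phi_1\!\left[{qx_j/tx_i,\ qs_j/ts_i\atop qx_js_j/x_is_i};q,\,q^kt\right].$$ This formula manifestly shows the following two properties. (a) Regularity: writing $p_3(x;s|q,t)=\sum_{\mu\in Q_+}x^{-\mu}p_\mu(s)$ for the series with leading coefficient $1$ that is related to $\varphi_3$ by $\varphi_3(x;s|q,t)=\prod_{1\le i<j\le3}\frac{(qs_j/s_i;q)_\infty}{(qs_j/ts_i;q)_\infty}\,p_3(x;s|q,t)$, each coefficient $p_\mu(s)$, a rational function of $(s_2/s_1,s_3/s_2)$, is regular at the origin $(s_2/s_1,s_3/s_2)=0$ and has at most simple poles along the divisors $q^{k+1}s_j/s_i=1$ $(1\le i<j\le3;\ k=0,1,2,\ldots)$. (b) Duality: $\varphi_3(x;s|q,t)=\varphi_3(s;x|q,t)$.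
   Context: Fix $q,t\in\mathbb{C}^*$ with $|q|<1$; $(z;q)_\infty=\prod_{k\ge0}(1-q^kz)$, $(z;q)_k=(z;q)_\infty/(q^kz;q)_\infty$, and ${}_2\phi_1\left[{a,b\atop c};q,z\right]=\sum_{m\ge0}\frac{(a;q)_m(b;q)_m}{(q;q)_m(c;q)_m}z^m$. $x=(x_1,x_2,x_3)$, $s=(s_1,s_2,s_3)$. $Q_+=\mathbb{N}\alpha_1\oplus\mathbb{N}\alpha_2$ with $\alpha_i=\epsilon_i-\epsilon_{i+1}$, and $x^{-\mu}=x_1^{-\mu_1}x_2^{-\mu_2}x_3^{-\mu_3}$ for $\mu=\sum_i\mu_i\epsilon_i\in Q_+$, so that $x^{-\alpha_i}=x_{i+1}/x_i$. $M_3$ is the set of strictly upper triangular $3\times3$ matrices with entries in $\mathbb{N}=\{0,1,\ldots\}$, and $p_3$, $\varphi_3$ are the case $n=3$ of $$p_n(x;s|q,t)=\sum_{\theta\in M_n}c_n(\theta;s|q,t)\prod_{1\le i<j\le n}(x_j/x_i)^{\theta_{ij}},\qquad \varphi_n(x;s|q,t)=\prod_{1\le i<j\le n}\frac{(qs_j/s_i;q)_\infty}{(qs_j/ts_i;q)_\infty}\,p_n(x;s|q,t),$$ $$c_n(\theta;s|q,t)=\prod_{k=2}^{n}\prod_{1\le i<j\le k}\frac{(q^{\sum_{a>k}(\theta_{i,a}-\theta_{j,a})}ts_j/s_i;q)_{\theta_{i,k}}}{(q^{\sum_{a>k}(\theta_{i,a}-\theta_{j,a})}qs_j/s_i;q)_{\theta_{i,k}}}\cdot\prod_{k=2}^{n}\prod_{1\le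 i\le j<k}\frac{(q^{-\theta_{j,k}+\sum_{a>k}(\theta_{i,a}-\theta_{j,a})}qs_j/ts_i;q)_{\theta_{i,k}}}{(q^{-\theta_{j,k}+\sum_{a>k}(\theta_{i,a}-\theta_{j,a})}s_j/s_i;q)_{\theta_{i,k}}}$$ with $\sum_{a>k}=\sum_{a=k+1}^n$. Here $\varphi_3$ is regarded as a formal power series in $x_2/x_1,x_3/x_2,s_2/s_1,s_3/s_2$ (with $x_3/x_1=(x_2/x_1)(x_3/x_2)$, etc.). *)

theory Defs
  imports
    Complex_Main
    "HOL-Computational_Algebra.Computational_Algebra"
    "HOL-Computational_Algebra.Field_as_Ring"
begin

section \<open>The coefficients $c_n$\<close>

text \<open>
  For a nonnegative integer \<open>k\<close> the shifted factorial $(z;q)_k$ is the finite product below; the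
  quotient $(z;q)_\infty / (q^k z;q)_\infty$ has to be read this way where it is formally $0/0$,
  as in $(q^{-m};q)_m$, which occurs in $c_n$.
\<close>

definition qpoch :: "'a::comm_ring_1 \<Rightarrow> 'a \<Rightarrow> nat \<Rightarrow> 'a" where
  "qpoch q z k = (\<Prod>l<k. 1 - q ^ l * z)"

definition upper_matrices :: "nat \<Rightarrow> (nat \<Rightarrow> nat \<Rightarrow> nat) set" where
  "upper_matrices n = {\<theta>. \<forall>i j. \<not> (1 \<le> i \<and> i < j \<and> j \<le> n) \<longrightarrow> \<theta> i j = 0}"

definition macd_c :: "nat \<Rightarrow> (nat \<Rightarrow> nat \<Rightarrow> nat) \<Rightarrow> (nat \<Rightarrow> 'a::field) \<Rightarrow> 'a \<Rightarrow> 'a \<Rightarrow> 'a" where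
  "macd_c n \<theta> s q t =
     (\<Prod>k=2..n. \<Prod>(i,j)\<in>{(i,j). 1 \<le> i \<and> i < j \<and> j \<le> k}.
        let e = (\<Sum>a=k+1..n. int (\<theta> i a) - int (\<theta> j a)) in
          qpoch q (q powi e * (t * s j / s i)) (\<theta> i k) /
          qpoch q (q powi e * (q * s j / s i)) (\<theta> i k)) *
     (\<Prod>k=2..n. \<Prod>(i,j)\<in>{(i,j). 1 \<le> i \<and> i \<le> j \<and> j < k}.
        let e = - int (\<theta> j k) + (\<Sum>a=k+1..n. int (\<theta> i a) - int (\<theta> j a)) in
          qpoch q (q powi e * (q * s j / (t * s i))) (\<theta> i k) /
          qpoch q (q powi e * (s j / s i)) (\<theta> i k))"

section \<open>Rational functions of $s_2/s_1$ and $s_3/s_2$\<close>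

text \<open>
  In \<open>complex poly poly\<close> the outer variable is $s_2/s_1$ and the inner one is $s_3/s_2$.
  The function \<open>s_ratio_poly i j\<close> is $s_j/s_i$ for \<open>i \<le> j\<close>.
\<close>

type_synonym ratfun = "complex poly poly fract"

definition s_ratio_poly :: "nat \<Rightarrow> nat \<Rightarrow> complex poly poly" where
  "s_ratio_poly i j = (\<Prod>l=i..<j. if l = 1 then [:0, 1:] else [:[:0, 1:]:])"

definition ratfun_const :: "complex \<Rightarrow> ratfun" where
  "ratfun_const c = to_fract [:[:c:]:]"

text \<open>
  The coefficient $p_\mu(s)$ of $x^{-\mu}$ in $p_3(x;s|q,t)$, where
  $\mu = a\alpha_1 + b\alpha_2$.  Since $c_3$ depends on the ratios of the $s_i$ only, it is
  evaluated at $(1, s_2/s_1, s_3/s_1)$.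
\<close>

definition p3_coeff :: "complex \<Rightarrow> complex \<Rightarrow> nat \<Rightarrow> nat \<Rightarrow> ratfun" where
  "p3_coeff q t a b =
     (\<Sum>\<theta>\<in>{\<theta> \<in> upper_matrices 3. \<theta> 1 2 + \<theta> 1 3 = a \<and> \<theta> 1 3 + \<theta> 2 3 = b}.
        macd_c 3 \<theta> (\<lambda>i. to_fract (s_ratio_poly 1 i)) (ratfun_const q) (ratfun_const t))"

definition ratfun_num :: "ratfun \<Rightarrow> complex poly poly" where
  "ratfun_num f = fst (quot_of_fract f)"

text \<open>Numerator and denominator are coprime, because \<open>quot_of_fract\<close> is in lowest terms.\<close>

definition ratfun_denom :: "ratfun \<Rightarrow> complex poly poly" where
  "ratfun_denom f = snd (quot_of_fract f)"

definition regular_at_origin :: "ratfun \<Rightarrow> bool" where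
  "regular_at_origin f \<longleftrightarrow> poly (poly (ratfun_denom f) 0) 0 \<noteq> 0"

text \<open>The order of the pole of \<open>f\<close> along the prime divisor \<open>\<pi> = 0\<close>; it is 0 if there is no pole.\<close>

definition pole_order :: "ratfun \<Rightarrow> complex poly poly \<Rightarrow> nat" where
  "pole_order f \<pi> = multiplicity \<pi> (ratfun_denom f)"

text \<open>The divisor $q^{k+1} s_j/s_i = 1$.\<close>

definition pole_divisor :: "complex \<Rightarrow> nat \<Rightarrow> nat \<Rightarrow> nat \<Rightarrow> complex poly poly" where
  "pole_divisor q i j k = [:[:q ^ (k + 1):]:] * s_ratio_poly i j - 1"

section \<open>Formal power series in $x_2/x_1, x_3/x_2, s_2/s_1, s_3/s_2$\<close>

text \<open>
  The coefficient of $(x_2/x_1)^a (x_3/x_2)^b (s_2/s_1)^c (s_3/s_2)^d$ in \<open>F\<close> is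
  \<open>F $ a $ b $ c $ d\<close>.  On iterated power series, \<open>inverse\<close> yields the inverse of every
  series with nonzero constant term.
\<close>

unbundle fps_syntax

type_synonym ps4 = "complex fps fps fps fps"

definition const4 :: "complex \<Rightarrow> ps4" where
  "const4 c = fps_const (fps_const (fps_const (fps_const c)))"

text \<open>\<open>x_ratio i j\<close> and \<open>s_ratio i j\<close> are $x_j/x_i$ and $s_j/s_i$ for \<open>i < j\<close>.\<close>

definition x_ratio :: "nat \<Rightarrow> nat \<Rightarrow> ps4" where
  "x_ratio i j = (\<Prod>l=i..<j. if l = 1 then fps_X else fps_const fps_X)"

definition s_ratio :: "nat \<Rightarrow> nat \<Rightarrow> ps4" where
  "s_ratio i j =
     (\<Prod>l=i..<j. if l = 1 then fps_const (fps_const fps_X)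
                 else fps_const (fps_const (fps_const fps_X)))"

text \<open>
  Exchange of the $x$- and $s$-variables: if \<open>F\<close> is $F(x;s)$, then \<open>swap_xs F\<close> is $F(s;x)$.
\<close>

definition swap_xs :: "ps4 \<Rightarrow> ps4" where
  "swap_xs F = Abs_fps (\<lambda>a. Abs_fps (\<lambda>b. Abs_fps (\<lambda>c. Abs_fps (\<lambda>d. F $ c $ d $ a $ b))))"

text \<open>
  Infinite sums and products of formal power series are taken coefficientwise, with respect to
  the usual topology of \<open>complex\<close> (and not the \<open>X\<close>-adic one of the type \<open>fps\<close>).
\<close>

definition ps4_lim :: "(nat \<Rightarrow> ps4) \<Rightarrow> ps4" where
  "ps4_lim F =
     Abs_fps (\<lambda>a. Abs_fps (\<lambda>b. Abs_fps (\<lambda>c. Abs_fps (\<lambda>d. lim (\<lambda>n. F n $ a $ b $ c $ d)))))"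

definition ps4_sums :: "(nat \<Rightarrow> ps4) \<Rightarrow> ps4 \<Rightarrow> bool" where
  "ps4_sums f F \<longleftrightarrow> (\<forall>a b c d. (\<lambda>n. f n $ a $ b $ c $ d) sums (F $ a $ b $ c $ d))"

definition ps4_suminf :: "(nat \<Rightarrow> ps4) \<Rightarrow> ps4" where
  "ps4_suminf f = ps4_lim (\<lambda>n. \<Sum>m<n. f m)"

text \<open>
  $(z;q)_\infty$; the limit exists for every \<open>z\<close> if \<open>norm q < 1\<close>.
\<close>

definition qpoch_inf :: "complex \<Rightarrow> ps4 \<Rightarrow> ps4" where
  "qpoch_inf q z = ps4_lim (qpoch (const4 q) z)"

text \<open>
  The basic hypergeometric series.  The coefficientwise limit exists if \<open>norm q < 1\<close>, the
  constant term of \<open>z\<close> has norm less than 1 and that of \<open>c\<close> is 0.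
\<close>

definition phi21 :: "complex \<Rightarrow> ps4 \<Rightarrow> ps4 \<Rightarrow> ps4 \<Rightarrow> ps4 \<Rightarrow> ps4" where
  "phi21 q a b c z =
     ps4_suminf (\<lambda>m. qpoch (const4 q) a m * qpoch (const4 q) b m *
       inverse (qpoch (const4 q) (const4 q) m * qpoch (const4 q) c m) * z ^ m)"

section \<open>The series $p_3$ and $\varphi_3$\<close>

text \<open>
  The power series expansion of a rational function at the origin (meaningful for those that are
  regular there).
\<close>

definition expand_poly :: "complex poly poly \<Rightarrow> complex fps fps" where
  "expand_poly p = fps_of_poly (map_poly fps_of_poly p)"

definition expand :: "ratfun \<Rightarrow> complex fps fps" where
  "expand f = expand_poly (ratfun_num f) * inverse (expand_poly (ratfun_denom f))"

definition p3 :: "complex \<Rightarrow> complex \<Rightarrow> ps4" where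
  "p3 q t = Abs_fps (\<lambda>a. Abs_fps (\<lambda>b. expand (p3_coeff q t a b)))"

definition pairs3 :: "(nat \<times> nat) set" where
  "pairs3 = {(i, j). 1 \<le> i \<and> i < j \<and> j \<le> 3}"

definition phi3 :: "complex \<Rightarrow> complex \<Rightarrow> ps4" where
  "phi3 q t =
     (\<Prod>(i,j)\<in>pairs3. qpoch_inf q (const4 q * s_ratio i j) *
        inverse (qpoch_inf q (const4 (q / t) * s_ratio i j))) * p3 q t"

unbundle no fps_syntax

end

theory Submission
  imports Defs
begin

text \<open>
  With \<open>u\<close>, \<open>v\<close> for $s_2/s_1$, $s_3/s_2$, the coefficient $p_\mu$ is a single sum over
  $\theta_{13}$ whose terms have spurious poles in \<open>u\<close>.  It equals a double sum whose terms have the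
  asserted simple poles only.  To see this, expand the dependence on \<open>v\<close> of either side by the
  \<open>q\<close>-Saalschuetz sum in functions of \<open>v\<close> alone, and compare the coefficients.  These satisfy on both
  sides the same recurrence (term by term for the single sum, by creative telescoping for the double
  sum), which reduces the comparison to a case that is another \<open>q\<close>-Saalschuetz sum.  The double
  sum, multiplied by $x^{-\mu}$ and summed over $\mu$, is a sum over \<open>k\<close> of products of three
  \<open>q\<close>-series, one for each pair $i < j$.  Heine's transformation, which follows from the
  \<open>q\<close>-binomial theorem, turns each of them into the ${}_2\phi_1$ of the formula, in which $x$ and
  $s$ play the same role.
\<close>

section \<open>The $q$-Saalschuetz summation\<close>

text \<open>The obstacle is that the two sums for p_mu agree only as wholes, in two variables at
  once. One Saalschuetz sum, with different parameters, expands the v-dependent quotients of both in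
  the same functions \<open>E v n\<close>, and the coefficients then contain only u. For fixed B
  these coefficients vanish for n > B and for A < n, so a recurrence joining n, n + 1 and A, A + 1
  determines them once the diagonal A = n is known; there j and b are forced to be n and one sum
  over k remains. Working in the field of rational functions turns the denominators behind the
  spurious poles into plain nonzero elements; poles are examined only afterwards, on the double sum.
  The arguments t and q^k t are constants, so the series at them converge because |t| < 1; the
  remaining arguments of infinite products have zero constant term, and their series are finite sums
  in each coefficient.\<close>

lemma qpoch_0 [simp]: "qpoch q z 0 = 1"
  by (simp add: qpoch_def)

lemma qpoch_Suc: "qpoch q z (Suc n) = qpoch q z n * (1 - q ^ n * z)"
  by (simp add: qpoch_def)

lemma qpoch_add: "qpoch q z (m + n) = qpoch q z m * qpoch q (q ^ m * z) n"
  by (induction n) (simp_all add: qpoch_Suc power_add mult_ac)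

lemma qpoch_Suc_left: "qpoch q z (Suc n) = (1 - z) * qpoch q (q * z) n"
  using qpoch_add[of q z 1 n] by (simp add: qpoch_Suc)

lemma qpoch_nonzero:
  fixes q z :: "'a :: idom"
  assumes "\<And>i. i < n \<Longrightarrow> q ^ i * z \<noteq> 1"
  shows "qpoch q z n \<noteq> 0"
  using assms by (auto simp: qpoch_def)

text \<open>In \<open>saalschuetz\<close> the letters \<open>P\<close> and \<open>D\<close> are q^n
  and q^(m - n). This is the termwise identity T(m+1,n) = (1 - f x q^m)(1 - f y q^m) T(m,n) + G(n+1)
  - G(n), freed of all shifted factorials by the common factor \<open>C\<close>.\<close>

lemma saalschuetz_certificate:
  fixes q :: "'a :: comm_ring_1"
  shows "C * ((1 - q * (P * D)) * (1 - f * D) * (1 - f * x * y * P * D)) =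
    (1 - f * x * (P * D)) * (1 - f * y * (P * D)) * (C * (1 - q * D)) +
    (- C * (D * f * (1 - x * P) * (1 - y * P) * (1 - q * D)) -
     - C * (D * (1 - P) * (1 - f * D) * (q - f * x * y * P)))"
  by (simp add: algebra_simps)

locale q_field =
  fixes q :: "'a :: field"
  assumes q_nonzero: "q \<noteq> 0" and q_power_neq_1: "\<And>n. q ^ Suc n \<noteq> 1"
begin

lemma qq_nonzero: "qpoch q q n \<noteq> 0"
  using q_power_neq_1 by (intro qpoch_nonzero) (metis power_Suc2)

text \<open>Reciprocals are kept as atoms: every summand is then a pure product, and changing the
  length of a denominator means multiplying by one linear factor.\<close>

definition rpoch :: "'a \<Rightarrow> nat \<Rightarrow> 'a" where
  "rpoch z n = inverse (qpoch q z n)"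

abbreviation rq :: "nat \<Rightarrow> 'a" where
  "rq \<equiv> rpoch q"

lemma rpoch_0 [simp]: "rpoch z 0 = 1"
  by (simp add: rpoch_def)

lemma rpoch_eq: "q ^ n * z \<noteq> 1 \<Longrightarrow> rpoch z n = rpoch z (Suc n) * (1 - q ^ n * z)"
  by (simp add: rpoch_def qpoch_Suc)

lemma rq_eq: "rq n = rq (Suc n) * (1 - q * q ^ n)"
  using rpoch_eq[of n q] q_power_neq_1[of n] by (simp add: mult_ac)

text \<open>
  The usual form has the factors $(q^{-m};q)_n$ and $(q^{1-m}/f;q)_n$ in place of those with index
  \<open>m - n\<close>, which need no division by \<open>f\<close>.
\<close>

lemma saalschuetz:
  "(\<Sum>n\<le>m. qpoch q q m * rq n * rq (m - n) * f ^ n * qpoch q x n * qpoch q y n *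
      qpoch q f (m - n) * qpoch q (f * x * y * q ^ n) (m - n)) = qpoch q (f * x) m * qpoch q (f * y) m"
proof (induction m)
  case 0
  show ?case by simp
next
  case (Suc m)
  define T where "T m n = qpoch q q m * rq n * rq (m - n) * f ^ n * qpoch q x n *
    qpoch q y n * qpoch q f (m - n) * qpoch q (f * x * y * q ^ n) (m - n)" for m n
  \<comment> \<open>The value 0 at n = 0 stands for 1/(q;q)_(-1) = 0; truncated subtraction would
    turn \<open>rq (n - 1)\<close> into 1 there.\<close>
  define G where "G n = (if n = 0 then 0 else - (q ^ (m + 1 - n)) * qpoch q q m *
      rq (n - 1) * rq (m + 1 - n) * f ^ n * qpoch q x n * qpoch q y n *
      qpoch q f (m + 1 - n) * qpoch q (f * x * y * q ^ (n - 1)) (m + 1 - n))" for n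
  have step: "T (Suc m) n = (1 - f * x * q ^ m) * (1 - f * y * q ^ m) * T m n + (G (Suc n) - G n)"
    if "n \<le> m" for n
  proof -
    obtain d where m: "m = n + d" using \<open>n \<le> m\<close> by (metis le_iff_add)
    define C where "C = qpoch q q m * rq n * rq (Suc d) * f ^ n * qpoch q x n *
      qpoch q y n * qpoch q f d * qpoch q (f * x * y * q ^ n) d"
    have 1: "T (Suc m) n = C * ((1 - q * (q ^ n * q ^ d)) * (1 - f * q ^ d) * (1 - f * x * y * q ^ n * q ^ d))"
      by (simp add: T_def C_def m Suc_diff_le qpoch_Suc power_add mult_ac)
    have 2: "T m n = C * (1 - q * q ^ d)"
      using rq_eq[of d] by (simp add: T_def C_def m mult_ac)
    have 3: "G (Suc n) = - C * (q ^ d * f * (1 - x * q ^ n) * (1 - y * q ^ n) * (1 - q * q ^ d))"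
      using rq_eq[of d] by (simp add: G_def C_def m qpoch_Suc mult_ac)
    have 4: "G n = - C * (q ^ d * (1 - q ^ n) * (1 - f * q ^ d) * (q - f * x * y * q ^ n))"
    proof (cases n)
      case 0
      then show ?thesis by (simp add: G_def)
    next
      case (Suc n')
      have 1: "qpoch q (f * x * y * q ^ n') (Suc d) = (1 - f * x * y * q ^ n') * qpoch q (f * x * y * q ^ n) d"
        by (simp add: Suc qpoch_Suc_left mult_ac)
      have 2: "q - f * x * y * q ^ n = q * (1 - f * x * y * q ^ n')"
        by (simp add: Suc algebra_simps)
      have 3: "rq n' = rq n * (1 - q ^ n)"
        using rq_eq[of n'] by (simp add: Suc mult_ac)
      have "m + 1 - n = Suc d" "n \<noteq> 0" "n - 1 = n'"
        using m Suc by auto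
      then show ?thesis
        unfolding G_def C_def 2 by (simp add: 1[simplified mult_ac] 3 qpoch_Suc[of q f] mult_ac)
    qed
    have m': "q ^ m = q ^ n * q ^ d" by (simp add: m power_add)
    show ?thesis unfolding 1 2 3 4 m' by (rule saalschuetz_certificate)
  qed
  have "(\<Sum>n\<le>Suc m. T (Suc m) n) = (\<Sum>n\<le>m. T (Suc m) n) + T (Suc m) (Suc m)"
    by (rule sum.atMost_Suc)
  also have "(\<Sum>n\<le>m. T (Suc m) n) =
      (1 - f * x * q ^ m) * (1 - f * y * q ^ m) * (\<Sum>n\<le>m. T m n) + (\<Sum>n\<le>m. G (Suc n) - G n)"
    by (simp add: step sum.distrib sum_distrib_left del: sum_subtractf)
  also have "(\<Sum>n\<le>m. G (Suc n) - G n) = G (Suc m) - G 0"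
    using sum_Suc_diff[of 0 m G] by (simp add: atLeast0AtMost)
  also have "G 0 = 0"
    by (simp add: G_def)
  \<comment> \<open>The term n = m + 1 lies outside the range of \<open>step\<close>; it cancels the
    upper boundary term left by the telescoping.\<close>
  also have "T (Suc m) (Suc m) = - G (Suc m)"
    using qq_nonzero by (simp add: T_def G_def rpoch_def)
  finally have "(\<Sum>n\<le>Suc m. T (Suc m) n) = (1 - f * x * q ^ m) * (1 - f * y * q ^ m) *
      (qpoch q (f * x) m * qpoch q (f * y) m)"
    using Suc by (simp add: T_def[symmetric])
  also have "\<dots> = qpoch q (f * x) (Suc m) * qpoch q (f * y) (Suc m)"
    by (simp add: qpoch_Suc mult_ac)
  finally show ?case by (simp add: T_def)
qed

end

section \<open>A creative telescoping certificate\<close>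

text \<open>The capital letters \<open>K\<close>, \<open>C\<close>, \<open>I\<close>,
  \<open>L\<close> and \<open>a\<close> are q to the powers k, c, i, l and a of
  \<open>certificate_generic\<close>, and \<open>J\<close> is q^j. The left side is the recurrence
  for one summand, the four terms on the right are the values of the two certificates at the ends of
  a step, all divided by a common factor.\<close>

lemma creative_telescoping_polynomial:
  fixes t s K a C L I w :: "'a::field"
  assumes q: "q = t * s" and J: "J = K * a * C" and u: "u = q * w * J * L"
  shows "s * I * (1 - q * K * a) * ((1 - w * J * a) * (1 - C) * (1 - t * L * K)) *
     (q * ((1 - t * u * I) * (1 - t * q * I * K)) - t * ((1 - q * I) * (1 - q * q * u * I * K)))
   - (1 - q * C * I) * (1 - q * w * q * J * I * K * a) * (s * (1 - a) * (1 - t * L * K) * (1 - t * u * I) * (1 - t * q * I * K))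
   + s * (1 - t * C * I) * (1 - t * q * w * J * I * K * a) * ((1 - a) * (1 - t * L * K) * (1 - q * I) * (1 - q * q * u * I * K))
   = I * (- q * (1 - q * K) * (1 - w * J * a) * (1 - t * J) * (1 - L) * (1 - q * I) * (1 - q * q * u * I * K)
      + s * q * a * (1 - q * K) * (1 - C) * (1 - w * J) * (1 - t * L * K) * (1 - t * u * I) * (1 - t * q * I * K)
      + q * w * J * (q * L - a * C) * (1 - s * q * K) * (1 - t * L * K) * (1 - t * q * I * K) * (1 - a) * (1 - q * I)
      - q * (L - a * C) * (1 - w * J * a) * (1 - q * K) * (1 - t * K) * (1 - q * I) * (1 - q * q * u * I * K))"
  unfolding u unfolding J unfolding q
  by algebra

text \<open>
  In the application, the field consists of the rational functions of $s_2/s_1$ and $s_3/s_2$, the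
  weight is $\mu = A\alpha_1 + B\alpha_2$, \<open>s\<close> is $q/t$, and \<open>w\<close> is such that \<open>u\<close> below is $s_2/s_1$.
\<close>

locale macd = q_field q for q :: "'a :: field" +
  fixes t s w :: 'a and B :: nat
  assumes q_eq: "q = t * s" and t_power: "\<And>n. q ^ n * t \<noteq> 1" and w_power: "\<And>n. q ^ n * w \<noteq> 1"
begin

text \<open>The exponent theta_13 - theta_23 = 2 b - B in c_3 can be negative. In terms of w it
  disappears: q^(2 b - B) u = w q^(2 b + 1).\<close>

definition u :: 'a where
  "u = q * w * q ^ B"

abbreviation rt :: "nat \<Rightarrow> 'a" where "rt \<equiv> rpoch t"

abbreviation ru :: "nat \<Rightarrow> 'a" where "ru \<equiv> rpoch (q * u)"

text \<open>Arises as (t q^l)^a from the Saalschuetz expansion times s^a from the double sum, since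
  t s = q.\<close>

definition q_pow :: "nat \<Rightarrow> nat \<Rightarrow> 'a" where
  "q_pow l a = q ^ (Suc l * a)"

lemma q_pow_Suc: "q_pow l (Suc a) = q_pow l a * q * q ^ l"
  by (simp add: q_pow_def power_add mult_ac)

lemma q_pow_Suc_left: "q_pow (Suc l) a = q_pow l a * q ^ a"
  by (simp add: q_pow_def power_add mult_ac)

lemma rt_eq: "rt n = rt (Suc n) * (1 - t * q ^ n)"
  using rpoch_eq[of n t] t_power[of n] by (simp add: mult_ac)

lemma ru_eq: "ru n = ru (Suc n) * (1 - q * u * q ^ n)"
proof -
  have "q ^ n * (q * u) \<noteq> 1"
    using w_power[of "n + 2 + B"] by (simp add: u_def power_add power2_eq_square mult_ac)
  then show ?thesis
    using rpoch_eq[of n "q * u"] by (simp add: mult_ac)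
qed

text \<open>The coefficient of \<open>E v n\<close> in the term \<open>S v A j k\<close> of the
  double sum (see \<open>S_expansion\<close>). The arguments are gaps between k, n, j, A and B, so
  that neighbouring summands differ by successor steps and no truncated subtraction
  interferes.\<close>

definition F :: "nat \<Rightarrow> nat \<Rightarrow> nat \<Rightarrow> nat \<Rightarrow> nat \<Rightarrow> 'a" where
  "F k a c i l = s ^ (i + l + c) * q_pow l a * (q * u) ^ k * qpoch q s k *
     qpoch q (w * q * q ^ (k + a + c)) a * qpoch q t (k + a + c) * qpoch q t (l + k) *
     qpoch q (t * u) i * qpoch q t (i + k) *
     (rq k * rq a * rt k * rq c * rq l * rq i * ru (i + k))"

text \<open>
  The indices \<open>k, a, c, i, l\<close> stand for \<open>k\<close>, \<open>n - k\<close>, \<open>j - n\<close>, \<open>A - j\<close>, \<open>B - j\<close>.  The functions \<open>g1\<close> and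
  \<open>g2\<close> are rational multiples of \<open>F\<close>, found by creative telescoping: they give the certificates for
  the summations over \<open>j\<close> and \<open>k\<close>.
\<close>

definition g1 :: "nat \<Rightarrow> nat \<Rightarrow> nat \<Rightarrow> nat \<Rightarrow> nat \<Rightarrow> 'a" where
  "g1 k a c i l = - (s ^ (i + l + c + 1) * q_pow l a * q ^ a * (q * u) ^ Suc k * qpoch q s (Suc k) *
     qpoch q (w * q ^ Suc (k + a + c)) a * qpoch q t (Suc (k + a + c)) * qpoch q t (l + Suc k) *
     qpoch q (t * u) i * qpoch q t (i + Suc k) *
     (rq k * rq a * rt (Suc k) * rq c * rq l * rq i * ru (i + Suc k)))"

definition g2 :: "nat \<Rightarrow> nat \<Rightarrow> nat \<Rightarrow> nat \<Rightarrow> nat \<Rightarrow> 'a" where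
  "g2 k a c i l = s ^ (i + l + c) * (q ^ l - q ^ (a + c)) * q_pow l a * (q * u) ^ Suc k *
     qpoch q s (Suc k) * qpoch q (w * q * q ^ (k + a + c)) a * qpoch q t (k + a + c) * qpoch q t (l + k) *
     qpoch q (t * u) i * qpoch q t (i + Suc k) *
     (rq k * rq a * rt k * rq c * rq l * rq i * ru (i + Suc k))"

definition T :: "nat \<Rightarrow> nat \<Rightarrow> nat \<Rightarrow> nat \<Rightarrow> 'a" where
  "T n A j k = (if n \<le> j \<and> j \<le> A \<and> j \<le> B \<and> k \<le> n
     then F k (n - k) (j - n) (A - j) (B - j) else 0)"

text \<open>The range is chosen so that the value is 0 at j = n and at j = B + 1, the ends of the
  telescoping in j. In the same way \<open>G2\<close> is 0 at k = 0 and at k = n + 2.\<close>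

definition G1 :: "nat \<Rightarrow> nat \<Rightarrow> nat \<Rightarrow> nat \<Rightarrow> 'a" where
  "G1 n A j k = (if n < j \<and> j \<le> A \<and> j \<le> B \<and> 1 \<le> k \<and> k \<le> Suc n
     then g1 (k - 1) (Suc n - k) (j - n - 1) (A - j) (B - j) else 0)"

definition G2 :: "nat \<Rightarrow> nat \<Rightarrow> nat \<Rightarrow> nat \<Rightarrow> 'a" where
  "G2 n A j k = (if n \<le> j \<and> j < A \<and> j \<le> B \<and> 1 \<le> k \<and> k \<le> Suc n
     then g2 (k - 1) (Suc n - k) (j - n) (A - j - 1) (B - j) else 0)"

text \<open>The case of positive summation index (here \<open>Suc k\<close>) and j at most A. All
  eight terms are polynomial multiples of one \<open>Z\<close>. When a term leaves its range because
  a, c or l is 0, its polynomial contains the factor 1 - q^0, so these edges obey the same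
  polynomial identity.\<close>

lemma certificate_generic:
  fixes k a c i l :: nat
  assumes B: "B = k + a + c + l"
  defines "n \<equiv> k + a" and "j \<equiv> k + a + c" and "A \<equiv> k + a + c + i"
  shows "s * q ^ A * (1 - q ^ Suc n) * (T (Suc n) (Suc A) j (Suc k) - T (Suc n) A j (Suc k)) -
     q ^ B * ((1 - q ^ (Suc A - n)) * (1 - w * q ^ (A + n + 2)) * T n (Suc A) j (Suc k) -
       s * (1 - t * q ^ (A - n)) * (1 - t * w * q ^ (A + n + 1)) * T n A j (Suc k)) =
     q ^ A * (G1 n (Suc A) (Suc j) (Suc k) - G1 n (Suc A) j (Suc k) +
       (G2 n (Suc A) j (Suc (Suc k)) - G2 n (Suc A) j (Suc k)))"
proof -
  have B': "j \<le> B" "B - j = l" "B - Suc j = l - 1" "Suc j \<le> B \<longleftrightarrow> l \<noteq> 0"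
    using B by (auto simp: j_def)
  define J where "J = q ^ j"
  define K where "K = q ^ k"
  define L where "L = q ^ l"
  define a' where "a' = q ^ a"
  define C where "C = q ^ c"
  define I where "I = q ^ i"
  note q_defs = J_def K_def L_def a'_def C_def I_def
  \<comment> \<open>For positive a, \<open>Y\<close> is \<open>q_pow l (a - 1)\<close> and
    \<open>W\<close> below is the factorial of length a - 1 starting at w q^(j + 1). Defining them
    by division keeps them meaningful for a = 0.\<close>
  define Y where "Y = q_pow l a / (q * q ^ l)"
  define W where "W = qpoch q (w * q ^ j) a / (1 - w * q ^ j)"
  \<comment> \<open>Shortest numerators and longest denominators among the eight terms, so that each
    of them is a polynomial times \<open>Z\<close>.\<close>
  define Z where "Z = s ^ (i + l + c) * (q * u) ^ k * qpoch q s (Suc k) * Y * W * qpoch q t j *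
    qpoch q t (l + k) * qpoch q (t * u) i * qpoch q t (Suc (i + k)) *
    (rq (Suc k) * rq a * rt (Suc k) * rq c * rq l * rq (Suc i) * ru (Suc (Suc (i + k))))"
  have w1: "1 - w * q ^ j \<noteq> 0" using w_power[of j] by (simp add: mult_ac)
  have Y1: "q_pow l a = Y * q * L" by (simp add: Y_def L_def q_nonzero)
  have Y2: "q_pow l a' = Y" if "a = Suc a'" for a'
    using that by (simp add: Y_def q_pow_Suc q_nonzero)
  have W1: "qpoch q (w * q ^ j) a = W * (1 - w * J)" using w1 by (simp add: W_def J_def)
  have W2: "qpoch q (w * q * q ^ j) a = W * (1 - w * J * a')"
  proof -
    have "(1 - w * q ^ j) * qpoch q (w * q * q ^ j) a = qpoch q (w * q ^ j) (Suc a)"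
      by (simp add: qpoch_Suc_left mult_ac)
    also have "\<dots> = qpoch q (w * q ^ j) a * (1 - w * J * a')"
      by (simp add: qpoch_Suc J_def a'_def mult_ac)
    finally show ?thesis using w1 by (simp add: W_def field_simps)
  qed
  have W3: "qpoch q (w * q * q ^ j) b = W" if "a = Suc b" for b
  proof -
    have "(1 - w * q ^ j) * qpoch q (w * q * q ^ j) b = qpoch q (w * q ^ j) a"
      by (simp add: that qpoch_Suc_left mult_ac)
    then show ?thesis using w1 by (simp add: W_def field_simps)
  qed
  have R: "rq k = rq (Suc k) * (1 - q * K)" "rq i = rq (Suc i) * (1 - q * I)"
    "rt k = rt (Suc k) * (1 - t * K)"
    "ru (Suc (i + k)) = ru (Suc (Suc (i + k))) * (1 - q * q * u * I * K)"
    using rq_eq[of k] rq_eq[of i] rt_eq[of k] ru_eq[of "Suc (i + k)"]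
    by (simp_all add: q_defs power_add mult_ac)
  have P: "qpoch q t (Suc (l + k)) = qpoch q t (l + k) * (1 - t * L * K)"
    "qpoch q (t * u) (Suc i) = qpoch q (t * u) i * (1 - t * u * I)"
    "qpoch q t (Suc (Suc (i + k))) = qpoch q t (Suc (i + k)) * (1 - t * q * I * K)"
    "qpoch q s (Suc (Suc k)) = qpoch q s (Suc k) * (1 - s * q * K)"
    "qpoch q t (Suc j) = qpoch q t j * (1 - t * J)"
    by (simp_all add: qpoch_Suc q_defs power_add mult_ac)
  have t1: "T (Suc n) (Suc A) j (Suc k) =
      Z * (q * u) * (q * L) * (1 - w * J * a') * (1 - C) * (1 - t * L * K) * (1 - t * u * I) * (1 - t * q * I * K)"
  proof (cases c)
    case 0
    then show ?thesis by (simp add: T_def n_def j_def C_def)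
  next
    case (Suc c')
    have "T (Suc n) (Suc A) j (Suc k) = F (Suc k) a c' (Suc i) l"
      using B'[unfolded j_def Suc] Suc by (simp add: T_def n_def j_def A_def)
    also have "Suc k + a + c' = j" by (simp add: j_def Suc)
    with rq_eq[of c'] have "F (Suc k) a c' (Suc i) l = s ^ (i + l + c) * q_pow l a * (q * u) ^ Suc k *
        qpoch q s (Suc k) * qpoch q (w * q * q ^ j) a * qpoch q t j * qpoch q t (Suc (l + k)) *
       qpoch q (t * u) (Suc i) * qpoch q t (Suc (Suc (i + k))) *
       (rq (Suc k) * rq a * rt (Suc k) * (rq c * (1 - C)) * rq l * rq (Suc i) * ru (Suc (Suc (i + k))))"
      by (simp add: F_def Suc C_def)
    finally show ?thesis unfolding P Y1 W2 Z_def by (simp add: mult_ac)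
  qed
  have t2: "T (Suc n) A j (Suc k) =
      Z * (q * u) * (t * L) * (1 - w * J * a') * (1 - C) * (1 - t * L * K) * (1 - q * I) * (1 - q * q * u * I * K)"
  proof (cases c)
    case 0
    then show ?thesis by (simp add: T_def n_def j_def C_def)
  next
    case (Suc c')
    have "T (Suc n) A j (Suc k) = F (Suc k) a c' i l"
      using B'[unfolded j_def Suc] Suc by (simp add: T_def n_def j_def A_def)
    also have "Suc k + a + c' = j" by (simp add: j_def Suc)
    with rq_eq[of c'] have "F (Suc k) a c' i l = s ^ (i + l + c') * q_pow l a * (q * u) ^ Suc k *
        qpoch q s (Suc k) * qpoch q (w * q * q ^ j) a * qpoch q t j * qpoch q t (Suc (l + k)) *
       qpoch q (t * u) i * qpoch q t (Suc (i + k)) *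
       (rq (Suc k) * rq a * rt (Suc k) * (rq c * (1 - C)) * rq l * rq i * ru (Suc (i + k)))"
      by (simp add: F_def Suc C_def)
    \<comment> \<open>This term has one power of s less than \<open>Z\<close>; the missing one is
      split off from a factor q = t s.\<close>
    also have "s ^ (i + l + c') * q_pow l a = s ^ (i + l + c) * Y * t * L"
    proof -
      have "s ^ (i + l + c') * q_pow l a = (s ^ (i + l + c') * q) * Y * L"
        by (simp add: Y1 mult_ac)
      also have "s ^ (i + l + c') * q = s ^ (i + l + c) * t"
        by (subst q_eq) (simp add: Suc)
      finally show ?thesis by (simp add: mult_ac)
    qed
    finally show ?thesis unfolding P R W2 Z_def by (simp add: mult_ac)
  qed
  have t3: "T n (Suc A) j (Suc k) =
      Z * s * (q * u) * (1 - a') * (1 - t * L * K) * (1 - t * u * I) * (1 - t * q * I * K)"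
  proof (cases a)
    case 0
    then show ?thesis by (simp add: T_def n_def j_def a'_def)
  next
    case (Suc b)
    have "T n (Suc A) j (Suc k) = F (Suc k) b c (Suc i) l"
      using B'[unfolded j_def Suc] Suc by (simp add: T_def n_def j_def A_def)
    also have "Suc k + b + c = j" by (simp add: j_def Suc)
    with rq_eq[of b] have "F (Suc k) b c (Suc i) l = s ^ Suc (i + l + c) * q_pow l b * (q * u) ^ Suc k *
        qpoch q s (Suc k) * qpoch q (w * q * q ^ j) b * qpoch q t j * qpoch q t (Suc (l + k)) *
       qpoch q (t * u) (Suc i) * qpoch q t (Suc (Suc (i + k))) *
       (rq (Suc k) * (rq a * (1 - a')) * rt (Suc k) * rq c * rq l * rq (Suc i) * ru (Suc (Suc (i + k))))"
      by (simp add: F_def Suc a'_def)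
    finally show ?thesis unfolding P W3[OF Suc] Y2[OF Suc] Z_def by (simp add: mult_ac)
  qed
  have t4: "T n A j (Suc k) =
      Z * (q * u) * (1 - a') * (1 - t * L * K) * (1 - q * I) * (1 - q * q * u * I * K)"
  proof (cases a)
    case 0
    then show ?thesis by (simp add: T_def n_def j_def a'_def)
  next
    case (Suc b)
    have "T n A j (Suc k) = F (Suc k) b c i l"
      using B'[unfolded j_def Suc] Suc by (simp add: T_def n_def j_def A_def)
    also have "Suc k + b + c = j" by (simp add: j_def Suc)
    with rq_eq[of b] have "F (Suc k) b c i l = s ^ (i + l + c) * q_pow l b * (q * u) ^ Suc k *
        qpoch q s (Suc k) * qpoch q (w * q * q ^ j) b * qpoch q t j * qpoch q t (Suc (l + k)) *
       qpoch q (t * u) i * qpoch q t (Suc (i + k)) *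
       (rq (Suc k) * (rq a * (1 - a')) * rt (Suc k) * rq c * rq l * rq i * ru (Suc (i + k)))"
      by (simp add: F_def Suc a'_def)
    finally show ?thesis unfolding P R W3[OF Suc] Y2[OF Suc] Z_def by (simp add: mult_ac)
  qed
  have h1: "G1 n (Suc A) (Suc j) (Suc k) = - (Z * (q * u) * (q * L) * (1 - q * K) * (1 - w * J * a') *
      (1 - t * J) * (1 - L) * (1 - q * I) * (1 - q * q * u * I * K))"
  proof (cases l)
    case 0
    then show ?thesis using B'(4) 0 by (simp add: G1_def L_def)
  next
    case (Suc m)
    have "G1 n (Suc A) (Suc j) (Suc k) = g1 k a c i m"
      using B'[unfolded j_def Suc] Suc by (simp add: G1_def n_def j_def A_def)
    also have "k + a + c = j" by (simp add: j_def)
    with rq_eq[of m] have "g1 k a c i m = - (s ^ (i + l + c) * (q_pow m a * q ^ a) * (q * u) ^ Suc k *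
        qpoch q s (Suc k) * qpoch q (w * q * q ^ j) a * qpoch q t (Suc j) * qpoch q t (l + k) *
       qpoch q (t * u) i * qpoch q t (Suc (i + k)) *
       (rq k * rq a * rt (Suc k) * rq c * (rq l * (1 - L)) * rq i * ru (Suc (i + k))))"
      by (simp add: g1_def Suc L_def mult.assoc)
    also have "q_pow m a * q ^ a = Y * q * L"
      using q_pow_Suc_left[of m a] by (simp add: Y1 flip: Suc)
    finally show ?thesis unfolding P R W2 Z_def by (simp add: mult_ac)
  qed
  have h2: "G1 n (Suc A) j (Suc k) = - (Z * s * (q * u) * (q * L * a') * (1 - q * K) * (1 - C) * (1 - w * J) *
      (1 - t * L * K) * (1 - t * u * I) * (1 - t * q * I * K))"
  proof (cases c)
    case 0
    then show ?thesis by (simp add: G1_def n_def j_def C_def)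
  next
    case (Suc c')
    have "G1 n (Suc A) j (Suc k) = g1 k a c' (Suc i) l"
      using B'[unfolded j_def Suc] Suc by (simp add: G1_def n_def j_def A_def)
    also have "Suc (k + a + c') = j" by (simp add: j_def Suc)
    with rq_eq[of c'] have "g1 k a c' (Suc i) l = - (s ^ Suc (i + l + c) * q_pow l a * a' * (q * u) ^ Suc k *
        qpoch q s (Suc k) * qpoch q (w * q ^ j) a * qpoch q t j * qpoch q t (Suc (l + k)) *
       qpoch q (t * u) (Suc i) * qpoch q t (Suc (Suc (i + k))) *
       (rq k * rq a * rt (Suc k) * (rq c * (1 - C)) * rq l * rq (Suc i) * ru (Suc (Suc (i + k)))))"
      by (simp add: g1_def Suc C_def a'_def)
    finally show ?thesis unfolding P R W1 Y1 Z_def by (simp add: mult_ac)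
  qed
  have h3: "G2 n (Suc A) j (Suc (Suc k)) = Z * (q * u) * u * (q * L - a' * C) * (1 - s * q * K) *
      (1 - t * L * K) * (1 - t * q * I * K) * (1 - a') * (1 - q * I)"
  proof (cases a)
    case 0
    then show ?thesis by (simp add: G2_def n_def j_def a'_def)
  next
    case (Suc b)
    have "G2 n (Suc A) j (Suc (Suc k)) = g2 (Suc k) b c i l"
      using B'[unfolded j_def Suc] Suc by (simp add: G2_def n_def j_def A_def)
    also have "Suc k + b + c = j" by (simp add: j_def Suc)
    with rq_eq[of b] have "g2 (Suc k) b c i l = s ^ (i + l + c) * (q ^ l - q ^ (b + c)) * q_pow l b * (q * u) ^ Suc (Suc k) *
        qpoch q s (Suc (Suc k)) * qpoch q (w * q * q ^ j) b * qpoch q t j * qpoch q t (Suc (l + k)) *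
       qpoch q (t * u) i * qpoch q t (Suc (Suc (i + k))) *
       (rq (Suc k) * (rq a * (1 - a')) * rt (Suc k) * rq c * rq l * rq i * ru (Suc (Suc (i + k))))"
      by (simp add: g2_def Suc a'_def)
    also have "\<dots> = s ^ (i + l + c) * (q * (q ^ l - q ^ (b + c))) * q_pow l b * (u * (q * u) ^ Suc k) *
        qpoch q s (Suc (Suc k)) * qpoch q (w * q * q ^ j) b * qpoch q t j * qpoch q t (Suc (l + k)) *
       qpoch q (t * u) i * qpoch q t (Suc (Suc (i + k))) *
       (rq (Suc k) * (rq a * (1 - a')) * rt (Suc k) * rq c * rq l * rq i * ru (Suc (Suc (i + k))))"
      by (simp add: mult_ac)
    also have "q * (q ^ l - q ^ (b + c)) = q * L - a' * C"
      by (simp add: L_def a'_def C_def Suc power_add algebra_simps)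
    finally show ?thesis unfolding P R(2) W3[OF Suc] Y2[OF Suc] Z_def by (simp add: mult_ac)
  qed
  have h4: "G2 n (Suc A) j (Suc k) = Z * (q * u) * (q * L) * (L - a' * C) * (1 - w * J * a') * (1 - q * K) *
      (1 - t * K) * (1 - q * I) * (1 - q * q * u * I * K)"
  proof -
    have "G2 n (Suc A) j (Suc k) = g2 k a c i l"
      using B'[unfolded j_def] by (simp add: G2_def n_def j_def A_def)
    also have "k + a + c = j" by (simp add: j_def)
    then have "g2 k a c i l = s ^ (i + l + c) * (L - a' * C) * q_pow l a * (q * u) ^ Suc k *
        qpoch q s (Suc k) * qpoch q (w * q * q ^ j) a * qpoch q t j * qpoch q t (l + k) *
       qpoch q (t * u) i * qpoch q t (Suc (i + k)) *
       (rq k * rq a * rt k * rq c * rq l * rq i * ru (Suc (i + k)))"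
      by (simp add: g2_def L_def a'_def C_def power_add)
    finally show ?thesis unfolding P R W2 Y1 Z_def by (simp add: mult_ac)
  qed
  have powers: "q ^ A = J * I" "q ^ Suc n = q * K * a'" "q ^ B = J * L" "q ^ (Suc A - n) = q * C * I"
    "w * q ^ (A + n + 2) = w * q * q * J * I * K * a'" "q ^ (A - n) = C * I"
    "t * w * q ^ (A + n + 1) = t * q * w * J * I * K * a'"
    by (simp_all add: A_def n_def j_def B q_defs power_add mult_ac power2_eq_square)
  have J: "J = K * a' * C" and u: "u = q * w * J * L"
    by (simp_all only: u_def) (simp_all add: q_defs j_def B power_add mult_ac)
  have h3': "G2 n (Suc A) j (Suc (Suc k)) = Z * (q * u) * (q * w * J * L) * (q * L - a' * C) * (1 - s * q * K) *
      (1 - t * L * K) * (1 - t * q * I * K) * (1 - a') * (1 - q * I)"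
    unfolding h3 by (simp flip: u)
  note poly = creative_telescoping_polynomial[OF q_eq J u, of I]
  have "s * q ^ A * (1 - q ^ Suc n) * (T (Suc n) (Suc A) j (Suc k) - T (Suc n) A j (Suc k)) -
     q ^ B * ((1 - q ^ (Suc A - n)) * (1 - w * q ^ (A + n + 2)) * T n (Suc A) j (Suc k) -
       s * (1 - t * q ^ (A - n)) * (1 - t * w * q ^ (A + n + 1)) * T n A j (Suc k)) =
     Z * (q * u) * L * J * (s * I * (1 - q * K * a') * ((1 - w * J * a') * (1 - C) * (1 - t * L * K)) *
     (q * ((1 - t * u * I) * (1 - t * q * I * K)) - t * ((1 - q * I) * (1 - q * q * u * I * K)))
   - (1 - q * C * I) * (1 - q * w * q * J * I * K * a') * (s * (1 - a') * (1 - t * L * K) * (1 - t * u * I) * (1 - t * q * I * K))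
   + s * (1 - t * C * I) * (1 - t * q * w * J * I * K * a') * ((1 - a') * (1 - t * L * K) * (1 - q * I) * (1 - q * q * u * I * K)))"
    unfolding t1 t2 t3 t4 powers by algebra
  also have "\<dots> = q ^ A * (G1 n (Suc A) (Suc j) (Suc k) - G1 n (Suc A) j (Suc k) +
       (G2 n (Suc A) j (Suc (Suc k)) - G2 n (Suc A) j (Suc k)))"
    unfolding poly h1 h2 h3' h4 powers by algebra
  finally show ?thesis .
qed

text \<open>With no index k - 1 to refer to, the common factor is a different one. Both values of
  \<open>G1\<close> and the lower value of \<open>G2\<close> are 0, so the value of
  \<open>G2\<close> at 1 alone balances the recurrence.\<close>

lemma certificate_k_0:
  fixes n c i l :: nat
  assumes B: "B = n + c + l"
  defines "j \<equiv> n + c" and "A \<equiv> n + c + i"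
  shows "s * q ^ A * (1 - q ^ Suc n) * (T (Suc n) (Suc A) j 0 - T (Suc n) A j 0) -
     q ^ B * ((1 - q ^ (Suc A - n)) * (1 - w * q ^ (A + n + 2)) * T n (Suc A) j 0 -
       s * (1 - t * q ^ (A - n)) * (1 - t * w * q ^ (A + n + 1)) * T n A j 0) =
     q ^ A * (G1 n (Suc A) (Suc j) 0 - G1 n (Suc A) j 0 +
       (G2 n (Suc A) j (Suc 0) - G2 n (Suc A) j 0))"
proof -
  have B': "j \<le> B" "B - j = l"
    using B by (auto simp: j_def)
  define J where "J = q ^ j"
  define L where "L = q ^ l"
  define N where "N = q ^ n"
  define C where "C = q ^ c"
  define I where "I = q ^ i"
  note q_defs = J_def L_def N_def C_def I_def
  define Z where "Z = s ^ (i + l + c) * q_pow l n * qpoch q (w * q * q ^ j) n * qpoch q t j *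
    qpoch q t l * qpoch q (t * u) i * qpoch q t i *
    (rq (Suc n) * rq c * rq l * rq (Suc i) * ru (Suc i))"
  have R: "rq i = rq (Suc i) * (1 - q * I)" "rq n = rq (Suc n) * (1 - q * N)"
    "ru i = ru (Suc i) * (1 - q * u * I)"
    using rq_eq[of i] rq_eq[of n] ru_eq[of i] by (simp_all add: q_defs)
  have P: "qpoch q (t * u) (Suc i) = qpoch q (t * u) i * (1 - t * u * I)"
    "qpoch q t (Suc i) = qpoch q t i * (1 - t * I)"
    "qpoch q (w * q * q ^ j) (Suc n) = qpoch q (w * q * q ^ j) n * (1 - w * q * J * N)"
    "q_pow l (Suc n) = q_pow l n * q * L"
    by (simp_all add: qpoch_Suc q_pow_Suc q_defs mult_ac)
  have t1: "T (Suc n) (Suc A) j 0 = Z * (q * L) * (1 - w * q * J * N) * (1 - C) * (1 - t * u * I) * (1 - t * I)"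
  proof (cases c)
    case 0
    then show ?thesis by (simp add: T_def j_def C_def)
  next
    case (Suc c')
    have "T (Suc n) (Suc A) j 0 = F 0 (Suc n) c' (Suc i) l"
      using B'[unfolded j_def Suc] Suc by (simp add: T_def j_def A_def)
    also have "0 + Suc n + c' = j" by (simp add: j_def Suc)
    with rq_eq[of c'] have "F 0 (Suc n) c' (Suc i) l = s ^ (i + l + c) * q_pow l (Suc n) *
        qpoch q (w * q * q ^ j) (Suc n) * qpoch q t j * qpoch q t l *
       qpoch q (t * u) (Suc i) * qpoch q t (Suc i) *
       (rq (Suc n) * (rq c * (1 - C)) * rq l * rq (Suc i) * ru (Suc i))"
      by (simp add: F_def Suc C_def)
    finally show ?thesis unfolding P Z_def by (simp add: mult_ac)
  qed
  have t2: "T (Suc n) A j 0 = Z * (t * L) * (1 - w * q * J * N) * (1 - C) * (1 - q * I) * (1 - q * u * I)"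
  proof (cases c)
    case 0
    then show ?thesis by (simp add: T_def j_def C_def)
  next
    case (Suc c')
    have "T (Suc n) A j 0 = F 0 (Suc n) c' i l"
      using B'[unfolded j_def Suc] Suc by (simp add: T_def j_def A_def)
    also have "0 + Suc n + c' = j" by (simp add: j_def Suc)
    with rq_eq[of c'] have "F 0 (Suc n) c' i l = s ^ (i + l + c') * q_pow l (Suc n) *
        qpoch q (w * q * q ^ j) (Suc n) * qpoch q t j * qpoch q t l *
       qpoch q (t * u) i * qpoch q t i *
       (rq (Suc n) * (rq c * (1 - C)) * rq l * rq i * ru i)"
      by (simp add: F_def Suc C_def)
    also have "s ^ (i + l + c') * q_pow l (Suc n) = s ^ (i + l + c) * q_pow l n * t * L"
    proof -
      have "s ^ (i + l + c') * q_pow l (Suc n) = (s ^ (i + l + c') * q) * q_pow l n * L"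
        by (simp add: P mult_ac)
      also have "s ^ (i + l + c') * q = s ^ (i + l + c) * t"
        by (subst q_eq) (simp add: Suc)
      finally show ?thesis by (simp add: mult_ac)
    qed
    finally show ?thesis unfolding P R Z_def by (simp add: mult_ac)
  qed
  have t3: "T n (Suc A) j 0 = Z * s * (1 - q * N) * (1 - t * u * I) * (1 - t * I)"
  proof -
    have "T n (Suc A) j 0 = F 0 n c (Suc i) l"
      using B'[unfolded j_def] by (simp add: T_def j_def A_def)
    also have "\<dots> = s ^ Suc (i + l + c) * q_pow l n *
        qpoch q (w * q * q ^ j) n * qpoch q t j * qpoch q t l *
       qpoch q (t * u) (Suc i) * qpoch q t (Suc i) *
       (rq n * rq c * rq l * rq (Suc i) * ru (Suc i))"
      by (simp add: F_def flip: j_def)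
    finally show ?thesis unfolding P R Z_def by (simp add: mult_ac)
  qed
  have t4: "T n A j 0 = Z * (1 - q * N) * (1 - q * I) * (1 - q * u * I)"
  proof -
    have "T n A j 0 = F 0 n c i l"
      using B'[unfolded j_def] by (simp add: T_def j_def A_def)
    also have "\<dots> = s ^ (i + l + c) * q_pow l n *
        qpoch q (w * q * q ^ j) n * qpoch q t j * qpoch q t l *
       qpoch q (t * u) i * qpoch q t i * (rq n * rq c * rq l * rq i * ru i)"
      by (simp add: F_def flip: j_def)
    finally show ?thesis unfolding P R Z_def by (simp add: mult_ac)
  qed
  have h: "G2 n (Suc A) j (Suc 0) = Z * (q * u) * (L - N * C) * (1 - s) * (1 - t * I) * (1 - q * N) * (1 - q * I)"
  proof -
    have "G2 n (Suc A) j (Suc 0) = g2 0 n c i l"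
      using B'[unfolded j_def] by (simp add: G2_def j_def A_def)
    also have "\<dots> = s ^ (i + l + c) * (L - J) * q_pow l n * (q * u) * (1 - s) *
        qpoch q (w * q * q ^ j) n * qpoch q t j * qpoch q t l *
       qpoch q (t * u) i * qpoch q t (Suc i) * (rq n * rq c * rq l * rq i * ru (Suc i))"
      by (simp add: g2_def qpoch_Suc[of q s] L_def J_def flip: j_def)
    also have "L - J = L - N * C"
      by (simp add: J_def N_def C_def j_def power_add)
    finally show ?thesis unfolding P R(1,2) Z_def by (simp add: mult_ac)
  qed
  have z: "G1 n (Suc A) (Suc j) 0 = 0" "G1 n (Suc A) j 0 = 0" "G2 n (Suc A) j 0 = 0"
    by (simp_all add: G1_def G2_def)
  have powers: "q ^ A = J * I" "q ^ Suc n = q * N" "q ^ B = J * L" "q ^ (Suc A - n) = q * C * I"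
    "w * q ^ (A + n + 2) = w * q * q * J * I * N" "q ^ (A - n) = C * I"
    "t * w * q ^ (A + n + 1) = t * q * w * J * I * N"
    by (simp_all add: A_def j_def B q_defs power_add mult_ac power2_eq_square)
  have J: "J = N * C" and u: "u = q * w * J * L"
    by (simp_all only: u_def) (simp_all add: q_defs j_def B power_add mult_ac)
  have h': "G2 n (Suc A) j (Suc 0) = Z * (q * (q * w * J * L)) * (L - N * C) * (1 - s) * (1 - t * I) * (1 - q * N) * (1 - q * I)"
    unfolding h by (simp flip: u)
  show ?thesis
    unfolding t1 t2 t3 t4 h' z powers unfolding u unfolding J q_eq by algebra
qed

text \<open>The edge j = A + 1: the terms with the smaller weight A are absent, and of the
  certificates only the lower boundary value of \<open>G1\<close> survives.\<close>

lemma certificate_last: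
  fixes k a c l :: nat
  defines "n \<equiv> k + a" and "A \<equiv> k + a + c"
  assumes B: "B = Suc A + l"
  shows "s * q ^ A * (1 - q ^ Suc n) * T (Suc n) (Suc A) (Suc A) (Suc k) -
     q ^ B * (1 - q ^ (Suc A - n)) * (1 - w * q ^ (A + n + 2)) * T n (Suc A) (Suc A) (Suc k) =
     - (q ^ A * G1 n (Suc A) (Suc A) (Suc k))"
proof -
  have B': "Suc A \<le> B" "B - Suc A = l"
    using B by auto
  define P where "P = q ^ A"
  define K where "K = q ^ k"
  define L where "L = q ^ l"
  define a' where "a' = q ^ a"
  define C where "C = q ^ Suc c"
  note q_defs = P_def K_def L_def a'_def C_def
  define Y where "Y = q_pow l a / (q * q ^ l)"
  define W where "W = qpoch q (w * q ^ Suc A) a / (1 - w * q ^ Suc A)"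
  define Z where "Z = s ^ (l + c) * (q * u) ^ Suc k * qpoch q s (Suc k) * Y * W * qpoch q t (Suc A) *
    qpoch q t (l + Suc k) * qpoch q t (Suc k) *
    (rq (Suc k) * rq a * rt (Suc k) * rq (Suc c) * rq l * ru (Suc k))"
  have w1: "1 - w * q ^ Suc A \<noteq> 0" using w_power[of "Suc A"] by (simp add: mult_ac)
  have Y1: "q_pow l a = Y * q * L" by (simp add: Y_def L_def q_nonzero)
  have Y2: "q_pow l a' = Y" if "a = Suc a'" for a'
    using that by (simp add: Y_def q_pow_Suc q_nonzero)
  have W1: "qpoch q (w * q ^ Suc A) a = W * (1 - w * q * P)" using w1 by (simp add: W_def P_def mult.assoc)
  have W2: "qpoch q (w * q * q ^ Suc A) a = W * (1 - w * q * P * a')"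
  proof -
    have "(1 - w * q ^ Suc A) * qpoch q (w * q * q ^ Suc A) a = qpoch q (w * q ^ Suc A) (Suc a)"
      by (simp add: qpoch_Suc_left mult_ac)
    also have "\<dots> = qpoch q (w * q ^ Suc A) a * (1 - w * q * P * a')"
      by (simp add: qpoch_Suc P_def a'_def mult_ac)
    finally show ?thesis using w1 by (simp add: W_def field_simps)
  qed
  have W3: "qpoch q (w * q * q ^ Suc A) b = W" if "a = Suc b" for b
  proof -
    have "(1 - w * q ^ Suc A) * qpoch q (w * q * q ^ Suc A) b = qpoch q (w * q ^ Suc A) a"
      by (simp add: that qpoch_Suc_left mult_ac)
    then show ?thesis using w1 by (simp add: W_def field_simps)
  qed
  have R: "rq k = rq (Suc k) * (1 - q * K)" "rq c = rq (Suc c) * (1 - C)"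
    using rq_eq[of k] rq_eq[of c] by (simp_all add: q_defs)
  have t1: "T (Suc n) (Suc A) (Suc A) (Suc k) = Z * (q * L) * (1 - w * q * P * a') * (1 - C)"
  proof -
    have "T (Suc n) (Suc A) (Suc A) (Suc k) = F (Suc k) a c 0 l"
      using B' by (simp add: T_def n_def A_def)
    also have "Suc k + a + c = Suc A" by (simp add: A_def)
    then have "F (Suc k) a c 0 l = s ^ (l + c) * q_pow l a * (q * u) ^ Suc k *
        qpoch q s (Suc k) * qpoch q (w * q * q ^ Suc A) a * qpoch q t (Suc A) * qpoch q t (l + Suc k) *
       qpoch q t (Suc k) *
       (rq (Suc k) * rq a * rt (Suc k) * rq c * rq l * ru (Suc k))"
      by (simp add: F_def)
    finally show ?thesis unfolding W2 Y1 R Z_def by (simp add: mult_ac)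
  qed
  have t3: "T n (Suc A) (Suc A) (Suc k) = Z * s * (1 - a')"
  proof (cases a)
    case 0
    then show ?thesis by (simp add: T_def n_def a'_def)
  next
    case (Suc b)
    have "T n (Suc A) (Suc A) (Suc k) = F (Suc k) b (Suc c) 0 l"
      using B'[unfolded A_def Suc] Suc by (simp add: T_def n_def A_def)
    also have "Suc k + b + Suc c = Suc A" by (simp add: A_def Suc)
    with rq_eq[of b] have "F (Suc k) b (Suc c) 0 l = s ^ Suc (l + c) * q_pow l b * (q * u) ^ Suc k *
        qpoch q s (Suc k) * qpoch q (w * q * q ^ Suc A) b * qpoch q t (Suc A) * qpoch q t (l + Suc k) *
       qpoch q t (Suc k) *
       (rq (Suc k) * (rq a * (1 - a')) * rt (Suc k) * rq (Suc c) * rq l * ru (Suc k))"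
      by (simp add: F_def Suc a'_def)
    finally show ?thesis unfolding W3[OF Suc] Y2[OF Suc] Z_def by (simp add: mult_ac)
  qed
  have h: "G1 n (Suc A) (Suc A) (Suc k) = - (Z * s * (q * L * a') * (1 - q * K) * (1 - C) * (1 - w * q * P))"
  proof -
    have "G1 n (Suc A) (Suc A) (Suc k) = g1 k a c 0 l"
      using B' by (simp add: G1_def n_def A_def)
    also have "\<dots> = - (s ^ Suc (l + c) * q_pow l a * a' * (q * u) ^ Suc k *
        qpoch q s (Suc k) * qpoch q (w * q ^ Suc A) a * qpoch q t (Suc A) * qpoch q t (l + Suc k) *
       qpoch q t (Suc k) *
       (rq k * rq a * rt (Suc k) * rq c * rq l * ru (Suc k)))"
      by (simp add: g1_def a'_def flip: A_def)
    finally show ?thesis unfolding W1 Y1 R Z_def by (simp add: mult_ac)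
  qed
  have powers: "q ^ A = P" "q ^ Suc n = q * K * a'" "q ^ B = q * P * L" "q ^ (Suc A - n) = C"
    "w * q ^ (A + n + 2) = w * q * q * P * K * a'"
    using B by (simp_all add: A_def n_def q_defs power_add mult_ac power2_eq_square)
  show ?thesis
    unfolding t1 t3 h powers by algebra
qed

lemma certificate_last_k_0:
  fixes n c l :: nat
  defines "A \<equiv> n + c"
  assumes B: "B = Suc A + l"
  shows "s * q ^ A * (1 - q ^ Suc n) * T (Suc n) (Suc A) (Suc A) 0 =
     q ^ B * (1 - q ^ (Suc A - n)) * (1 - w * q ^ (A + n + 2)) * T n (Suc A) (Suc A) 0"
proof -
  have B': "Suc A \<le> B" "B - Suc A = l"
    using B by auto
  define W where "W = qpoch q (w * q * q ^ Suc A) n"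
  have t1: "T (Suc n) (Suc A) (Suc A) 0 = F 0 (Suc n) c 0 l"
    using B' by (simp add: T_def A_def)
  have t3: "T n (Suc A) (Suc A) 0 = F 0 n (Suc c) 0 l"
    using B' by (simp add: T_def A_def)
  have W: "qpoch q (w * q * q ^ Suc A) (Suc n) = W * (1 - w * q ^ (A + n + 2))"
    by (simp add: W_def qpoch_Suc power_add power2_eq_square mult_ac)
  have F1: "F 0 (Suc n) c 0 l = s ^ (l + c) * (q_pow l n * q * q ^ l) * (W * (1 - w * q ^ (A + n + 2))) *
      qpoch q t (Suc A) * qpoch q t l * (rq (Suc n) * (rq (Suc c) * (1 - q ^ Suc c)) * rq l)"
    using W rq_eq[of c] by (simp add: F_def q_pow_Suc A_def)
  have F2: "F 0 n (Suc c) 0 l = s ^ Suc (l + c) * q_pow l n * W *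
      qpoch q t (Suc A) * qpoch q t l * (rq (Suc n) * (1 - q ^ Suc n) * rq (Suc c) * rq l)"
    using rq_eq[of n] by (simp add: F_def W_def A_def)
  have "q ^ (Suc A - n) = q ^ Suc c" "q ^ B = q ^ A * q * q ^ l"
    using B by (simp_all add: A_def power_add mult_ac)
  then show ?thesis
    unfolding t1 t3 F1 F2 by (simp add: mult_ac)
qed

lemma certificate:
  assumes "n \<le> j" "n \<le> A" "j \<le> Suc A" "j \<le> B" "k \<le> Suc n"
  shows "s * q ^ A * (1 - q ^ Suc n) * (T (Suc n) (Suc A) j k - T (Suc n) A j k) -
     q ^ B * ((1 - q ^ (Suc A - n)) * (1 - w * q ^ (A + n + 2)) * T n (Suc A) j k -
       s * (1 - t * q ^ (A - n)) * (1 - t * w * q ^ (A + n + 1)) * T n A j k) =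
     q ^ A * (G1 n (Suc A) (Suc j) k - G1 n (Suc A) j k +
       (G2 n (Suc A) j (Suc k) - G2 n (Suc A) j k))"
proof -
  obtain c where c: "j = n + c" using assms(1) by (metis le_iff_add)
  obtain l where l: "B = j + l" using assms(4) by (metis le_iff_add)
  show ?thesis
  proof (cases "j = Suc A")
    case True
    then obtain c' where c': "c = Suc c'" using assms c by (cases c) auto
    have A: "A = n + c'" using True c c' by simp
    have z: "T (Suc n) A j k = 0" "T n A j k = 0" "G1 n (Suc A) (Suc j) k = 0"
      "G2 n (Suc A) j (Suc k) = 0" "G2 n (Suc A) j k = 0"
      using True by (simp_all add: T_def G1_def G2_def)
    show ?thesis
    proof (cases k)
      case 0
      have "G1 n (Suc A) j k = 0" by (simp add: 0 G1_def)
      then show ?thesis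
        using certificate_last_k_0[of n c' l] l z A True by (simp add: 0 mult.assoc)
    next
      case (Suc k')
      obtain a where "n = k' + a" using assms(5) Suc by (metis Suc_le_mono le_iff_add)
      then show ?thesis
        using certificate_last[of k' a c' l] l z A True by (simp add: Suc mult.assoc)
    qed
  next
    case False
    then obtain i where i: "A = j + i" using assms(3) by (metis le_SucE le_iff_add)
    show ?thesis
    proof (cases k)
      case 0
      then show ?thesis
        using certificate_k_0[of n c l i] l i c by simp
    next
      case (Suc k')
      obtain a where "n = k' + a" using assms(5) Suc by (metis Suc_le_mono le_iff_add)
      then show ?thesis
        using certificate_generic[of k' a c l i] l i c Suc by simp
    qed
  qed
qed

section \<open>Two solutions of the same recurrence\<close>

text \<open>The coefficient of \<open>E v n\<close> in the double sum.\<close>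

definition R :: "nat \<Rightarrow> nat \<Rightarrow> 'a" where
  "R n A = (\<Sum>j\<le>B. \<Sum>k\<le>n. T n A j k)"

text \<open>All four sums are padded with zero terms to the same rectangle n <= j <= B, k <= n + 1.
  On it the certificates telescope to 0, \<open>G1\<close> in j and \<open>G2\<close> in k.\<close>

lemma R_recurrence:
  assumes "n \<le> A"
  shows "s * q ^ A * (1 - q ^ Suc n) * (R (Suc n) (Suc A) - R (Suc n) A) =
     q ^ B * ((1 - q ^ (Suc A - n)) * (1 - w * q ^ (A + n + 2)) * R n (Suc A) -
       s * (1 - t * q ^ (A - n)) * (1 - t * w * q ^ (A + n + 1)) * R n A)"
proof (cases "n \<le> B")
  case True
  have R_eq: "R m D = (\<Sum>j=n..B. \<Sum>k\<le>Suc n. T m D j k)" if "m = n \<or> m = Suc n" for m D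
  proof -
    have "R m D = (\<Sum>j\<le>B. \<Sum>k\<le>Suc n. T m D j k)"
      unfolding R_def using that by (intro sum.cong sum.mono_neutral_left) (auto simp: T_def)
    also have "\<dots> = (\<Sum>j=n..B. \<Sum>k\<le>Suc n. T m D j k)"
      using that by (intro sum.mono_neutral_right) (auto simp: T_def)
    finally show ?thesis .
  qed
  define e where "e j k = G1 n (Suc A) (Suc j) k - G1 n (Suc A) j k +
    (G2 n (Suc A) j (Suc k) - G2 n (Suc A) j k)" for j k
  have cert: "s * q ^ A * (1 - q ^ Suc n) * (T (Suc n) (Suc A) j k - T (Suc n) A j k) -
     q ^ B * ((1 - q ^ (Suc A - n)) * (1 - w * q ^ (A + n + 2)) * T n (Suc A) j k -
       s * (1 - t * q ^ (A - n)) * (1 - t * w * q ^ (A + n + 1)) * T n A j k) = q ^ A * e j k"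
    if "j \<in> {n..B}" "k \<le> Suc n" for j k
  proof (cases "j \<le> Suc A")
    case True
    then show ?thesis
      unfolding e_def using certificate[of n j A k] that assms by auto
  next
    case False
    then show ?thesis by (simp add: e_def T_def G1_def G2_def)
  qed
  have g1: "(\<Sum>j=n..B. G1 n (Suc A) (Suc j) k - G1 n (Suc A) j k) = 0" for k
    using True by (subst sum_Suc_diff) (auto simp: G1_def)
  have g2: "(\<Sum>k\<le>Suc n. G2 n (Suc A) j (Suc k) - G2 n (Suc A) j k) = 0" for j
    unfolding atMost_atLeast0 by (subst sum_Suc_diff) (auto simp: G2_def)
  have "s * q ^ A * (1 - q ^ Suc n) * (R (Suc n) (Suc A) - R (Suc n) A) -
     q ^ B * ((1 - q ^ (Suc A - n)) * (1 - w * q ^ (A + n + 2)) * R n (Suc A) -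
       s * (1 - t * q ^ (A - n)) * (1 - t * w * q ^ (A + n + 1)) * R n A) =
     (\<Sum>j=n..B. \<Sum>k\<le>Suc n. s * q ^ A * (1 - q ^ Suc n) * (T (Suc n) (Suc A) j k - T (Suc n) A j k) -
     q ^ B * ((1 - q ^ (Suc A - n)) * (1 - w * q ^ (A + n + 2)) * T n (Suc A) j k -
       s * (1 - t * q ^ (A - n)) * (1 - t * w * q ^ (A + n + 1)) * T n A j k))"
    by (simp only: R_eq simp_thms sum_subtractf sum_distrib_left[symmetric])
  also have "\<dots> = (\<Sum>j=n..B. \<Sum>k\<le>Suc n. q ^ A * e j k)"
    by (intro sum.cong refl cert) auto
  also have "\<dots> = q ^ A * (\<Sum>j=n..B. \<Sum>k\<le>Suc n. e j k)"
    by (simp only: sum_distrib_left)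
  also have "(\<Sum>j=n..B. \<Sum>k\<le>Suc n. e j k) =
      (\<Sum>k\<le>Suc n. \<Sum>j=n..B. G1 n (Suc A) (Suc j) k - G1 n (Suc A) j k) +
      (\<Sum>j=n..B. \<Sum>k\<le>Suc n. G2 n (Suc A) j (Suc k) - G2 n (Suc A) j k)"
    unfolding e_def sum.distrib by (subst sum.swap) (rule refl)
  finally show ?thesis by (simp only: g1 g2 sum.neutral_const) simp
next
  case False
  then show ?thesis by (simp add: R_def T_def)
qed

text \<open>
  \<open>P A b\<close> is the part of the term $\theta_{13} = b$ of $p_\mu$ that does not depend on $s_3/s_2$.
\<close>

definition P :: "nat \<Rightarrow> nat \<Rightarrow> 'a" where
  "P A b = (if b \<le> A then s ^ (A + B - b) * qpoch q t (A - b) * qpoch q t b * qpoch q t (B - b) *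
     qpoch q (t * w * q ^ (2 * b + 1)) (A - b) * qpoch q (t * u) b * qpoch q (s * w * q ^ (b + 1)) b *
     (rq (A - b) * rq b * rq (B - b) * rpoch (w * q ^ (2 * b + 2)) (A - b) * ru b * rpoch (w * q ^ (b + 1)) b)
   else 0)"

text \<open>Connection coefficients: the v-dependent quotient in the term b of the single sum is the
  sum over n of \<open>E v n * conn_coeff n b\<close>. The formula is \<open>v_expansion\<close>
  with its k equal to 0.\<close>

definition conn_coeff :: "nat \<Rightarrow> nat \<Rightarrow> 'a" where
  "conn_coeff n b = (if n \<le> b then qpoch q q b * rq n * rq (b - n) * (t * q ^ (B - b)) ^ n * qpoch q (w * q ^ (b + 1)) n else 0)"

text \<open>The coefficient of \<open>E v n\<close> in the single sum.\<close>

definition X :: "nat \<Rightarrow> nat \<Rightarrow> 'a" where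
  "X n A = (\<Sum>b\<le>B. P A b * conn_coeff n b)"

lemma conn_coeff_Suc:
  assumes "B = n + d + l"
  shows "(1 - q ^ Suc n) * conn_coeff (Suc n) (n + d) =
    (1 - q ^ d) * (t * q ^ l) * (1 - w * q ^ (n + d + n + 1)) * conn_coeff n (n + d)"
proof (cases d)
  case 0
  then show ?thesis by (simp add: conn_coeff_def)
next
  case (Suc d')
  have l: "B - (n + d) = l" using assms by simp
  have "(1 - q ^ Suc n) * conn_coeff (Suc n) (n + d) = qpoch q q (n + d) * (rq (Suc n) * (1 - q ^ Suc n)) * rq d' *
      (t * q ^ l) ^ Suc n * qpoch q (w * q ^ (n + d + 1)) (Suc n)"
    by (simp only: conn_coeff_def l) (simp add: Suc mult_ac)
  also have "\<dots> = qpoch q q (n + d) * rq n * (rq d * (1 - q ^ d)) *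
      (t * q ^ l) ^ Suc n * qpoch q (w * q ^ (n + d + 1)) (Suc n)"
    using rq_eq[of n] rq_eq[of d'] by (simp add: Suc)
  also have "qpoch q (w * q ^ (n + d + 1)) (Suc n) = qpoch q (w * q ^ (n + d + 1)) n * (1 - w * q ^ (n + d + n + 1))"
    by (simp add: qpoch_Suc power_add mult_ac)
  also have "qpoch q q (n + d) * rq n * (rq d * (1 - q ^ d)) * (t * q ^ l) ^ Suc n *
      (qpoch q (w * q ^ (n + d + 1)) n * (1 - w * q ^ (n + d + n + 1))) =
      (1 - q ^ d) * (t * q ^ l) * (1 - w * q ^ (n + d + n + 1)) * conn_coeff n (n + d)"
    by (simp only: conn_coeff_def l) (simp add: mult_ac)
  finally show ?thesis .
qed

text \<open>Here \<open>I\<close>, \<open>D\<close>, \<open>M\<close> are q^(A - b), q^(b - n), q^(2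
  n). The coefficients of the recurrence involve only D I = q^(A - n) and M D I = q^(A + n), hence
  not b; this is why a relation between single terms yields one for their sum.\<close>

lemma X_recurrence_polynomial:
  fixes I D M :: 'a
  shows "s * I * ((1 - D) * t * (1 - w * q * M * D)) * (s * ((1 - t * I) * (1 - t * w * q * M * D * D * I)) - (1 - q * I) * (1 - w * q * q * M * D * D * I)) =
    ((1 - q * D * I) * (1 - w * q * q * M * D * I)) * (s * ((1 - t * I) * (1 - t * w * q * M * D * D * I))) -
    s * ((1 - t * D * I) * (1 - t * w * q * M * D * I)) * ((1 - q * I) * (1 - w * q * q * M * D * D * I))"
  unfolding q_eq by algebra

lemma X_recurrence_summand:
  assumes "n \<le> A" "b \<le> B"
  shows "s * q ^ A * (1 - q ^ Suc n) * (P (Suc A) b * conn_coeff (Suc n) b - P A b * conn_coeff (Suc n) b) =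
     q ^ B * ((1 - q ^ (Suc A - n)) * (1 - w * q ^ (A + n + 2)) * (P (Suc A) b * conn_coeff n b) -
       s * (1 - t * q ^ (A - n)) * (1 - t * w * q ^ (A + n + 1)) * (P A b * conn_coeff n b))"
proof (cases "n \<le> b \<and> b \<le> Suc A")
  case True
  obtain d where b: "b = n + d" using True by (metis le_iff_add)
  obtain l where l: "B = b + l" using assms(2) by (metis le_iff_add)
  have conn_coeff: "(1 - q ^ Suc n) * conn_coeff (Suc n) b = (1 - q ^ d) * (t * q ^ l) * (1 - w * q ^ (n + d + n + 1)) * conn_coeff n b"
    using conn_coeff_Suc[of n d l] l b by simp
  show ?thesis
  \<comment> \<open>The edge where A - b would be -1: \<open>P A b\<close> is 0 and only the terms
    of weight A + 1 remain.\<close>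
  proof (cases "b = Suc A")
    case True
    have "s * q ^ A * (1 - q ^ Suc n) * (P (Suc A) b * conn_coeff (Suc n) b - P A b * conn_coeff (Suc n) b) =
        s * q ^ A * P (Suc A) b * ((1 - q ^ Suc n) * conn_coeff (Suc n) b)"
      using True by (simp add: P_def)
    also have "\<dots> = (t * s) * q ^ A * q ^ l * (1 - q ^ d) * (1 - w * q ^ (n + d + n + 1)) * (P (Suc A) b * conn_coeff n b)"
      by (simp only: conn_coeff mult_ac)
    also have "(t * s) * q ^ A * q ^ l = q ^ B"
      using True l by (simp add: power_add flip: q_eq)
    finally have *: "s * q ^ A * (1 - q ^ Suc n) * (P (Suc A) b * conn_coeff (Suc n) b - P A b * conn_coeff (Suc n) b) =
        q ^ B * (1 - q ^ d) * (1 - w * q ^ (n + d + n + 1)) * (P (Suc A) b * conn_coeff n b)" .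
    have "d = Suc A - n" "n + d + n + 1 = A + n + 2" "P A b = 0"
      using True b by (auto simp: P_def)
    then show ?thesis unfolding * by (simp add: mult_ac)
  next
    case False
    then obtain i where A: "A = b + i" using \<open>n \<le> b \<and> b \<le> Suc A\<close> by (metis le_SucE le_iff_add)
    define p where "p = s ^ (i + B) * qpoch q t i * qpoch q t b * qpoch q t (B - b) *
      qpoch q (t * w * q ^ (2 * b + 1)) i * qpoch q (t * u) b * qpoch q (s * w * q ^ (b + 1)) b *
      (rq (Suc i) * rq b * rq (B - b) * rpoch (w * q ^ (2 * b + 2)) (Suc i) * ru b * rpoch (w * q ^ (b + 1)) b)"
    define I where "I = q ^ i"
    define D where "D = q ^ d"
    define M where "M = q ^ n * q ^ n"
    have M: "q ^ (2 * b) = M * D * D"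
    proof -
      have "2 * b = n + n + d + d" by (simp add: b)
      then show ?thesis by (simp only: M_def D_def power_add)
    qed
    then have M': "q ^ (b * 2) = M * D * D"
      by (simp add: mult.commute)
    have P1: "P (Suc A) b = p * (s * ((1 - t * I) * (1 - t * w * q * M * D * D * I)))"
    proof -
      have "P (Suc A) b = s ^ Suc (i + B) * qpoch q t (Suc i) * qpoch q t b * qpoch q t (B - b) *
      qpoch q (t * w * q ^ (2 * b + 1)) (Suc i) * qpoch q (t * u) b * qpoch q (s * w * q ^ (b + 1)) b *
      (rq (Suc i) * rq b * rq (B - b) * rpoch (w * q ^ (2 * b + 2)) (Suc i) * ru b * rpoch (w * q ^ (b + 1)) b)"
        by (simp add: P_def A Suc_diff_le)
      also have "qpoch q t (Suc i) = qpoch q t i * (1 - t * I)"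
        by (simp add: qpoch_Suc I_def mult_ac)
      also have "qpoch q (t * w * q ^ (2 * b + 1)) (Suc i) =
          qpoch q (t * w * q ^ (2 * b + 1)) i * (1 - t * w * q * M * D * D * I)"
        by (simp add: qpoch_Suc I_def M' mult_ac)
      finally show ?thesis by (simp add: p_def mult_ac)
    qed
    have P2: "P A b = p * ((1 - q * I) * (1 - w * q * q * M * D * D * I))"
    proof -
      have "q ^ i * (w * q ^ (2 * b + 2)) \<noteq> 1"
        using w_power[of "i + (2 * b + 2)"] by (simp add: power_add mult_ac)
      then have "rpoch (w * q ^ (2 * b + 2)) i = rpoch (w * q ^ (2 * b + 2)) (Suc i) * (1 - w * q * q * M * D * D * I)"
        by (subst rpoch_eq) (simp_all add: power_add[of q "2 * b"] M M' I_def power2_eq_square mult_ac)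
      moreover have "rq i = rq (Suc i) * (1 - q * I)"
        using rq_eq[of i] by (simp add: I_def)
      moreover have "A - b = i" "b \<le> A" "A + B - b = i + B"
        using A by auto
      ultimately show ?thesis by (simp only: P_def p_def if_True) (simp only: mult_ac)
    qed
    have powers: "q ^ A * q ^ l = q ^ B * I" "q ^ (Suc A - n) = q * D * I" "w * q ^ (A + n + 2) = w * q * q * M * D * I"
      "q ^ (A - n) = D * I" "t * w * q ^ (A + n + 1) = t * w * q * M * D * I"
      "w * q ^ (n + d + n + 1) = w * q * M * D" "q ^ d = D"
      using l by (simp_all add: A b I_def D_def M_def power_add mult_ac power2_eq_square)
    have "s * q ^ A * (1 - q ^ Suc n) * (P (Suc A) b * conn_coeff (Suc n) b - P A b * conn_coeff (Suc n) b) =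
        s * q ^ A * ((1 - q ^ Suc n) * conn_coeff (Suc n) b) * (P (Suc A) b - P A b)"
      by (simp add: algebra_simps)
    also have "\<dots> = s * (q ^ A * q ^ l) * ((1 - q ^ d) * t * (1 - w * q ^ (n + d + n + 1))) * conn_coeff n b * (P (Suc A) b - P A b)"
      unfolding conn_coeff by (simp only: mult_ac)
    also have "\<dots> = q ^ B * conn_coeff n b * p * (s * I * ((1 - D) * t * (1 - w * q * M * D)) *
        (s * ((1 - t * I) * (1 - t * w * q * M * D * D * I)) - (1 - q * I) * (1 - w * q * q * M * D * D * I)))"
      unfolding P1 P2 powers right_diff_distrib[of p, symmetric] by (simp only: mult_ac)
    also have "\<dots> = q ^ B * ((1 - q ^ (Suc A - n)) * (1 - w * q ^ (A + n + 2)) * (P (Suc A) b * conn_coeff n b) -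
       s * (1 - t * q ^ (A - n)) * (1 - t * w * q ^ (A + n + 1)) * (P A b * conn_coeff n b))"
      unfolding X_recurrence_polynomial P1 P2 powers by algebra
    finally show ?thesis .
  qed
next
  case False
  then show ?thesis by (auto simp: P_def conn_coeff_def)
qed

lemma X_recurrence:
  assumes "n \<le> A"
  shows "s * q ^ A * (1 - q ^ Suc n) * (X (Suc n) (Suc A) - X (Suc n) A) =
     q ^ B * ((1 - q ^ (Suc A - n)) * (1 - w * q ^ (A + n + 2)) * X n (Suc A) -
       s * (1 - t * q ^ (A - n)) * (1 - t * w * q ^ (A + n + 1)) * X n A)"
proof -
  have "s * q ^ A * (1 - q ^ Suc n) * (X (Suc n) (Suc A) - X (Suc n) A) =
      (\<Sum>b\<le>B. s * q ^ A * (1 - q ^ Suc n) * (P (Suc A) b * conn_coeff (Suc n) b - P A b * conn_coeff (Suc n) b))"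
    by (simp only: X_def sum_subtractf sum_distrib_left[symmetric])
  also have "\<dots> = (\<Sum>b\<le>B. q ^ B * ((1 - q ^ (Suc A - n)) * (1 - w * q ^ (A + n + 2)) * (P (Suc A) b * conn_coeff n b) -
       s * (1 - t * q ^ (A - n)) * (1 - t * w * q ^ (A + n + 1)) * (P A b * conn_coeff n b)))"
    using assms by (intro sum.cong X_recurrence_summand) auto
  finally show ?thesis
    by (simp only: X_def sum_subtractf sum_distrib_left[symmetric])
qed

text \<open>The remaining sum over k is \<open>saalschuetz\<close> with f = w q^(n + 1), x = s, y =
  t q^(B - n), for which f y = t u and f x y = q u. On the other side only b = n is left, and the
  factorial of f in \<open>conn_coeff\<close> cancels the one in the denominator of
  \<open>P\<close>.\<close>

lemma R_diagonal:
  assumes "n \<le> B"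
  shows "R n n = X n n"
proof -
  obtain l where l: "B = n + l" using assms by (metis le_iff_add)
  have Bn: "B - n = l" using l by simp
  define f where "f = w * q * q ^ n"
  have u: "q * u = f * q * q ^ l" "q * u = f * s * (t * q ^ l)" "t * u = f * (t * q ^ l)"
    by (simp_all only: u_def f_def) (simp_all add: l power_add mult_ac, simp_all add: q_eq mult_ac)
  have "R n n = (\<Sum>k\<le>n. T n n n k)"
  proof -
    have "R n n = (\<Sum>j\<in>{n}. \<Sum>k\<le>n. T n n j k)"
      unfolding R_def using assms
    proof (intro sum.mono_neutral_right ballI sum.neutral)
      fix j k assume "j \<in> {..B} - {n}"
      then show "T n n j k = 0" by (auto simp: T_def)
    qed auto
    then show ?thesis by simp
  qed
  also have "\<dots> = (\<Sum>k\<le>n. s ^ l * q ^ (Suc l * n) * qpoch q t n * qpoch q t l * rq l * rq n * ru n *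
      (qpoch q q n * rq k * rq (n - k) * f ^ k * qpoch q s k * qpoch q (t * q ^ l) k *
       qpoch q f (n - k) * qpoch q (f * s * (t * q ^ l) * q ^ k) (n - k)))"
  proof (rule sum.cong)
    fix k assume "k \<in> {..n}"
    then obtain m where n: "n = k + m" by (metis atMost_iff le_iff_add)
    have "T n n n k = F k m 0 0 l"
      using assms Bn n by (simp add: T_def)
    also have "\<dots> = s ^ l * (q_pow l m * (q * u) ^ k) * qpoch q s k *
        qpoch q f m * qpoch q t n * qpoch q t (l + k) * (rq k * rq m * rq l * ru k) * (qpoch q t k * rt k)"
      by (simp add: F_def f_def n mult_ac)
    also have "q_pow l m * (q * u) ^ k = q ^ (Suc l * n) * f ^ k"
      unfolding u(1) by (simp add: q_pow_def n power_add power_mult_distrib add_mult_distrib add_mult_distrib2 mult_ac flip: power_mult)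
    also have "qpoch q t (l + k) = qpoch q t l * qpoch q (t * q ^ l) k"
      by (simp add: qpoch_add mult_ac)
    also have "qpoch q t k * rt k = 1"
      using t_power by (simp add: rpoch_def qpoch_nonzero)
    also have "ru k = ru n * qpoch q (f * s * (t * q ^ l) * q ^ k) m"
    proof -
      have "qpoch q (q * u) n \<noteq> 0"
        using w_power[of "_ + 2 + B"]
        by (intro qpoch_nonzero) (simp add: u_def power_add power2_eq_square mult_ac)
      then show ?thesis
        unfolding u(2)[symmetric] rpoch_def n qpoch_add[of q _ k] by (simp add: field_simps)
    qed
    also have "1 = qpoch q q n * rq n"
      using qq_nonzero by (simp add: rpoch_def)
    finally show "T n n n k = s ^ l * q ^ (Suc l * n) * qpoch q t n * qpoch q t l * rq l * rq n * ru n *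
      (qpoch q q n * rq k * rq (n - k) * f ^ k * qpoch q s k * qpoch q (t * q ^ l) k *
       qpoch q f (n - k) * qpoch q (f * s * (t * q ^ l) * q ^ k) (n - k))"
      by (simp add: n mult_ac)
  qed simp
  also have "\<dots> = s ^ l * q ^ (Suc l * n) * qpoch q t n * qpoch q t l * rq l * rq n * ru n *
      (qpoch q (f * s) n * qpoch q (t * u) n)"
    unfolding sum_distrib_left[symmetric] saalschuetz u(3) by (rule refl)
  also have "\<dots> = X n n"
  proof -
    have "X n n = (\<Sum>b\<in>{n}. P n b * conn_coeff n b)"
      unfolding X_def using assms by (intro sum.mono_neutral_right) (auto simp: P_def conn_coeff_def)
    also have "\<dots> = s ^ B * qpoch q t n * qpoch q t l * qpoch q (t * u) n * qpoch q (f * s) n *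
       (rq n * rq l * ru n) * (t * q ^ l) ^ n * (qpoch q q n * rq n) * (qpoch q f n * rpoch f n)"
      by (simp add: P_def conn_coeff_def Bn f_def mult_ac)
    also have "qpoch q q n * rq n = 1"
      using qq_nonzero by (simp add: rpoch_def)
    also have "qpoch q f n * rpoch f n = 1"
    proof -
      have "qpoch q f n \<noteq> 0"
        using w_power[of "_ + 1 + n"] by (intro qpoch_nonzero) (simp add: f_def power_add mult_ac)
      then show ?thesis by (simp add: rpoch_def)
    qed
    also have "s ^ B * qpoch q t n * qpoch q t l * qpoch q (t * u) n * qpoch q (f * s) n *
       (rq n * rq l * ru n) * (t * q ^ l) ^ n = s ^ l * ((t * s) ^ n * (q ^ l) ^ n) * qpoch q t n * qpoch q t l * qpoch q (t * u) n * qpoch q (f * s) n *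
       (rq n * rq l * ru n)"
      by (simp add: l power_add power_mult_distrib mult_ac)
    also have "(t * s) ^ n * (q ^ l) ^ n = q ^ (Suc l * n)"
      by (simp add: power_add flip: q_eq power_mult)
    finally show ?thesis by (simp add: mult_ac)
  qed
  finally show ?thesis .
qed

text \<open>Downward in n, starting from n > B where both sides are 0; for fixed n upward in A,
  through 0 for A < n and \<open>R_diagonal\<close> for A = n. Beyond the diagonal the recurrences
  give the value at A + 1, because its coefficient, essentially (1 - q^(A + 1 - n)) (1 - w q^(A + n
  + 2)), is nonzero.\<close>

lemma X_eq_R: "X n A = R n A"
proof (induction "Suc B - n" arbitrary: n A)
  case 0
  then show ?case by (simp add: X_def R_def conn_coeff_def T_def)
next
  case (Suc d)
  then have IH: "X (Suc n) A = R (Suc n) A" for A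
    by (metis Suc_diff_le diff_Suc_Suc diff_Suc_1 zero_less_Suc zero_less_diff less_Suc_eq_le)
  have n: "n \<le> B" using Suc.hyps(2) by simp
  show ?case
  proof (induction A)
    case 0
    show ?case
    proof (cases "n = 0")
      case True
      then show ?thesis using R_diagonal[of 0] by simp
    next
      case False
      then have "X n 0 = 0" "R n 0 = 0"
        by (auto simp: X_def R_def P_def conn_coeff_def T_def intro!: sum.neutral)
      then show ?thesis by simp
    qed
  next
    case (Suc A)
    consider "n \<le> A" | "n = Suc A" | "n > Suc A" by linarith
    then show ?case
    proof cases
      case 1
      have nz: "(1 - q ^ (Suc A - n)) * (1 - w * q ^ (A + n + 2)) \<noteq> 0"
        using q_power_neq_1[of "A - n"] w_power[of "A + n + 2"] 1
        by (simp add: Suc_diff_le mult_ac)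
      have "q ^ B * ((1 - q ^ (Suc A - n)) * (1 - w * q ^ (A + n + 2)) * X n (Suc A) -
          s * (1 - t * q ^ (A - n)) * (1 - t * w * q ^ (A + n + 1)) * X n A) =
          q ^ B * ((1 - q ^ (Suc A - n)) * (1 - w * q ^ (A + n + 2)) * R n (Suc A) -
          s * (1 - t * q ^ (A - n)) * (1 - t * w * q ^ (A + n + 1)) * R n A)"
        unfolding X_recurrence[OF 1, symmetric] R_recurrence[OF 1, symmetric] IH ..
      then show ?thesis
        using nz q_nonzero \<open>X n A = R n A\<close> by simp
    next
      case 2
      then show ?thesis using R_diagonal[OF n] by simp
    next
      case 3
      then have "X n (Suc A) = 0" "R n (Suc A) = 0"
        by (auto simp: X_def R_def P_def conn_coeff_def T_def intro!: sum.neutral)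
      then show ?thesis by simp
    qed
  qed
qed

section \<open>Transformation of the coefficient sum\<close>

text \<open>The common functions of v for the two expansions; besides n they involve only u and B,
  not A or a summation index of either sum.\<close>

definition E :: "'a \<Rightarrow> nat \<Rightarrow> 'a" where
  "E v n = qpoch q s n * v ^ n * qpoch q (t * v) (B - n) * rpoch (q * u * v) n * rpoch (q * v) B"

definition S :: "'a \<Rightarrow> nat \<Rightarrow> nat \<Rightarrow> nat \<Rightarrow> 'a" where
  "S v A j k = qpoch q s k * qpoch q s k * rq k * rt k * (q * u * v) ^ k * s ^ (A + B - j - k) *
    (qpoch q (t * u) (A - j) * qpoch q t (A - j + k) * rq (A - j) * ru (A - j + k)) *
    (qpoch q (t * u * v) (j - k) * qpoch q t j * rq (j - k) * rpoch (q * u * v) j) *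
    (qpoch q (t * v) (B - j) * qpoch q t (B - j + k) * rq (B - j) * rpoch (q * v) (B - j + k))"

context
  fixes v :: 'a
  assumes v_power: "\<And>n. q ^ n * (q * v) \<noteq> 1" and uv_power: "\<And>n. q ^ n * (q * u * v) \<noteq> 1"
begin

lemma v_qpoch_nonzero: "qpoch q (q * v) n \<noteq> 0" "qpoch q (q * u * v) n \<noteq> 0"
  using v_power uv_power by (simp_all add: qpoch_nonzero)

text \<open>\<open>saalschuetz\<close> with f = t q^l v, x = s q^k, y = w q^(k + m + 1). These
  parameters give f x = q^(l + k) q v, f y = t u v and f x y q^r = q^(k + r) q u v, so the functions
  on the right are those of \<open>E v (k + r)\<close>. The single sum uses k = 0, the double sum
  general k.\<close>

lemma v_expansion:
  assumes B: "B = k + m + l"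
  shows "qpoch q (t * u * v) m * qpoch q (t * v) l * rpoch (q * u * v) (k + m) * rpoch (q * v) (l + k) =
    (\<Sum>r\<le>m. rpoch (q * v) B * (qpoch q q m * rq r * rq (m - r) * (t * q ^ l * v) ^ r * qpoch q (s * q ^ k) r *
      qpoch q (w * q * q ^ (k + m)) r * qpoch q (t * v) (l + (m - r)) * rpoch (q * u * v) (k + r)))"
proof -
  define f where "f = t * q ^ l * v"
  define x where "x = s * q ^ k"
  define y where "y = w * q * q ^ (k + m)"
  have fx: "f * x = q ^ (l + k) * (q * v)"
    by (simp add: f_def x_def power_add) (subst q_eq, simp add: mult_ac)
  have fy: "f * y = t * u * v"
    by (simp only: u_def) (simp add: f_def y_def B power_add mult_ac)
  have fxy: "f * x * y * q ^ r = q ^ (k + r) * (q * u * v)" for r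
    unfolding fx by (simp only: u_def) (simp add: y_def B power_add mult_ac)
  have 1: "rpoch (q * v) (l + k) = rpoch (q * v) B * qpoch q (f * x) m"
  proof -
    have "qpoch q (q * v) B = qpoch q (q * v) (l + k) * qpoch q (f * x) m"
      unfolding fx qpoch_add[symmetric] by (simp add: B ac_simps)
    then show ?thesis using v_qpoch_nonzero(1)[of B] by (simp add: rpoch_def)
  qed
  have 2: "qpoch q (t * v) l * qpoch q f n = qpoch q (t * v) (l + n)" for n
    by (simp add: qpoch_add f_def mult_ac)
  have 3: "rpoch (q * u * v) (k + m) * qpoch q (f * x * y * q ^ r) (m - r) = rpoch (q * u * v) (k + r)" if "r \<le> m" for r
  proof -
    have "qpoch q (q * u * v) (k + m) = qpoch q (q * u * v) (k + r) * qpoch q (f * x * y * q ^ r) (m - r)"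
      unfolding fxy qpoch_add[symmetric] using that by simp
    then show ?thesis using v_qpoch_nonzero(2)[of "k + m"] by (simp add: rpoch_def)
  qed
  have "qpoch q (t * u * v) m * qpoch q (t * v) l * rpoch (q * u * v) (k + m) * rpoch (q * v) (l + k) =
     rpoch (q * v) B * qpoch q (t * v) l * rpoch (q * u * v) (k + m) * (qpoch q (f * x) m * qpoch q (f * y) m)"
    unfolding 1 fy by (simp only: mult_ac)
  also have "\<dots> = (\<Sum>r\<le>m. rpoch (q * v) B * qpoch q (t * v) l * rpoch (q * u * v) (k + m) *
      (qpoch q q m * rq r * rq (m - r) * f ^ r * qpoch q x r * qpoch q y r *
      qpoch q f (m - r) * qpoch q (f * x * y * q ^ r) (m - r)))"
    unfolding saalschuetz[symmetric] sum_distrib_left ..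
  also have "\<dots> = (\<Sum>r\<le>m. rpoch (q * v) B * (qpoch q q m * rq r * rq (m - r) * f ^ r * qpoch q x r * qpoch q y r *
      qpoch q (t * v) (l + (m - r)) * rpoch (q * u * v) (k + r)))"
  proof (intro sum.cong refl)
    fix r assume "r \<in> {..m}"
    then have r: "r \<le> m" by simp
    show "rpoch (q * v) B * qpoch q (t * v) l * rpoch (q * u * v) (k + m) *
      (qpoch q q m * rq r * rq (m - r) * f ^ r * qpoch q x r * qpoch q y r *
      qpoch q f (m - r) * qpoch q (f * x * y * q ^ r) (m - r)) =
      rpoch (q * v) B * (qpoch q q m * rq r * rq (m - r) * f ^ r * qpoch q x r * qpoch q y r *
      qpoch q (t * v) (l + (m - r)) * rpoch (q * u * v) (k + r))"
      unfolding 2[symmetric] 3[OF r, symmetric] by (simp only: mult_ac)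
  qed
  finally show ?thesis unfolding f_def x_def y_def .
qed

lemma P_expansion:
  assumes "b \<le> B"
  shows "P A b * (qpoch q (t * u * v) b * qpoch q (t * v) (B - b) * rpoch (q * u * v) b * rpoch (q * v) (B - b)) =
    (\<Sum>n\<le>B. E v n * (P A b * conn_coeff n b))"
proof -
  obtain l where l: "B = b + l" using assms by (metis le_iff_add)
  then have Bb: "B - b = l" by simp
  have "P A b * (qpoch q (t * u * v) b * qpoch q (t * v) (B - b) * rpoch (q * u * v) b * rpoch (q * v) (B - b)) =
     (\<Sum>r\<le>b. E v r * (P A b * conn_coeff r b))"
  proof -
    have "P A b * (qpoch q (t * u * v) b * qpoch q (t * v) (B - b) * rpoch (q * u * v) b * rpoch (q * v) (B - b)) =
       P A b * (qpoch q (t * u * v) b * qpoch q (t * v) l * rpoch (q * u * v) (0 + b) * rpoch (q * v) (l + 0))"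
      by (simp add: Bb)
    also have "\<dots> = (\<Sum>r\<le>b. E v r * (P A b * conn_coeff r b))"
      unfolding add_0 add_0_right v_expansion[of 0 b l, unfolded add_0 add_0_right power_0 mult_1_right, OF l] sum_distrib_left
    proof (intro sum.cong refl)
      fix r assume "r \<in> {..b}"
      then have "B - r = l + (b - r)" "r \<le> b" using l by auto
      then show "P A b * (rpoch (q * v) B * (qpoch q q b * rq r * rq (b - r) * (t * q ^ l * v) ^ r * qpoch q s r *
          qpoch q (w * q * q ^ b) r * qpoch q (t * v) (l + (b - r)) * rpoch (q * u * v) r)) =
          E v r * (P A b * conn_coeff r b)"
        by (simp add: E_def conn_coeff_def Bb power_mult_distrib mult_ac)
    qed
    finally show ?thesis .
  qed
  also have "\<dots> = (\<Sum>n\<le>B. E v n * (P A b * conn_coeff n b))"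
    using assms by (intro sum.mono_neutral_left) (auto simp: conn_coeff_def)
  finally show ?thesis .
qed

lemma S_expansion:
  assumes "k \<le> j" "j \<le> A" "j \<le> B"
  shows "S v A j k = (\<Sum>n\<le>B. E v n * T n A j k)"
proof -
  obtain m where m: "j = k + m" using assms by (metis le_iff_add)
  obtain l where l: "B = k + m + l" using assms m by (metis le_iff_add)
  obtain i where i: "A = k + m + i" using assms m by (metis le_iff_add)
  define D where "D = qpoch q s k * qpoch q s k * rq k * rt k * (q * u * v) ^ k * s ^ (i + l + m) *
    (qpoch q (t * u) i * qpoch q t (i + k) * rq i * ru (i + k)) *
    (qpoch q t j * rq m) * (qpoch q t (l + k) * rq l)"
  have Bj: "B - j = l" "A - j = i" "j - k = m" "A + B - j - k = i + l + m"
    using l m i by auto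
  have "S v A j k = D * (qpoch q (t * u * v) m * qpoch q (t * v) l * rpoch (q * u * v) (k + m) * rpoch (q * v) (l + k))"
    unfolding S_def D_def Bj by (simp add: m mult_ac)
  also have "\<dots> = (\<Sum>r\<le>m. E v (k + r) * T (k + r) A j k)"
    unfolding v_expansion[OF l] sum_distrib_left
  proof (rule sum.cong)
    fix r assume "r \<in> {..m}"
    then obtain c where c: "m = r + c" by (metis atMost_iff le_iff_add)
    have Br: "B - (k + r) = l + c" using l c by simp
    have "E v (k + r) * T (k + r) A j k = E v (k + r) * F k r c i l"
      using assms m c i Bj by (simp add: T_def)
    \<comment> \<open>One of the two factors (s;q)_k of \<open>S\<close> joins (s q^k;q)_r from the
      expansion to form the factorial (s;q)_(k+r) of \<open>E\<close>; the other stays in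
      \<open>F\<close>.\<close>
    also have "\<dots> = (qpoch q s k * qpoch q (s * q ^ k) r) * v ^ (k + r) * qpoch q (t * v) (l + c) * rpoch (q * u * v) (k + r) * rpoch (q * v) B *
       (s ^ (i + l + c) * q_pow l r * (q * u) ^ k * qpoch q s k *
     qpoch q (w * q * q ^ (k + m)) r * qpoch q t j * qpoch q t (l + k) *
     qpoch q (t * u) i * qpoch q t (i + k) *
     (rq k * rq r * rt k * rq c * rq l * rq i * ru (i + k)))"
      by (simp only: E_def F_def Br) (simp add: m c qpoch_add[of q s k r] add.assoc mult_ac)
    also have "s ^ (i + l + c) * q_pow l r = s ^ (i + l + m) * (t * q ^ l) ^ r"
    proof -
      have "q_pow l r = (q * q ^ l) ^ r"
        by (simp only: q_pow_def power_mult power_Suc)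
      then show ?thesis
        by (simp only: c) (subst q_eq, simp add: power_add power_mult_distrib mult_ac flip: q_eq)
    qed
    also have "rq k = rq k * (qpoch q q m * rq m)"
      using qq_nonzero by (simp add: rpoch_def)
    finally show "D * (rpoch (q * v) B * (qpoch q q m * rq r * rq (m - r) * (t * q ^ l * v) ^ r * qpoch q (s * q ^ k) r *
      qpoch q (w * q * q ^ (k + m)) r * qpoch q (t * v) (l + (m - r)) * rpoch (q * u * v) (k + r))) =
      E v (k + r) * T (k + r) A j k"
      by (simp add: D_def c power_add power_mult_distrib mult_ac)
  qed simp
  also have "\<dots> = (\<Sum>n\<in>{k..j}. E v n * T n A j k)"
    by (rule sum.reindex_bij_witness[of _ "\<lambda>n. n - k" "\<lambda>r. k + r"]) (auto simp: m)
  also have "\<dots> = (\<Sum>n\<le>B. E v n * T n A j k)"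
    using assms by (intro sum.mono_neutral_left) (auto simp: T_def)
  finally show ?thesis .
qed

lemma P_sum_eq_S_sum:
  "(\<Sum>b\<le>B. P A b * (qpoch q (t * u * v) b * qpoch q (t * v) (B - b) * rpoch (q * u * v) b * rpoch (q * v) (B - b))) =
   (\<Sum>j\<le>min A B. \<Sum>k\<le>j. S v A j k)"
proof -
  have "(\<Sum>b\<le>B. P A b * (qpoch q (t * u * v) b * qpoch q (t * v) (B - b) * rpoch (q * u * v) b * rpoch (q * v) (B - b))) =
      (\<Sum>b\<le>B. \<Sum>n\<le>B. E v n * (P A b * conn_coeff n b))"
    by (intro sum.cong refl P_expansion) auto
  also have "\<dots> = (\<Sum>n\<le>B. E v n * R n A)"
    by (subst sum.swap) (simp add: X_def sum_distrib_left flip: X_eq_R)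
  also have "\<dots> = (\<Sum>n\<le>B. \<Sum>j\<le>min A B. \<Sum>k\<le>j. E v n * T n A j k)"
  proof (intro sum.cong refl)
    fix n
    have "R n A = (\<Sum>j\<le>min A B. \<Sum>k\<le>n. T n A j k)"
      unfolding R_def
    proof (intro sum.mono_neutral_right ballI sum.neutral)
      fix j k assume "j \<in> {..B} - {..min A B}"
      then show "T n A j k = 0" by (auto simp: T_def)
    qed auto
    also have "\<dots> = (\<Sum>j\<le>min A B. \<Sum>k\<le>j. T n A j k)"
    proof (rule sum.cong[OF refl])
      fix j
      have "(\<Sum>k\<le>n. T n A j k) = (\<Sum>k\<in>{..n} \<inter> {..j}. T n A j k)"
        by (intro sum.mono_neutral_right) (auto simp: T_def)
      also have "\<dots> = (\<Sum>k\<le>j. T n A j k)"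
        by (intro sum.mono_neutral_left) (auto simp: T_def)
      finally show "(\<Sum>k\<le>n. T n A j k) = (\<Sum>k\<le>j. T n A j k)" .
    qed
    finally show "E v n * R n A = (\<Sum>j\<le>min A B. \<Sum>k\<le>j. E v n * T n A j k)"
      by (simp add: sum_distrib_left)
  qed
  also have "\<dots> = (\<Sum>j\<le>min A B. \<Sum>n\<le>B. \<Sum>k\<le>j. E v n * T n A j k)"
    by (rule sum.swap)
  also have "\<dots> = (\<Sum>j\<le>min A B. \<Sum>k\<le>j. S v A j k)"
  proof (rule sum.cong[OF refl])
    fix j assume "j \<in> {..min A B}"
    then have *: "(\<Sum>k\<le>j. S v A j k) = (\<Sum>k\<le>j. \<Sum>n\<le>B. E v n * T n A j k)"
      by (intro sum.cong refl S_expansion) auto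
    show "(\<Sum>n\<le>B. \<Sum>k\<le>j. E v n * T n A j k) = (\<Sum>k\<le>j. S v A j k)"
      unfolding * by (rule sum.swap)
  qed
  finally show ?thesis .
qed

end

end

section \<open>The coefficients of $p_3$\<close>

text \<open>Amounts to reversing the order of the factors. The quotients with i = j in c_n, where s
  cancels, have this form; with q/t for every unit of theta they produce the power (q/t)^(A + B - b)
  in \<open>P\<close>.\<close>

lemma (in q_field) qpoch_reversed:
  assumes "t \<noteq> 0"
  shows "qpoch q (q powi (- int m) * (q / t)) m / qpoch q (q powi (- int m)) m =
    (q / t) ^ m * qpoch q t m * rq m"
proof -
  have pw: "q powi (- int n) = 1 / q ^ n" for n
    by (simp only: power_int_minus power_int_of_nat inverse_eq_divide)
  have rec: "qpoch q (q powi (- int (Suc m)) * z) (Suc m) = (1 - z / q ^ Suc m) * qpoch q (q powi (- int m) * z) m" for z m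
    using q_nonzero unfolding pw by (simp add: qpoch_Suc_left)
  have 1: "qpoch q (q powi (- int m) * (q / t)) m * qpoch q q m =
      (q / t) ^ m * qpoch q t m * qpoch q (q powi (- int m) * 1) m"
  proof (induction m)
    case (Suc m)
    have step: "(1 - q / t / q ^ Suc m) * (1 - q ^ m * q) = (q / t) * (1 - q ^ m * t) * (1 - 1 / q ^ Suc m)"
      using assms q_nonzero by (simp add: field_simps)
    have "(1 - q / t / q ^ Suc m) * qpoch q (q powi (- int m) * (q / t)) m * (qpoch q q m * (1 - q ^ m * q)) =
        ((1 - q / t / q ^ Suc m) * (1 - q ^ m * q)) * (qpoch q (q powi (- int m) * (q / t)) m * qpoch q q m)"
      by (simp only: mult_ac)
    also have "\<dots> = ((q / t) * (1 - q ^ m * t) * (1 - 1 / q ^ Suc m)) *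
        ((q / t) ^ m * qpoch q t m * qpoch q (q powi (- int m) * 1) m)"
      unfolding step Suc ..
    finally show ?case
      unfolding rec qpoch_Suc[of q q] qpoch_Suc[of q t] power_Suc[of "q / t"] by (simp only: mult_ac)
  qed simp
  have 2: "qpoch q (q powi (- int m)) m \<noteq> 0"
  proof (rule qpoch_nonzero)
    fix i assume "i < m"
    then obtain d where "m = i + Suc d" using less_iff_Suc_add by auto
    then show "q ^ i * q powi (- int m) \<noteq> 1"
      using q_nonzero q_power_neq_1[of d] unfolding pw by (simp add: power_add field_simps)
  qed
  have 3: "x / y = z * inverse c" if "x * c = z * y" "y \<noteq> 0" "c \<noteq> 0" for x y z c :: 'a
    using that by (simp add: field_simps)
  show ?thesis
    unfolding rpoch_def by (rule 3[OF 1[unfolded mult_1_right] 2 qq_nonzero])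
qed

lemma pairs_strict:
  "{(i, j). 1 \<le> i \<and> i < j \<and> j \<le> (2::nat)} = {(1, 2)}"
  "{(i, j). 1 \<le> i \<and> i < j \<and> j \<le> (3::nat)} = {(1, 2), (1, 3), (2, 3)}"
  by auto

lemma pairs_weak:
  "{(i, j). 1 \<le> i \<and> i \<le> j \<and> j < (2::nat)} = {(1, 1)}"
  "{(i, j). 1 \<le> i \<and> i \<le> j \<and> j < (3::nat)} = {(1, 1), (1, 2), (2, 2)}"
  by auto

lemma macd_c_3:
  fixes s :: "nat \<Rightarrow> 'a :: field"
  shows "macd_c 3 \<theta> s q t =
    (let a = \<theta> 1 2; b = \<theta> 1 3; c = \<theta> 2 3; e = int b - int c in
      qpoch q (q powi e * (t * s 2 / s 1)) a / qpoch q (q powi e * (q * s 2 / s 1)) a *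
      (qpoch q (t * s 2 / s 1) b / qpoch q (q * s 2 / s 1) b *
       (qpoch q (t * s 3 / s 1) b / qpoch q (q * s 3 / s 1) b) *
       (qpoch q (t * s 3 / s 2) c / qpoch q (q * s 3 / s 2) c)) *
      (qpoch q (q powi (- int a) * (q * s 1 / (t * s 1))) a / qpoch q (q powi (- int a) * (s 1 / s 1)) a *
      (qpoch q (q powi (- int b) * (q * s 1 / (t * s 1))) b / qpoch q (q powi (- int b) * (s 1 / s 1)) b *
       (qpoch q (q powi (- int c) * (q * s 2 / (t * s 1))) b / qpoch q (q powi (- int c) * (s 2 / s 1)) b) *
       (qpoch q (q powi (- int c) * (q * s 2 / (t * s 2))) c / qpoch q (q powi (- int c) * (s 2 / s 2)) c))))"
proof -
  have sets: "{2..3::nat} = {2, 3}" "{2 + 1..3::nat} = {3}" "{3 + 1..3::nat} = {}"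
    by auto
  show ?thesis
    unfolding macd_c_def Let_def by (simp add: sets pairs_strict[simplified] pairs_weak[simplified] mult_ac)
qed

lemma upper_matrices_3_sum:
  "(\<Sum>\<theta>\<in>{\<theta> \<in> upper_matrices 3. \<theta> 1 2 + \<theta> 1 3 = A \<and> \<theta> 1 3 + \<theta> 2 3 = B}. f (\<theta> 1 2) (\<theta> 1 3) (\<theta> 2 3)) =
   (\<Sum>b\<le>min A B. f (A - b) b (B - b))"
proof -
  define mk :: "nat \<Rightarrow> nat \<Rightarrow> nat \<Rightarrow> nat" where
    "mk b i j = (if i = 1 \<and> j = 2 then A - b else if i = 1 \<and> j = 3 then b else if i = 2 \<and> j = 3 then B - b else 0)" for b i j
  show ?thesis
  proof (rule sum.reindex_bij_witness[of _ mk "\<lambda>\<theta>. \<theta> 1 3"])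
    fix \<theta> assume \<theta>: "\<theta> \<in> {\<theta> \<in> upper_matrices 3. \<theta> 1 2 + \<theta> 1 3 = A \<and> \<theta> 1 3 + \<theta> 2 3 = B}"
    have "\<theta> i j = 0" if "\<not> (i = 1 \<and> j = 2)" "\<not> (i = 1 \<and> j = 3)" "\<not> (i = 2 \<and> j = 3)" for i j
    proof -
      have "\<not> (1 \<le> i \<and> i < j \<and> j \<le> 3)"
        using that by presburger
      then show ?thesis using \<theta> by (auto simp: upper_matrices_def)
    qed
    then show "mk (\<theta> 1 3) = \<theta>"
      using \<theta> unfolding mk_def by (intro ext) auto
    show "f (A - \<theta> 1 3) (\<theta> 1 3) (B - \<theta> 1 3) = f (\<theta> 1 2) (\<theta> 1 3) (\<theta> 2 3)"
      using \<theta> by auto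
  qed (auto simp: mk_def upper_matrices_def)
qed

section \<open>Constants and variables in the field of rational functions\<close>

lemma ratfun_const_hom [simp]:
  "ratfun_const 0 = 0" "ratfun_const 1 = 1"
  "ratfun_const (a * b) = ratfun_const a * ratfun_const b"
  "ratfun_const (a + b) = ratfun_const a + ratfun_const b"
  "ratfun_const (a - b) = ratfun_const a - ratfun_const b"
  "ratfun_const (- a) = - ratfun_const a"
  "ratfun_const a = ratfun_const b \<longleftrightarrow> a = b"
  by (simp_all add: ratfun_const_def flip: to_fract_mult to_fract_add to_fract_diff to_fract_uminus one_pCons)

lemma ratfun_const_eq_0_1 [simp]: "ratfun_const a = 0 \<longleftrightarrow> a = 0" "ratfun_const a = 1 \<longleftrightarrow> a = 1"
  using ratfun_const_hom(7)[of a 0] ratfun_const_hom(7)[of a 1] by (simp_all del: ratfun_const_hom(7))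

lemma ratfun_const_power [simp]: "ratfun_const (a ^ n) = ratfun_const a ^ n"
  by (induction n) simp_all

lemma ratfun_const_inverse [simp]: "ratfun_const (inverse a) = inverse (ratfun_const a)"
proof (cases "a = 0")
  case False
  then have "ratfun_const a * ratfun_const (inverse a) = 1"
    by (simp flip: ratfun_const_hom)
  then show ?thesis
    by (metis inverse_unique)
qed simp

lemma ratfun_const_divide [simp]: "ratfun_const (a / b) = ratfun_const a / ratfun_const b"
  by (simp add: divide_inverse)

abbreviation u_rat :: ratfun where "u_rat \<equiv> to_fract [:0, 1:]"
abbreviation v_rat :: ratfun where "v_rat \<equiv> to_fract [:[:0, 1:]:]"

lemma const_mult_rat_neq_const:
  "ratfun_const a * u_rat \<noteq> ratfun_const b \<or> a = 0" "ratfun_const a * v_rat \<noteq> 1" "ratfun_const a * (u_rat * v_rat) \<noteq> 1"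
  by (auto simp: ratfun_const_def simp flip: to_fract_mult to_fract_1 simp: one_pCons)

context
  fixes q t :: complex
  assumes q: "q \<noteq> 0" "norm q < 1" and t: "t \<noteq> 0" "norm t < 1"
begin

abbreviation q_rat where "q_rat \<equiv> ratfun_const q"
abbreviation t_rat where "t_rat \<equiv> ratfun_const t"
abbreviation w_rat where "w_rat B \<equiv> u_rat / q_rat ^ Suc B"

lemma norm_q_power_less_1: "norm (q ^ Suc n) < 1"
  using q by (metis norm_power power_Suc_less_one norm_ge_zero zero_less_norm_iff)

lemma norm_q_power_le_1: "norm (q ^ n) \<le> 1"
  using q by (simp add: norm_power power_le_one)

lemma q_power_neq_1: "q ^ Suc n \<noteq> 1"
  using norm_q_power_less_1[of n] by auto

lemma q_power_t_neq_1: "q ^ n * t \<noteq> 1"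
proof -
  have "norm (q ^ n * t) < 1"
    using norm_q_power_le_1[of n] t by (simp add: norm_mult) (metis mult_le_cancel_right1 mult_left_le_one_le norm_ge_zero order_le_less_trans)
  then show ?thesis by auto
qed

text \<open>The elements 1 - q^n w, which carry the spurious poles, are nonzero in this field
  because s_2/s_1 is not a constant; the conditions on q and t come from their absolute
  values.\<close>

lemma macd_rat: "macd q_rat t_rat (q_rat / t_rat) (w_rat B)"
proof
  show "q_rat ^ Suc n \<noteq> 1" for n
    using q_power_neq_1[of n] by (simp del: power_Suc flip: ratfun_const_power)
  show "q_rat ^ n * t_rat \<noteq> 1" for n
    using q_power_t_neq_1[of n] by (simp flip: ratfun_const_power ratfun_const_hom(3))
  show "q_rat ^ n * w_rat B \<noteq> 1" for n
    using q const_mult_rat_neq_const(1)[of "q ^ n" "q ^ Suc B"] by auto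
qed (use q t in auto)

lemma u_macd_rat: "macd.u q_rat (w_rat B) B = u_rat"
  unfolding macd.u_def[OF macd_rat] using q by simp

lemma p3_coeff_eq:
  "p3_coeff q t A B = (\<Sum>j\<le>min A B. \<Sum>k\<le>j. macd.S q_rat t_rat (q_rat / t_rat) (w_rat B) B v_rat A j k)"
proof -
  interpret macd q_rat t_rat "q_rat / t_rat" "w_rat B" B
    by (rule macd_rat)
  define sv where "sv = (\<lambda>i. to_fract (s_ratio_poly 1 i))"
  define f where "f = (\<lambda>a b c. let e = int b - int c in
      qpoch q_rat (q_rat powi e * (t_rat * sv 2 / sv 1)) a / qpoch q_rat (q_rat powi e * (q_rat * sv 2 / sv 1)) a *
      (qpoch q_rat (t_rat * sv 2 / sv 1) b / qpoch q_rat (q_rat * sv 2 / sv 1) b *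
       (qpoch q_rat (t_rat * sv 3 / sv 1) b / qpoch q_rat (q_rat * sv 3 / sv 1) b) *
       (qpoch q_rat (t_rat * sv 3 / sv 2) c / qpoch q_rat (q_rat * sv 3 / sv 2) c)) *
      (qpoch q_rat (q_rat powi (- int a) * (q_rat * sv 1 / (t_rat * sv 1))) a / qpoch q_rat (q_rat powi (- int a) * (sv 1 / sv 1)) a *
      (qpoch q_rat (q_rat powi (- int b) * (q_rat * sv 1 / (t_rat * sv 1))) b / qpoch q_rat (q_rat powi (- int b) * (sv 1 / sv 1)) b *
       (qpoch q_rat (q_rat powi (- int c) * (q_rat * sv 2 / (t_rat * sv 1))) b / qpoch q_rat (q_rat powi (- int c) * (sv 2 / sv 1)) b) *
       (qpoch q_rat (q_rat powi (- int c) * (q_rat * sv 2 / (t_rat * sv 2))) c / qpoch q_rat (q_rat powi (- int c) * (sv 2 / sv 2)) c))))"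
  have sv: "sv 1 = 1" "sv 2 = u_rat" "sv 3 = u_rat * v_rat"
  proof -
    have "{1..<2::nat} = {1}" "{1..<3::nat} = {1, 2}" by auto
    then show "sv 1 = 1" "sv 2 = u_rat" "sv 3 = u_rat * v_rat"
      by (simp_all add: sv_def s_ratio_poly_def flip: to_fract_mult)
  qed
  have nz: "u_rat \<noteq> 0" "q_rat \<noteq> 0" "t_rat \<noteq> 0" using q t by simp_all
  have pw: "q_rat powi (- int n) = 1 / q_rat ^ n" for n
    by (simp only: power_int_minus power_int_of_nat inverse_eq_divide)
  have u_v: "q_rat ^ n * (q_rat * v_rat) \<noteq> 1" "q_rat ^ n * (q_rat * u * v_rat) \<noteq> 1" for n
    using const_mult_rat_neq_const(2,3)[of "q ^ n * q"]
    unfolding u_macd_rat by (simp_all add: mult.assoc)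
  have summand: "f (A - b) b (B - b) =
      P A b * (qpoch q_rat (t_rat * u * v_rat) b * qpoch q_rat (t_rat * v_rat) (B - b) *
        rpoch (q_rat * u * v_rat) b * rpoch (q_rat * v_rat) (B - b))" if b: "b \<le> A" "b \<le> B" for b
  proof -
    obtain c where c: "B = b + c" using b by (metis le_iff_add)
    then have Bb: "B - b = c" by simp
    obtain a where a: "A = b + a" using b by (metis le_iff_add)
    then have Ab: "A - b = a" by simp
    have e: "q_rat powi (int b - int c) = q_rat ^ b / q_rat ^ c"
      using nz by (simp add: power_int_diff)
    \<comment> \<open>Here the negative exponents go: theta_13 - theta_23 = b - c = 2 b - B, and
      \<open>u_rat\<close> is q^(B + 1) times \<open>w_rat B\<close>.\<close>
    have 1: "q_rat powi (int b - int c) * (t_rat * u_rat / 1) = t_rat * w_rat B * q_rat ^ (2 * b + 1)"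
      "q_rat powi (int b - int c) * (q_rat * u_rat / 1) = w_rat B * q_rat ^ (2 * b + 2)"
      "q_rat powi (- int c) * (q_rat * u_rat / (t_rat * 1)) = q_rat / t_rat * w_rat B * q_rat ^ (b + 1)"
      "q_rat powi (- int c) * (u_rat / 1) = w_rat B * q_rat ^ (b + 1)"
    proof -
      have "q_rat ^ (b * 2) = q_rat ^ b * q_rat ^ b"
        by (simp add: mult_2_right power_add)
      then show "q_rat powi (int b - int c) * (t_rat * u_rat / 1) = t_rat * w_rat B * q_rat ^ (2 * b + 1)"
        "q_rat powi (int b - int c) * (q_rat * u_rat / 1) = w_rat B * q_rat ^ (2 * b + 2)"
        "q_rat powi (- int c) * (q_rat * u_rat / (t_rat * 1)) = q_rat / t_rat * w_rat B * q_rat ^ (b + 1)"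
        "q_rat powi (- int c) * (u_rat / 1) = w_rat B * q_rat ^ (b + 1)"
        unfolding e pw using nz by (simp_all add: c power_add field_simps)
    qed
    have 2: "t_rat * (u_rat * v_rat) / u_rat = t_rat * v_rat" "q_rat * (u_rat * v_rat) / u_rat = q_rat * v_rat"
      "t_rat * (u_rat * v_rat) / 1 = t_rat * u_rat * v_rat" "q_rat * (u_rat * v_rat) / 1 = q_rat * u_rat * v_rat"
      "t_rat * u_rat / 1 = t_rat * u_rat" "q_rat * u_rat / 1 = q_rat * u_rat"
      "q_rat * 1 / (t_rat * 1) = q_rat / t_rat" "q_rat * u_rat / (t_rat * u_rat) = q_rat / t_rat"
      "u_rat / u_rat = 1" "(1::ratfun) / 1 = 1"
      using nz by simp_all
    have 3: "(q_rat / t_rat) ^ (A + B - b) = (q_rat / t_rat) ^ a * (q_rat / t_rat) ^ b * (q_rat / t_rat) ^ c"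
      by (simp only: a c flip: power_add) (simp add: ac_simps)
    show ?thesis
      unfolding f_def Let_def Ab Bb sv
      unfolding 1
      unfolding 2 mult_1_right
      unfolding qpoch_reversed[OF nz(3)]
      unfolding divide_inverse[of "qpoch _ _ _"]
      unfolding P_def Ab Bb 3 u_macd_rat rpoch_def if_P[OF b(1)]
      by (simp only: mult_ac)
  qed
  have "p3_coeff q t A B = (\<Sum>\<theta>\<in>{\<theta> \<in> upper_matrices 3. \<theta> 1 2 + \<theta> 1 3 = A \<and> \<theta> 1 3 + \<theta> 2 3 = B}. f (\<theta> 1 2) (\<theta> 1 3) (\<theta> 2 3))"
    unfolding p3_coeff_def macd_c_3 f_def sv_def Let_def ..
  also have "\<dots> = (\<Sum>b\<le>min A B. f (A - b) b (B - b))"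
    by (rule upper_matrices_3_sum)
  also have "\<dots> = (\<Sum>b\<le>min A B. P A b * (qpoch q_rat (t_rat * u * v_rat) b * qpoch q_rat (t_rat * v_rat) (B - b) *
        rpoch (q_rat * u * v_rat) b * rpoch (q_rat * v_rat) (B - b)))"
    by (rule sum.cong[OF refl], rule summand) auto
  also have "\<dots> = (\<Sum>b\<le>B. P A b * (qpoch q_rat (t_rat * u * v_rat) b * qpoch q_rat (t_rat * v_rat) (B - b) *
        rpoch (q_rat * u * v_rat) b * rpoch (q_rat * v_rat) (B - b)))"
    by (intro sum.mono_neutral_left) (auto simp: P_def simp del: power_Suc)
  also have "\<dots> = (\<Sum>j\<le>min A B. \<Sum>k\<le>j. S v_rat A j k)"
    using u_v by (rule P_sum_eq_S_sum)
  finally show ?thesis .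
qed

end

section \<open>Poles of the coefficients\<close>

lemma qpoch_hom:
  assumes "\<And>x y. f (x * y) = f x * f y" "\<And>x y. f (x - y) = f x - f y" "f 1 = 1"
  shows "f (qpoch q z n) = qpoch (f q) (f z) n"
proof (induction n)
  case (Suc n)
  have "f (q ^ n) = f q ^ n"
    by (induction n) (simp_all add: assms)
  with Suc show ?case by (simp add: qpoch_Suc assms)
qed (simp add: assms)

text \<open>The numerical factor of a term of the double sum, split off so that only factors
  relevant for poles and expansions remain.\<close>

definition p3_term_const :: "complex \<Rightarrow> complex \<Rightarrow> nat \<Rightarrow> nat \<Rightarrow> nat \<Rightarrow> nat \<Rightarrow> complex" where
  "p3_term_const q t A B j k = qpoch q (q / t) k * qpoch q (q / t) k / (qpoch q q k * qpoch q t k) *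
     q ^ k * (q / t) ^ (A + B - j - k) *
     (qpoch q t (A - j + k) * qpoch q t j * qpoch q t (B - j + k)) /
     (qpoch q q (A - j) * qpoch q q (j - k) * qpoch q q (B - j))"

section \<open>Irreducibility of the pole divisors, and denominators in lowest terms\<close>

lemma pairs3_eq: "pairs3 = {(1, 2), (1, 3), (2, 3)}"
  unfolding pairs3_def by (rule pairs_strict)

text \<open>The constant coefficients of \<open>p\<close> and of its cofactor have product -1, so
  both are units. Hence \<open>p\<close>, not being a unit, has positive degree; the cofactor is
  then constant and itself a unit.\<close>

lemma linear_divisor:
  fixes c :: "'a :: idom"
  assumes "p dvd [:-1, c:]" "\<not> p dvd 1"
  shows "[:-1, c:] dvd p"
proof -
  obtain h where h: "[:-1, c:] = p * h" using assms(1) by (auto simp: dvd_def)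
  then have nz: "p \<noteq> 0" "h \<noteq> 0" by auto
  have "coeff p 0 * coeff h 0 = -1"
    using arg_cong[OF h, of "\<lambda>r. coeff r 0"] by (simp add: coeff_mult_0)
  then have "coeff p 0 dvd - 1" "coeff h 0 dvd - 1"
    using dvd_triv_left[of "coeff p 0" "coeff h 0"] dvd_triv_right[of "coeff h 0" "coeff p 0"] by simp_all
  then have unit: "coeff p 0 dvd 1" "coeff h 0 dvd 1"
    by simp_all
  have "degree p + degree h = degree [:-1, c:]"
    using degree_mult_eq[OF nz] h by simp
  moreover have "degree [:-1, c:] \<le> 1"
    by simp
  moreover have "degree p \<noteq> 0"
  proof
    assume "degree p = 0"
    then obtain p0 where "p = [:p0:]" by (rule degree_eq_zeroE)
    then show False using unit(1) assms(2) by (simp add: is_unit_const_poly_iff)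
  qed
  ultimately have "degree h = 0" by linarith
  then obtain h0 where "h = [:h0:]" by (rule degree_eq_zeroE)
  then have "h dvd 1" using unit(2) by (simp add: is_unit_const_poly_iff)
  then show ?thesis
    by (simp add: h mult_unit_dvd_iff)
qed

text \<open>Cross-multiplication and coprimality of the reduced fraction: any denominator that
  clears \<open>f\<close>, reduced or not, bounds the true one.\<close>

lemma ratfun_denom_dvd:
  assumes "f * to_fract d = to_fract n"
  shows "ratfun_denom f dvd d"
proof -
  have f: "f = to_fract (fst (quot_of_fract f)) / to_fract (ratfun_denom f)"
    unfolding ratfun_denom_def Fract_conv_to_fract[symmetric] by simp
  have "ratfun_denom f \<noteq> 0"
    by (simp add: ratfun_denom_def)
  then have eq: "f * to_fract (ratfun_denom f) = to_fract (fst (quot_of_fract f))"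
    by (subst f) simp
  have "to_fract (fst (quot_of_fract f)) * to_fract d = f * to_fract d * to_fract (ratfun_denom f)"
    unfolding eq[symmetric] by (simp only: mult_ac)
  then have "to_fract (fst (quot_of_fract f)) * to_fract d = to_fract n * to_fract (ratfun_denom f)"
    by (simp only: assms)
  then have "fst (quot_of_fract f) * d = n * ratfun_denom f"
    by (simp flip: to_fract_mult)
  then have "ratfun_denom f dvd fst (quot_of_fract f) * d" by simp
  then show ?thesis
    using coprime_quot_of_fract[of f]
    by (simp add: ratfun_denom_def coprime_commute coprime_dvd_mult_right_iff)
qed

context
  fixes q t :: complex
  assumes q: "q \<noteq> 0" "norm q < 1" and t: "t \<noteq> 0" "norm t < 1"
begin

lemma p3_coeff_explicit:
  "p3_coeff q t A B = (\<Sum>j\<le>min A B. \<Sum>k\<le>j. ratfun_const (p3_term_const q t A B j k) *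
     ((u_rat * v_rat) ^ k * qpoch (ratfun_const q) (ratfun_const t * u_rat) (A - j) *
      qpoch (ratfun_const q) (ratfun_const t * (u_rat * v_rat)) (j - k) *
      qpoch (ratfun_const q) (ratfun_const t * v_rat) (B - j)) *
     inverse (qpoch (ratfun_const q) (ratfun_const q * u_rat) (A - j + k) *
      qpoch (ratfun_const q) (ratfun_const q * (u_rat * v_rat)) j *
      qpoch (ratfun_const q) (ratfun_const q * v_rat) (B - j + k)))"
proof -
  interpret macd "ratfun_const q" "ratfun_const t" "ratfun_const q / ratfun_const t"
    "u_rat / ratfun_const q ^ Suc B" B
    by (rule macd_rat[OF q t])
  have const: "qpoch (ratfun_const q) (ratfun_const z) n = ratfun_const (qpoch q z n)" for z n
    by (rule qpoch_hom[symmetric]) simp_all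
  show ?thesis
    unfolding p3_coeff_eq[OF q t] S_def
    unfolding u_macd_rat[OF q t]
    unfolding rpoch_def
    unfolding ratfun_const_divide[symmetric] const ratfun_const_power[symmetric] p3_term_const_def
    by (intro sum.cong refl) (simp add: divide_inverse power_mult_distrib mult_ac)
qed

lemma pole_divisor_simps:
  "pole_divisor q 1 2 k = [:-1, [:q ^ (k + 1):]:]"
  "pole_divisor q 1 3 k = [:-1, [:0, q ^ (k + 1):]:]"
  "pole_divisor q 2 3 k = [:[:-1, q ^ (k + 1):]:]"
proof -
  have "{1..<2::nat} = {1}" "{1..<3::nat} = {1, 2}" "{2..<3::nat} = {2}" by auto
  then show "pole_divisor q 1 2 k = [:-1, [:q ^ (k + 1):]:]"
    "pole_divisor q 1 3 k = [:-1, [:0, q ^ (k + 1):]:]"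
    "pole_divisor q 2 3 k = [:[:-1, q ^ (k + 1):]:]"
    by (simp_all add: pole_divisor_def s_ratio_poly_def one_pCons)
qed

text \<open>For (1,2) and (1,3) the divisor is linear in the outer variable with constant term -1,
  so \<open>linear_divisor\<close> applies there. For (2,3) it is constant in the outer variable,
  hence so are its divisors, and the lemma is applied to the inner one.\<close>

lemma pole_divisor_associated:
  assumes "prime_elem p" "p dvd pole_divisor q i j k" "(i, j) \<in> pairs3"
  shows "pole_divisor q i j k dvd p"
proof -
  have p: "\<not> p dvd 1" using assms(1) by (simp add: prime_elem_not_unit)
  consider "i = 1 \<and> j = 2" | "i = 1 \<and> j = 3" | "i = 2 \<and> j = 3"
    using assms(3) by (auto simp: pairs3_eq)
  then show ?thesis
  proof cases
    case 3
    have "p dvd [:[:-1, q ^ (k + 1):]:]" using assms(2) 3 by (simp add: pole_divisor_simps)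
    then obtain h where h: "[:[:-1, q ^ (k + 1):]:] = p * h" by (auto simp: dvd_def)
    have "p \<noteq> 0" "h \<noteq> 0" using h by auto
    then have "degree p + degree h = degree [:[:-1, q ^ (k + 1):]:]"
      using degree_mult_eq[of p h] h by simp
    then have "degree p = 0" "degree h = 0" by simp_all
    then obtain p0 h0 where ph: "p = [:p0:]" "h = [:h0:]" by (meson degree_eq_zeroE)
    then have "p0 dvd [:-1, q ^ (k + 1):]" using h by (auto simp: dvd_def)
    moreover have "\<not> p0 dvd 1" using p ph by (simp add: is_unit_const_poly_iff)
    ultimately have "[:-1, q ^ (k + 1):] dvd p0" by (rule linear_divisor)
    then obtain r where "p0 = [:-1, q ^ (k + 1):] * r" by (auto simp: dvd_def)
    then have "p = [:[:-1, q ^ (k + 1):]:] * [:r:]" using ph by simp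
    then have "[:[:-1, q ^ (k + 1):]:] dvd p" by (simp only: dvd_triv_left)
    then show ?thesis using 3 pole_divisor_simps(3)[of k] by (simp only:)
  qed (use assms(2) p in \<open>auto simp: pole_divisor_simps[simplified] intro!: linear_divisor\<close>)
qed

lemma pole_divisor_nonzero: "(i, j) \<in> pairs3 \<Longrightarrow> pole_divisor q i j k \<noteq> 0"
  by (auto simp: pairs3_eq pole_divisor_simps[simplified])

lemma q_power_inj: "q ^ m = q ^ n \<Longrightarrow> m = n"
proof (induction m n rule: linorder_wlog)
  case (le m n)
  then obtain d where d: "n = m + d" by (metis le_iff_add)
  with le q have "q ^ d = 1" by (simp add: power_add)
  then show ?case using q_power_neq_1[OF q t, of "d - 1"] d by (cases d) auto
qed simp

text \<open>Associated divisors differ by a complex constant, which is 1 because every divisor takes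
  the value -1 at the origin. Equal divisors have the same pair and the same power of q, and the
  powers of q are distinct.\<close>

lemma pole_divisor_inj:
  assumes "(i, j) \<in> pairs3" "(i', j') \<in> pairs3"
  assumes "pole_divisor q i j k dvd pole_divisor q i' j' k'" "pole_divisor q i' j' k' dvd pole_divisor q i j k"
  shows "(i, j, k) = (i', j', k')"
proof -
  obtain c where c: "pole_divisor q i' j' k' = pole_divisor q i j k * c" using assms(3) by (auto simp: dvd_def)
  have "pole_divisor q i j k * c dvd pole_divisor q i j k * 1"
    using assms(4) c by simp
  then have "c dvd 1"
    using pole_divisor_nonzero[OF assms(1), of k] by (subst (asm) dvd_mult_cancel_left) simp
  then obtain c1 where c1: "c = [:c1:]" "c1 dvd 1" by (rule is_unit_polyE)
  from c1(2) obtain c0 where c0: "c1 = [:c0:]" by (rule is_unit_polyE)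
  have "poly (poly (pole_divisor q i j k) 0) 0 = -1" if "(i, j) \<in> pairs3" for i j k
    using that by (auto simp: pairs3_eq pole_divisor_simps[simplified])
  moreover have "poly (poly (pole_divisor q i' j' k') 0) 0 = c0 * poly (poly (pole_divisor q i j k) 0) 0"
    using c c0 c1 by simp
  ultimately have "c0 = 1" using assms by simp
  then have "pole_divisor q i' j' k' = pole_divisor q i j k" using c c0 c1 by (simp flip: one_pCons)
  then show ?thesis
    using assms(1,2) q by (auto simp: pairs3_eq pole_divisor_simps[simplified] dest: q_power_inj simp flip: power_Suc)
qed

definition pole_product :: "nat \<Rightarrow> complex poly poly" where
  "pole_product M = (\<Prod>(x, k)\<in>pairs3 \<times> {..<M}. pole_divisor q (fst x) (snd x) k)"

text \<open>The factors are irreducible and pairwise not associated: a prime divides at most one of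
  them, and that one only once.\<close>

lemma multiplicity_pole_product:
  assumes "prime_elem p"
  shows "multiplicity p (pole_product M) \<le> 1"
    and "multiplicity p (pole_product M) > 0 \<Longrightarrow>
      \<exists>(i, j)\<in>pairs3. \<exists>k. p dvd pole_divisor q i j k \<and> pole_divisor q i j k dvd p"
proof -
  define f where "f = (\<lambda>(x, k). pole_divisor q (fst x) (snd x) k)"
  let ?I = "pairs3 \<times> {..<M}"
  have fin: "finite ?I" by (simp add: pairs3_eq)
  have eq: "multiplicity p (pole_product M) = (\<Sum>x\<in>?I. multiplicity p (f x))"
    unfolding pole_product_def f_def[symmetric]
    using fin assms pole_divisor_nonzero by (intro prime_elem_multiplicity_prod_distrib) (auto simp: f_def)
  have le1: "multiplicity p (f x) \<le> 1" if "x \<in> ?I" for x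
  proof (rule ccontr)
    assume "\<not> ?thesis"
    then have "p ^ 2 dvd f x" by (intro multiplicity_dvd') simp
    moreover then have "f x dvd p"
      using that assms pole_divisor_associated by (auto simp: f_def power2_eq_square dest: dvd_mult_left)
    ultimately have "p * p dvd p * 1" by (metis dvd_trans power2_eq_square mult_1_right)
    then show False
      using assms by (metis dvd_mult_cancel_left prime_elem_not_unit prime_elem_not_zeroI)
  qed
  have pos: "p dvd f x \<and> f x dvd p" if "x \<in> ?I" "multiplicity p (f x) > 0" for x
  proof -
    have "p dvd f x" using that(2) by (metis not_dvd_imp_multiplicity_0 less_irrefl)
    then show ?thesis using that(1) assms pole_divisor_associated by (auto simp: f_def)
  qed
  have unique: "x = y" if "x \<in> ?I" "y \<in> ?I" "multiplicity p (f x) > 0" "multiplicity p (f y) > 0" for x y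
  proof -
    have "f x dvd f y" "f y dvd f x"
      using pos that by (meson dvd_trans)+
    moreover obtain i j k where "x = ((i, j), k)" by (metis surj_pair)
    moreover obtain i' j' k' where "y = ((i', j'), k')" by (metis surj_pair)
    ultimately show ?thesis
      using that(1,2) pole_divisor_inj[of i j i' j' k k'] by (simp add: f_def)
  qed
  show "multiplicity p (pole_product M) \<le> 1"
  proof (cases "\<exists>x\<in>?I. multiplicity p (f x) > 0")
    case True
    then obtain x where x: "x \<in> ?I" "multiplicity p (f x) > 0" by auto
    have "(\<Sum>y\<in>?I. multiplicity p (f y)) = (\<Sum>y\<in>{x}. multiplicity p (f y))"
    proof (intro sum.mono_neutral_right ballI)
      fix y assume "y \<in> ?I - {x}"
      then show "multiplicity p (f y) = 0"
        using unique[of y x] x by (metis Diff_iff neq0_conv singletonI)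
    qed (use fin x in auto)
    then show ?thesis using le1[OF x(1)] eq by simp
  next
    case False
    then have "(\<Sum>x\<in>?I. multiplicity p (f x)) = 0"
      by (intro sum.neutral ballI) (meson neq0_conv)
    then show ?thesis using eq by simp
  qed
  show "\<exists>(i, j)\<in>pairs3. \<exists>k. p dvd pole_divisor q i j k \<and> pole_divisor q i j k dvd p"
    if "multiplicity p (pole_product M) > 0"
  proof -
    have "\<exists>x\<in>?I. multiplicity p (f x) > 0"
    proof (rule ccontr)
      assume "\<not> ?thesis"
      then have "(\<Sum>x\<in>?I. multiplicity p (f x)) = 0"
        by (intro sum.neutral ballI) (meson neq0_conv)
      then show False using that eq by simp
    qed
    then obtain x where x: "x \<in> ?I" "multiplicity p (f x) > 0" by blast
    obtain i j k where ijk: "x = ((i, j), k)" by (metis surj_pair)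
    then have "(i, j) \<in> pairs3" "p dvd pole_divisor q i j k \<and> pole_divisor q i j k dvd p"
      using x pos[OF x] by (simp_all add: f_def)
    then show ?thesis by blast
  qed
qed

section \<open>A common denominator of the terms of the double sum\<close>

definition s_poch :: "nat \<Rightarrow> nat \<Rightarrow> nat \<Rightarrow> complex poly poly" where
  "s_poch i j m = qpoch [:[:q:]:] ([:[:q:]:] * s_ratio_poly i j) m"

lemma s_poch_eq: "s_poch i j m = (\<Prod>k<m. - pole_divisor q i j k)"
proof -
  have "[:[:q:]:] ^ k = [:[:q ^ k:]:]" for k
    by (induction k) (simp_all add: one_pCons)
  then show ?thesis
    by (simp add: s_poch_def qpoch_def pole_divisor_def mult_ac)
qed

lemma s_poch_dvd: "m \<le> M \<Longrightarrow> s_poch i j m dvd s_poch i j M"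
  unfolding s_poch_def by (metis dvd_triv_left le_iff_add qpoch_add)

lemma to_fract_s_poch:
  "to_fract (s_poch i j m) = qpoch (ratfun_const q) (ratfun_const q * to_fract (s_ratio_poly i j)) m"
  unfolding s_poch_def ratfun_const_def to_fract_mult[symmetric] by (rule qpoch_hom) simp_all

lemma s_ratio_poly_simps:
  "s_ratio_poly 1 2 = [:0, 1:]" "s_ratio_poly 2 3 = [:[:0, 1:]:]"
  "s_ratio_poly 1 3 = [:0, 1:] * [:[:0, 1:]:]"
proof -
  have "{1..<2::nat} = {1}" "{1..<3::nat} = {1, 2}" "{2..<3::nat} = {2}" by auto
  then show "s_ratio_poly 1 2 = [:0, 1:]" "s_ratio_poly 2 3 = [:[:0, 1:]:]"
    "s_ratio_poly 1 3 = [:0, 1:] * [:[:0, 1:]:]"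
    by (simp_all add: s_ratio_poly_def)
qed

lemma p3_coeff_denominator:
  "\<exists>n. p3_coeff q t A B * to_fract (s_poch 1 2 (A + B) * s_poch 1 3 (A + B) * s_poch 2 3 (A + B)) = to_fract n"
proof -
  let ?D = "s_poch 1 2 (A + B) * s_poch 1 3 (A + B) * s_poch 2 3 (A + B)"
  \<comment> \<open>The polynomials as a subring of the rational functions; the claim is a
    membership, shown for each term.\<close>
  let ?G = "range to_fract :: ratfun set"
  have zero: "0 \<in> ?G" by (simp flip: to_fract_0)
  have add: "x + y \<in> ?G" if "x \<in> ?G" "y \<in> ?G" for x y
    using that by (auto simp flip: to_fract_add)
  have sum: "sum f I \<in> ?G" if "\<And>i. i \<in> I \<Longrightarrow> f i \<in> ?G" for f :: "nat \<Rightarrow> ratfun" and I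
    using that by (induction I rule: infinite_finite_induct) (simp_all add: zero add)
  have mult: "x * y \<in> ?G" if "x \<in> ?G" "y \<in> ?G" for x y
    using that by (auto simp flip: to_fract_mult)
  have const: "ratfun_const c \<in> ?G" for c by (simp add: ratfun_const_def)
  have power: "x ^ k \<in> ?G" if "x \<in> ?G" for x k
    using that by (induction k) (auto intro: mult simp flip: to_fract_1)
  have diff: "x - y \<in> ?G" if "x \<in> ?G" "y \<in> ?G" for x y
    using that by (auto simp flip: to_fract_diff)
  have poch: "qpoch (ratfun_const q) z k \<in> ?G" if "z \<in> ?G" for z k
    by (induction k) (auto simp: qpoch_Suc intro!: mult diff power const that simp flip: to_fract_1)
  have quot: "to_fract d * inverse (to_fract c) \<in> ?G" if "c dvd d" "c \<noteq> 0" for c d :: "complex poly poly"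
  proof -
    from that(1) obtain e where "d = c * e" by (rule dvdE)
    then have "to_fract d * inverse (to_fract c) = to_fract e" using that(2) by simp
    then show ?thesis by simp
  qed
  have nz: "s_poch i j m \<noteq> 0" if "(i, j) \<in> pairs3" for i j m
    using that pole_divisor_nonzero by (simp add: s_poch_eq)
  have "p3_coeff q t A B * to_fract ?D \<in> ?G"
    unfolding p3_coeff_explicit sum_distrib_right
  proof (intro sum)
    fix j k assume "j \<in> {..min A B}" "k \<in> {..j}"
    then have jk: "k \<le> j" "j \<le> A" "j \<le> B" by auto
    have 1: "qpoch (ratfun_const q) (ratfun_const q * u_rat) m = to_fract (s_poch 1 2 m)"
      "qpoch (ratfun_const q) (ratfun_const q * (u_rat * v_rat)) m = to_fract (s_poch 1 3 m)"
      "qpoch (ratfun_const q) (ratfun_const q * v_rat) m = to_fract (s_poch 2 3 m)" for m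
      by (simp_all only: to_fract_s_poch s_ratio_poly_simps to_fract_mult)
    define N where "N = ratfun_const (p3_term_const q t A B j k) *
     ((u_rat * v_rat) ^ k * qpoch (ratfun_const q) (ratfun_const t * u_rat) (A - j) *
      qpoch (ratfun_const q) (ratfun_const t * (u_rat * v_rat)) (j - k) *
      qpoch (ratfun_const q) (ratfun_const t * v_rat) (B - j))"
    have nG: "N \<in> ?G"
      unfolding N_def by (intro mult const power poch) auto
    \<comment> \<open>The lengths A - j + k, j and B - j + k are all at most A + B. The bound may be
      crude, since lengthening the product only adds further distinct primes.\<close>
    have qG: "to_fract (s_poch 1 2 (A + B)) * inverse (to_fract (s_poch 1 2 (A - j + k))) \<in> ?G"
      "to_fract (s_poch 1 3 (A + B)) * inverse (to_fract (s_poch 1 3 j)) \<in> ?G"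
      "to_fract (s_poch 2 3 (A + B)) * inverse (to_fract (s_poch 2 3 (B - j + k))) \<in> ?G"
      using jk by (intro quot s_poch_dvd nz; force simp: pairs3_eq)+
    have "N * ((to_fract (s_poch 1 2 (A + B)) * inverse (to_fract (s_poch 1 2 (A - j + k)))) *
      (to_fract (s_poch 1 3 (A + B)) * inverse (to_fract (s_poch 1 3 j))) *
      (to_fract (s_poch 2 3 (A + B)) * inverse (to_fract (s_poch 2 3 (B - j + k))))) \<in> ?G"
      by (rule mult[OF nG mult[OF mult[OF qG(1) qG(2)] qG(3)]])
    then show "ratfun_const (p3_term_const q t A B j k) *
     ((u_rat * v_rat) ^ k * qpoch (ratfun_const q) (ratfun_const t * u_rat) (A - j) *
      qpoch (ratfun_const q) (ratfun_const t * (u_rat * v_rat)) (j - k) *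
      qpoch (ratfun_const q) (ratfun_const t * v_rat) (B - j)) *
     inverse (qpoch (ratfun_const q) (ratfun_const q * u_rat) (A - j + k) *
      qpoch (ratfun_const q) (ratfun_const q * (u_rat * v_rat)) j *
      qpoch (ratfun_const q) (ratfun_const q * v_rat) (B - j + k)) * to_fract ?D \<in> ?G"
      unfolding N_def[symmetric] 1 to_fract_mult inverse_mult_distrib by (simp only: mult_ac)
  qed
  then show ?thesis by auto
qed

lemma p3_coeff_denom_dvd:
  "ratfun_denom (p3_coeff q t A B) dvd s_poch 1 2 (A + B) * s_poch 1 3 (A + B) * s_poch 2 3 (A + B)"
  using p3_coeff_denominator ratfun_denom_dvd by blast

lemma poly_s_poch_0: "(i, j) \<in> pairs3 \<Longrightarrow> poly (poly (s_poch i j m) 0) 0 = 1"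
  by (auto simp: s_poch_eq poly_prod pairs3_eq pole_divisor_simps[simplified])

lemma p3_coeff_regular: "regular_at_origin (p3_coeff q t A B)"
proof -
  obtain c where "s_poch 1 2 (A + B) * s_poch 1 3 (A + B) * s_poch 2 3 (A + B) = ratfun_denom (p3_coeff q t A B) * c"
    using p3_coeff_denom_dvd by (auto simp: dvd_def)
  from arg_cong[OF this, of "\<lambda>p. poly (poly p 0) 0"] show ?thesis
    using poly_s_poch_0[of 1 2] poly_s_poch_0[of 1 3] poly_s_poch_0[of 2 3]
    by (auto simp: regular_at_origin_def pairs3_eq)
qed

lemma pole_product_eq_s_poch:
  "s_poch 1 2 M * s_poch 1 3 M * s_poch 2 3 M = (-1) ^ (3 * M) * pole_product M"
proof -
  have "(\<Prod>k<M. - pole_divisor q i j k) = (-1) ^ M * (\<Prod>k<M. pole_divisor q i j k)" for i j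
    by (simp add: prod_uminus)
  then show ?thesis
    unfolding s_poch_eq pole_product_def
    by (simp add: prod.cartesian_product' [symmetric] pairs3_eq power_mult power3_eq_cube mult_ac power_mult_distrib flip: prod.cartesian_product)
qed

lemma p3_coeff_poles:
  assumes "prime_elem p"
  shows "pole_order (p3_coeff q t A B) p \<le> 1"
    and "pole_order (p3_coeff q t A B) p > 0 \<Longrightarrow>
      \<exists>(i, j)\<in>pairs3. \<exists>k. p dvd pole_divisor q i j k \<and> pole_divisor q i j k dvd p"
proof -
  have nz: "pole_product (A + B) \<noteq> 0"
    using pole_divisor_nonzero by (auto simp: pole_product_def pairs3_eq)
  have "ratfun_denom (p3_coeff q t A B) dvd (-1) ^ (3 * (A + B)) * pole_product (A + B)"
    using p3_coeff_denom_dvd by (simp only: pole_product_eq_s_poch)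
  then have "ratfun_denom (p3_coeff q t A B) dvd pole_product (A + B)"
    by (simp add: dvd_mult_unit_iff' is_unit_power_iff)
  then have "pole_order (p3_coeff q t A B) p \<le> multiplicity p (pole_product (A + B))"
    unfolding pole_order_def using nz by (rule dvd_imp_multiplicity_le)
  with multiplicity_pole_product[OF assms, of "A + B"]
  show "pole_order (p3_coeff q t A B) p \<le> 1"
    "pole_order (p3_coeff q t A B) p > 0 \<Longrightarrow>
      \<exists>(i, j)\<in>pairs3. \<exists>k. p dvd pole_divisor q i j k \<and> pole_divisor q i j k dvd p"
    by auto
qed

lemma p3_coeff_0_0: "p3_coeff q t 0 0 = 1"
  by (simp add: p3_coeff_explicit p3_term_const_def)

end

section \<open>Coefficientwise convergence and the $q$-binomial theorem\<close>

unbundle fps_syntax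

definition tendsto4 :: "(nat \<Rightarrow> ps4) \<Rightarrow> ps4 \<Rightarrow> bool" where
  "tendsto4 F L \<longleftrightarrow> (\<forall>a b c d. (\<lambda>n. F n $ a $ b $ c $ d) \<longlonglongrightarrow> L $ a $ b $ c $ d)"

lemma ps4_eqI: "(\<And>a b c d. F $ a $ b $ c $ d = G $ a $ b $ c $ d) \<Longrightarrow> F = (G :: ps4)"
  by (simp add: fps_eq_iff)

lemma ps4_mult_nth:
  fixes F G :: ps4
  shows "(F * G) $ a $ b $ c $ d = (\<Sum>i\<le>a. \<Sum>j\<le>b. \<Sum>k\<le>c. \<Sum>l\<le>d.
     F $ i $ j $ k $ l * G $ (a - i) $ (b - j) $ (c - k) $ (d - l))"
  by (simp add: fps_mult_nth fps_sum_nth atLeast0AtMost)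

lemma ps4_sum_nth: "(\<Sum>i\<in>I. F i :: ps4) $ a $ b $ c $ d = (\<Sum>i\<in>I. F i $ a $ b $ c $ d)"
  by (simp add: fps_sum_nth)

lemma tendsto4_mult: "tendsto4 F L \<Longrightarrow> tendsto4 G M \<Longrightarrow> tendsto4 (\<lambda>n. F n * G n) (L * M)"
  unfolding tendsto4_def ps4_mult_nth by (intro allI tendsto_sum tendsto_mult) auto

lemma tendsto4_const [simp]: "tendsto4 (\<lambda>n. F) F"
  by (simp add: tendsto4_def)

lemma tendsto4_unique: "tendsto4 F L \<Longrightarrow> tendsto4 F M \<Longrightarrow> L = M"
  unfolding tendsto4_def by (intro ps4_eqI) (blast intro: LIMSEQ_unique)

lemma ps4_lim_eq: "tendsto4 F L \<Longrightarrow> ps4_lim F = L"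
  unfolding tendsto4_def ps4_lim_def by (intro ps4_eqI) (simp add: limI)

lemma tendsto4_shift: "tendsto4 F L \<Longrightarrow> tendsto4 (\<lambda>n. F (n + m)) L"
  unfolding tendsto4_def by (auto intro: LIMSEQ_ignore_initial_segment)

lemma ps4_sums_iff_tendsto4: "ps4_sums f F \<longleftrightarrow> tendsto4 (\<lambda>n. \<Sum>m<n. f m) F"
  by (simp add: ps4_sums_def tendsto4_def sums_def ps4_sum_nth)

lemma ps4_suminf_eq: "ps4_sums f F \<Longrightarrow> ps4_suminf f = F"
  unfolding ps4_sums_iff_tendsto4 ps4_suminf_def by (rule ps4_lim_eq)

lemma ps4_sums_unique: "ps4_sums f F \<Longrightarrow> ps4_sums f G \<Longrightarrow> F = G"
  unfolding ps4_sums_iff_tendsto4 by (rule tendsto4_unique)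

lemma ps4_sums_mult: "ps4_sums f F \<Longrightarrow> ps4_sums (\<lambda>m. G * f m) (G * F)"
  unfolding ps4_sums_iff_tendsto4 sum_distrib_left[symmetric] by (rule tendsto4_mult) simp

lemma ps4_sums_diff: "ps4_sums f F \<Longrightarrow> ps4_sums g G \<Longrightarrow> ps4_sums (\<lambda>m. f m - g m) (F - G)"
  unfolding ps4_sums_def by (auto intro: sums_diff)

section \<open>Absolute summability and order of vanishing\<close>

definition summable4 :: "(nat \<Rightarrow> ps4) \<Rightarrow> bool" where
  "summable4 f \<longleftrightarrow> (\<forall>a b c d. summable (\<lambda>m. norm (f m $ a $ b $ c $ d)))"

lemma summable4_imp_sums:
  assumes "summable4 f"
  shows "ps4_sums f (ps4_suminf f)"
proof -
  define F where "F = Abs_fps (\<lambda>a. Abs_fps (\<lambda>b. Abs_fps (\<lambda>c. Abs_fps (\<lambda>d. \<Sum>m. f m $ a $ b $ c $ d))))"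
  have F: "ps4_sums f F"
    unfolding ps4_sums_def
  proof (intro allI)
    fix a b c d
    have "summable (\<lambda>m. f m $ a $ b $ c $ d)"
      using assms unfolding summable4_def by (blast intro: summable_norm_cancel)
    then show "(\<lambda>m. f m $ a $ b $ c $ d) sums (F $ a $ b $ c $ d)"
      by (simp add: F_def summable_sums)
  qed
  show ?thesis unfolding ps4_suminf_eq[OF F] by (rule F)
qed

text \<open>Lower bound for the total degree in all four variables. If the r-th term of a series has
  order r, each coefficient of the sum receives finitely many contributions.\<close>

definition ord4 :: "nat \<Rightarrow> ps4 \<Rightarrow> bool" where
  "ord4 n F \<longleftrightarrow> (\<forall>a b c d. a + b + c + d < n \<longrightarrow> F $ a $ b $ c $ d = 0)"

lemma ord4_mult:
  assumes "ord4 m F" "ord4 n G"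
  shows "ord4 (m + n) (F * G)"
  unfolding ord4_def
proof (intro allI impI)
  fix a b c d assume less: "a + b + c + d < m + n"
  have "F $ i $ j $ k $ l * G $ (a - i) $ (b - j) $ (c - k) $ (d - l) = 0"
    if "i \<le> a" "j \<le> b" "k \<le> c" "l \<le> d" for i j k l
  proof (cases "i + j + k + l < m")
    case False
    then have "(a - i) + (b - j) + (c - k) + (d - l) < n" using that less by linarith
    then show ?thesis using assms by (simp add: ord4_def)
  qed (use assms in \<open>simp add: ord4_def\<close>)
  then show "(F * G) $ a $ b $ c $ d = 0"
    unfolding ps4_mult_nth by (intro sum.neutral ballI) auto
qed

lemma ord4_0 [simp]: "ord4 0 F"
  by (simp add: ord4_def)

lemma ord4_mult_right: "ord4 m F \<Longrightarrow> ord4 m (F * G)"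
  using ord4_mult[of m F 0 G] by simp

lemma ord4_mult_left: "ord4 m F \<Longrightarrow> ord4 m (G * F)"
  using ord4_mult[of 0 G m F] by simp

lemma ord4_power: "ord4 1 F \<Longrightarrow> ord4 n (F ^ n)"
  by (induction n) (use ord4_mult[of 1 F] in auto)

lemma ord4_nth_0: "ord4 1 F \<Longrightarrow> F $ 0 $ 0 $ 0 $ 0 = 0"
  by (simp add: ord4_def)

lemma ord4_imp_summable4:
  assumes "\<And>r. ord4 r (f r)"
  shows "summable4 f"
  unfolding summable4_def
proof (intro allI)
  fix a b c d
  show "summable (\<lambda>m. norm (f m $ a $ b $ c $ d))"
    using assms by (intro summable_finite[of "{..a + b + c + d}"]) (auto simp: ord4_def)
qed

text \<open>The range of the finite sum depends on the coefficient alone and not on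
  \<open>G\<close>. In \<open>heine\<close> this reduces the interchange of two infinite sums to
  that of an infinite and a finite one.\<close>

lemma ord4_sums_mult_nth:
  assumes "\<And>r. ord4 r (f r)" "ps4_sums f F"
  shows "(F * G) $ a $ b $ c $ d = (\<Sum>r\<le>a + b + c + d. (f r * G) $ a $ b $ c $ d)"
proof -
  have "ps4_sums (\<lambda>r. G * f r) (G * F)"
    using assms(2) by (rule ps4_sums_mult)
  then have "(\<lambda>r. (f r * G) $ a $ b $ c $ d) sums ((F * G) $ a $ b $ c $ d)"
    by (simp add: ps4_sums_def mult.commute)
  moreover have "(\<lambda>r. (f r * G) $ a $ b $ c $ d) sums (\<Sum>r\<le>a + b + c + d. (f r * G) $ a $ b $ c $ d)"
  proof (intro sums_finite)
    show "(f r * G) $ a $ b $ c $ d = 0" if "r \<notin> {..a + b + c + d}" for r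
      using ord4_mult_right[OF assms(1), of r G] that by (simp add: ord4_def)
  qed simp
  ultimately show ?thesis by (rule sums_unique2)
qed

lemma const4_hom [simp]:
  "const4 0 = 0" "const4 1 = 1" "const4 (x + y) = const4 x + const4 y" "const4 (x - y) = const4 x - const4 y"
  "const4 (x * y) = const4 x * const4 y"
  by (simp_all add: const4_def)

lemma const4_power [simp]: "const4 (x ^ n) = const4 x ^ n"
  by (induction n) simp_all

lemma const4_mult_nth [simp]: "(const4 x * F) $ a $ b $ c $ d = x * F $ a $ b $ c $ d"
  by (simp add: const4_def)

lemma ps4_mult_nth_0: "(F * G :: ps4) $ 0 $ 0 $ 0 $ 0 = F $ 0 $ 0 $ 0 $ 0 * G $ 0 $ 0 $ 0 $ 0"
  by simp

text \<open>Stated over a ring with an \<open>inverse\<close> operation, so that it can be applied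
  at each of the four layers of an iterated series, ending at a nonzero complex number.\<close>

lemma fps_mult_inverse_nested:
  fixes f :: "'a :: {comm_ring_1, inverse} fps"
  assumes "f $ 0 * inverse (f $ 0) = 1"
  shows "f * inverse f = 1"
  using fps_right_inverse[OF assms] by (simp add: fps_inverse_def)

lemma ps4_mult_inverse:
  fixes F :: ps4
  assumes "F $ 0 $ 0 $ 0 $ 0 \<noteq> 0"
  shows "F * inverse F = 1"
  using assms by (intro fps_mult_inverse_nested) simp

lemma ps4_inverse_unique:
  fixes F G :: ps4
  assumes "F * G = 1"
  shows "inverse F = G"
proof -
  have "F $ 0 $ 0 $ 0 $ 0 * G $ 0 $ 0 $ 0 $ 0 = 1"
    using assms ps4_mult_nth_0[of F G] by simp
  then have *: "F * inverse F = 1" by (intro ps4_mult_inverse) auto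
  have "inverse F = inverse F * (F * G)" using assms by simp
  also have "\<dots> = (F * inverse F) * G" by (simp only: mult_ac)
  finally show ?thesis using * by simp
qed

lemma ps4_inverse_nth_0: "F $ 0 $ 0 $ 0 $ 0 \<noteq> 0 \<Longrightarrow> inverse (F :: ps4) $ 0 $ 0 $ 0 $ 0 \<noteq> 0"
  using ps4_mult_inverse[of F] ps4_mult_nth_0[of F "inverse F"] by auto

lemma ps4_inverse_mult:
  fixes F G :: ps4
  assumes "F $ 0 $ 0 $ 0 $ 0 \<noteq> 0" "G $ 0 $ 0 $ 0 $ 0 \<noteq> 0"
  shows "inverse (F * G) = inverse F * inverse G"
proof (rule ps4_inverse_unique)
  have "F * G * (inverse F * inverse G) = (F * inverse F) * (G * inverse G)"
    by (simp only: mult_ac)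
  then show "F * G * (inverse F * inverse G) = 1"
    using assms by (simp add: ps4_mult_inverse)
qed

lemma const4_inverse: "x \<noteq> 0 \<Longrightarrow> inverse (const4 x) = const4 (inverse x)"
  by (intro ps4_inverse_unique) (simp flip: const4_hom(5))

lemma qpoch_const4: "qpoch (const4 q) (const4 z) n = const4 (qpoch q z n)"
  by (induction n) (simp_all add: qpoch_Suc)

lemma qpoch_nth_0: "ord4 1 Z \<Longrightarrow> qpoch (const4 q) Z n $ 0 $ 0 $ 0 $ 0 = 1"
proof (induction n)
  case (Suc n)
  have "ord4 1 (const4 q ^ n * Z)" using Suc.prems by (rule ord4_mult_left)
  then show ?case using Suc by (simp add: qpoch_Suc ord4_nth_0 del: fps_mult_nth_0 add: ps4_mult_nth_0)
qed simp

section \<open>Infinite products and the q-binomial theorem\<close>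

context
  fixes q :: complex
  assumes q: "norm q < 1"
begin

lemma norm_q_power_Suc_le: "norm (q ^ Suc n) \<le> norm q"
  using q unfolding norm_power by (intro power_Suc_le_self) auto

lemma q_power_Suc_neq_1: "q ^ Suc n \<noteq> 1"
proof
  assume "q ^ Suc n = 1"
  then show False using norm_q_power_Suc_le[of n] q by simp
qed

lemma qq_neq_0: "qpoch q q n \<noteq> 0"
  by (rule qpoch_nonzero) (metis power_Suc2 q_power_Suc_neq_1)

definition q_binomial_term :: "ps4 \<Rightarrow> ps4 \<Rightarrow> nat \<Rightarrow> ps4" where
  "q_binomial_term a Z m = qpoch (const4 q) a m * const4 (inverse (qpoch q q m)) * Z ^ m"

text \<open>In the difference of the two series the m-th term acquires the factor 1 - q^m, which
  cancels the last factor of (q;q)_m and lowers the index by one.\<close>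

lemma q_binomial_term_step:
  assumes "ps4_sums (q_binomial_term a Z) H" "ps4_sums (q_binomial_term a (const4 q * Z)) H'"
  shows "(1 - Z) * H = (1 - a * Z) * H'"
proof -
  define g where "g m = q_binomial_term a Z m - q_binomial_term a (const4 q * Z) m" for m
  have g: "ps4_sums g (H - H')"
    unfolding g_def using assms by (rule ps4_sums_diff)
  have "ps4_sums (\<lambda>m. g (Suc m)) (H - H')"
    unfolding ps4_sums_def
  proof (intro allI)
    fix a b c d
    have "g 0 = 0" by (simp add: g_def q_binomial_term_def)
    then show "(\<lambda>m. g (Suc m) $ a $ b $ c $ d) sums ((H - H') $ a $ b $ c $ d)"
      using g by (subst sums_Suc_iff) (auto simp: ps4_sums_def)
  qed
  moreover have "g (Suc m) = Z * (q_binomial_term a Z m - a * q_binomial_term a (const4 q * Z) m)" for m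
  proof -
    have "inverse (qpoch q q m) = inverse (qpoch q q (Suc m)) * (1 - q ^ Suc m)"
      using q_power_Suc_neq_1[of m] by (simp add: qpoch_Suc mult_ac)
    then have 1: "const4 (inverse (qpoch q q m)) = const4 (inverse (qpoch q q (Suc m))) * (1 - const4 q ^ Suc m)"
      by (simp del: power_Suc flip: const4_hom(2,4,5) const4_power)
    have "g (Suc m) = qpoch (const4 q) a (Suc m) * (const4 (inverse (qpoch q q (Suc m))) * (1 - const4 q ^ Suc m)) * Z ^ Suc m"
      by (simp add: g_def q_binomial_term_def power_mult_distrib algebra_simps)
    also have "\<dots> = qpoch (const4 q) a (Suc m) * const4 (inverse (qpoch q q m)) * Z ^ Suc m"
      by (simp only: 1)
    also have "\<dots> = Z * (q_binomial_term a Z m - a * q_binomial_term a (const4 q * Z) m)"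
      by (simp add: qpoch_Suc q_binomial_term_def power_mult_distrib algebra_simps)
    finally show ?thesis .
  qed
  moreover have "ps4_sums (\<lambda>m. Z * (q_binomial_term a Z m - a * q_binomial_term a (const4 q * Z) m)) (Z * (H - a * H'))"
    using assms by (intro ps4_sums_mult ps4_sums_diff)
  ultimately have "H - H' = Z * (H - a * H')"
    using ps4_sums_unique by simp
  then show ?thesis by (simp add: algebra_simps)
qed

text \<open>Each term of positive index picks up at least a factor q^n, so the distance of a
  coefficient from that of 1 is at most |q|^n times the absolute sum of the original tail.\<close>

lemma q_binomial_term_limit:
  assumes "summable4 (q_binomial_term a Z)"
  shows "tendsto4 (\<lambda>n. ps4_suminf (q_binomial_term a (const4 q ^ n * Z))) 1"
    and "summable4 (q_binomial_term a (const4 q ^ n * Z))"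
proof -
  have nth: "q_binomial_term a (const4 q ^ n * Z) m $ i $ j $ k $ l = (q ^ n) ^ m * q_binomial_term a Z m $ i $ j $ k $ l" for n m i j k l
  proof -
    have "q_binomial_term a (const4 q ^ n * Z) m = const4 ((q ^ n) ^ m) * q_binomial_term a Z m"
      by (simp add: q_binomial_term_def power_mult_distrib mult_ac)
    then show ?thesis by (simp only: const4_mult_nth)
  qed
  have le: "norm (q_binomial_term a (const4 q ^ n * Z) m $ i $ j $ k $ l) \<le> norm (q_binomial_term a Z m $ i $ j $ k $ l)" for n m i j k l
  proof -
    have "norm ((q ^ n) ^ m) \<le> 1"
      unfolding norm_power using q by (intro power_le_one) auto
    then show ?thesis unfolding nth norm_mult by (intro mult_left_le_one_le) auto
  qed
  show abs: "summable4 (q_binomial_term a (const4 q ^ n * Z))" for n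
    unfolding summable4_def
  proof (intro allI)
    fix i j k l
    have "summable (\<lambda>m. norm (q_binomial_term a Z m $ i $ j $ k $ l))"
      using assms by (simp add: summable4_def)
    then show "summable (\<lambda>m. norm (q_binomial_term a (const4 q ^ n * Z) m $ i $ j $ k $ l))"
      by (rule summable_comparison_test') (simp add: le)
  qed
  show "tendsto4 (\<lambda>n. ps4_suminf (q_binomial_term a (const4 q ^ n * Z))) 1"
    unfolding tendsto4_def
  proof (intro allI)
    fix i j k l
    define h where "h n m = q_binomial_term a (const4 q ^ n * Z) m $ i $ j $ k $ l" for n m
    define K where "K = (\<Sum>m. norm (q_binomial_term a Z (Suc m) $ i $ j $ k $ l))"
    have sm: "summable (\<lambda>m. norm (q_binomial_term a Z (Suc m) $ i $ j $ k $ l))"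
      using assms unfolding summable4_def by (subst summable_Suc_iff) blast
    have h0: "h n 0 = (1 :: ps4) $ i $ j $ k $ l" for n
      by (simp add: h_def q_binomial_term_def)
    have bound: "norm (ps4_suminf (q_binomial_term a (const4 q ^ n * Z)) $ i $ j $ k $ l - (1 :: ps4) $ i $ j $ k $ l) \<le> norm q ^ n * K" for n
    proof -
      have hs: "h n sums (ps4_suminf (q_binomial_term a (const4 q ^ n * Z)) $ i $ j $ k $ l)"
        using summable4_imp_sums[OF abs[of n]] by (simp add: ps4_sums_def h_def[abs_def])
      then have tail: "(\<lambda>m. h n (Suc m)) sums (ps4_suminf (q_binomial_term a (const4 q ^ n * Z)) $ i $ j $ k $ l - (1 :: ps4) $ i $ j $ k $ l)"
        using h0[of n] by (subst sums_Suc_iff) simp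
      have le': "norm (h n (Suc m)) \<le> norm q ^ n * norm (q_binomial_term a Z (Suc m) $ i $ j $ k $ l)" for m
      proof -
        have "norm ((q ^ n) ^ Suc m) \<le> norm (q ^ n)"
          unfolding norm_power using q by (intro power_Suc_le_self power_le_one) auto
        then have "norm ((q ^ n) ^ Suc m) \<le> norm q ^ n"
          by (simp only: norm_power)
        then show ?thesis unfolding h_def nth norm_mult by (intro mult_right_mono) auto
      qed
      have sm': "summable (\<lambda>m. norm q ^ n * norm (q_binomial_term a Z (Suc m) $ i $ j $ k $ l))"
        using sm by (rule summable_mult)
      have "summable (\<lambda>m. norm (h n (Suc m)))"
        by (rule summable_comparison_test'[OF sm']) (simp add: le')
      then have "norm (\<Sum>m. h n (Suc m)) \<le> (\<Sum>m. norm q ^ n * norm (q_binomial_term a Z (Suc m) $ i $ j $ k $ l))"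
        using summable_norm[of "\<lambda>m. h n (Suc m)"] suminf_le[OF le' _ sm'] by linarith
      then show ?thesis
        unfolding K_def suminf_mult[OF sm] sums_unique[OF tail, symmetric] .
    qed
    have "(\<lambda>n. norm q ^ n * K) \<longlonglongrightarrow> 0 * K"
      using q by (intro tendsto_mult LIMSEQ_power_zero tendsto_const) auto
    note * = this
    show "(\<lambda>n. ps4_suminf (q_binomial_term a (const4 q ^ n * Z)) $ i $ j $ k $ l) \<longlonglongrightarrow> (1 :: ps4) $ i $ j $ k $ l"
    proof (rule LIM_zero_cancel, rule tendsto_norm_zero_cancel)
      show "(\<lambda>n. norm (ps4_suminf (q_binomial_term a (const4 q ^ n * Z)) $ i $ j $ k $ l - (1 :: ps4) $ i $ j $ k $ l)) \<longlonglongrightarrow> 0"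
        by (rule tendsto_sandwich[OF _ _ tendsto_const *[unfolded mult_zero_left]]) (use bound in auto)
    qed
  qed
qed

lemma q_binomial_term_iterate:
  assumes "summable4 (q_binomial_term a Z)"
  shows "qpoch (const4 q) Z n * ps4_suminf (q_binomial_term a Z) =
    qpoch (const4 q) (a * Z) n * ps4_suminf (q_binomial_term a (const4 q ^ n * Z))"
proof (induction n)
  case (Suc n)
  have "(1 - const4 q ^ n * Z) * ps4_suminf (q_binomial_term a (const4 q ^ n * Z)) =
      (1 - a * (const4 q ^ n * Z)) * ps4_suminf (q_binomial_term a (const4 q ^ Suc n * Z))"
    using q_binomial_term_step[of a "const4 q ^ n * Z"] summable4_imp_sums[OF q_binomial_term_limit(2)[OF assms], of n]
      summable4_imp_sums[OF q_binomial_term_limit(2)[OF assms], of "Suc n"] by (simp add: mult.assoc)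
  then have "qpoch (const4 q) (a * Z) n * ((1 - const4 q ^ n * Z) * ps4_suminf (q_binomial_term a (const4 q ^ n * Z))) =
      qpoch (const4 q) (a * Z) (Suc n) * ps4_suminf (q_binomial_term a (const4 q ^ Suc n * Z))"
    by (simp add: qpoch_Suc mult_ac)
  moreover have "qpoch (const4 q) Z (Suc n) * ps4_suminf (q_binomial_term a Z) =
      qpoch (const4 q) (a * Z) n * ((1 - const4 q ^ n * Z) * ps4_suminf (q_binomial_term a (const4 q ^ n * Z)))"
    using Suc by (simp add: qpoch_Suc mult_ac)
  ultimately show ?case by simp
qed simp

text \<open>The case \<open>a = 0\<close> of the \<open>q\<close>-binomial theorem yields the existence of \<open>qpoch_inf\<close>.\<close>

definition admissible :: "ps4 \<Rightarrow> bool" where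
  "admissible Z \<longleftrightarrow> summable4 (q_binomial_term 0 Z)"

lemma qpoch_0_right: "qpoch r 0 n = 1"
  by (simp add: qpoch_def)

text \<open>Euler's identity: for a = 0 the iteration reads (Z;q)_n H(Z) = H(q^n Z), and the right
  side tends to 1. Hence H(Z) has a nonzero constant term, and (Z;q)_n converges to its
  inverse.\<close>

lemma admissible_qpoch_inf:
  assumes "admissible Z"
  shows "tendsto4 (qpoch (const4 q) Z) (qpoch_inf q Z)" "qpoch_inf q Z $ 0 $ 0 $ 0 $ 0 \<noteq> 0"
proof -
  let ?H = "ps4_suminf (q_binomial_term 0 Z)"
  have abs: "summable4 (q_binomial_term 0 Z)" using assms by (simp add: admissible_def)
  have "tendsto4 (\<lambda>n. qpoch (const4 q) Z n * ?H) 1"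
    using q_binomial_term_limit(1)[OF abs] unfolding q_binomial_term_iterate[OF abs] by (simp add: qpoch_0_right)
  then have "(\<lambda>n. (qpoch (const4 q) Z n * ?H) $ 0 $ 0 $ 0 $ 0) \<longlonglongrightarrow> (1 :: ps4) $ 0 $ 0 $ 0 $ 0"
    unfolding tendsto4_def by blast
  then have H: "?H $ 0 $ 0 $ 0 $ 0 \<noteq> 0"
    by (auto simp: LIMSEQ_const_iff)
  have "tendsto4 (\<lambda>n. inverse ?H * (qpoch (const4 q) Z n * ?H)) (inverse ?H * 1)"
    using \<open>tendsto4 (\<lambda>n. qpoch (const4 q) Z n * ?H) 1\<close> by (intro tendsto4_mult) simp_all
  moreover have "inverse ?H * (qpoch (const4 q) Z n * ?H) = qpoch (const4 q) Z n" for n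
  proof -
    have "inverse ?H * (qpoch (const4 q) Z n * ?H) = (?H * inverse ?H) * qpoch (const4 q) Z n"
      by (simp only: mult_ac)
    then show ?thesis using ps4_mult_inverse[OF H] by simp
  qed
  ultimately have lim: "tendsto4 (qpoch (const4 q) Z) (inverse ?H)" by simp
  then have eq: "qpoch_inf q Z = inverse ?H"
    unfolding qpoch_inf_def by (rule ps4_lim_eq)
  show "tendsto4 (qpoch (const4 q) Z) (qpoch_inf q Z)" using lim eq by simp
  show "qpoch_inf q Z $ 0 $ 0 $ 0 $ 0 \<noteq> 0" unfolding eq using H by (rule ps4_inverse_nth_0)
qed

lemma q_binomial:
  assumes "admissible Z" "admissible (a * Z)" "summable4 (q_binomial_term a Z)"
  shows "qpoch_inf q Z * ps4_suminf (q_binomial_term a Z) = qpoch_inf q (a * Z)"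
proof -
  have "tendsto4 (\<lambda>n. qpoch (const4 q) Z n * ps4_suminf (q_binomial_term a Z)) (qpoch_inf q Z * ps4_suminf (q_binomial_term a Z))"
    using admissible_qpoch_inf(1)[OF assms(1)] by (intro tendsto4_mult) simp_all
  moreover have "tendsto4 (\<lambda>n. qpoch (const4 q) (a * Z) n * ps4_suminf (q_binomial_term a (const4 q ^ n * Z))) (qpoch_inf q (a * Z) * 1)"
    using admissible_qpoch_inf(1)[OF assms(2)] q_binomial_term_limit(1)[OF assms(3)] by (rule tendsto4_mult)
  ultimately show ?thesis
    unfolding q_binomial_term_iterate[OF assms(3)] using tendsto4_unique by force
qed

lemma admissible_q_power: "admissible Z \<Longrightarrow> admissible (const4 q ^ n * Z)"
  unfolding admissible_def by (rule q_binomial_term_limit(2))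

lemma qpoch_inf_shift:
  assumes "admissible Z"
  shows "qpoch_inf q Z = qpoch (const4 q) Z m * qpoch_inf q (const4 q ^ m * Z)"
proof -
  have "tendsto4 (\<lambda>n. qpoch (const4 q) Z (n + m)) (qpoch_inf q Z)"
    using admissible_qpoch_inf(1)[OF assms] by (rule tendsto4_shift)
  moreover have "tendsto4 (\<lambda>n. qpoch (const4 q) Z m * qpoch (const4 q) (const4 q ^ m * Z) n)
      (qpoch (const4 q) Z m * qpoch_inf q (const4 q ^ m * Z))"
    using admissible_qpoch_inf(1)[OF admissible_q_power[OF assms]] by (intro tendsto4_mult) simp_all
  moreover have "qpoch (const4 q) Z (n + m) = qpoch (const4 q) Z m * qpoch (const4 q) (const4 q ^ m * Z) n" for n
    by (simp add: qpoch_add add.commute[of n])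
  ultimately show ?thesis using tendsto4_unique by force
qed

lemma ord4_q_binomial_term: "ord4 1 Z \<Longrightarrow> ord4 m (q_binomial_term a Z m)"
  unfolding q_binomial_term_def by (intro ord4_mult_left ord4_power)

lemma ord4_summable4_q_binomial_term: "ord4 1 Z \<Longrightarrow> summable4 (q_binomial_term a Z)"
  by (intro ord4_imp_summable4 ord4_q_binomial_term)

lemma ord4_admissible: "ord4 1 Z \<Longrightarrow> admissible Z"
  unfolding admissible_def by (rule ord4_summable4_q_binomial_term)

lemma summable_power_over_qpoch:
  assumes "norm z < 1"
  shows "summable (\<lambda>m. norm (z ^ m / qpoch q q m))"
proof -
  \<comment> \<open>The quotients of successive terms tend to the norm of z, so any r strictly
    between it and 1 serves in the ratio test.\<close>
  define r where "r = (norm z + 1) / 2"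
  have r: "norm z < r" "r < 1" using assms by (auto simp: r_def)
  have "(\<lambda>m. norm (1 - q ^ m * q)) \<longlonglongrightarrow> norm (1 - 0 * q)"
    using q by (intro tendsto_intros LIMSEQ_power_zero) auto
  moreover have "norm z / r < norm (1 - 0 * q)"
    using r norm_ge_zero[of z] by (simp add: divide_less_eq del: norm_ge_zero)
  ultimately have "eventually (\<lambda>m. norm z / r < norm (1 - q ^ m * q)) sequentially"
    by (rule order_tendstoD(1))
  then obtain N where N: "\<And>m. m \<ge> N \<Longrightarrow> norm z / r < norm (1 - q ^ m * q)"
    by (auto simp: eventually_at_top_linorder)
  show ?thesis
  proof (rule summable_ratio_test[of r N])
    show "r < 1" by fact
    fix m assume "N \<le> m"
    have pos: "r > 0" using r norm_ge_zero[of z] by linarith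
    have nz: "norm (1 - q ^ m * q) > 0"
      using q_power_Suc_neq_1[of m] by (simp add: mult.commute)
    have "norm z / norm (1 - q ^ m * q) \<le> r"
      using N[OF \<open>N \<le> m\<close>] pos nz by (simp add: field_simps)
    then have "norm (z ^ m / qpoch q q m) * (norm z / norm (1 - q ^ m * q)) \<le> norm (z ^ m / qpoch q q m) * r"
      by (intro mult_left_mono) auto
    then show "norm (norm (z ^ Suc m / qpoch q q (Suc m))) \<le> r * norm (norm (z ^ m / qpoch q q m))"
      by (simp add: qpoch_Suc norm_mult norm_divide mult_ac)
  qed
qed

text \<open>A constant argument has powers of order 0, so here summability is analytic: the series
  of z^m/(q;q)_m converges absolutely, and the coefficients of (a;q)_m are bounded.\<close>

lemma const4_summable4_q_binomial_term:
  assumes "norm z < 1" "\<And>i j k l. Bseq (\<lambda>m. qpoch (const4 q) a m $ i $ j $ k $ l)"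
  shows "summable4 (q_binomial_term a (const4 z))"
  unfolding summable4_def
proof (intro allI)
  fix i j k l
  obtain K where K: "\<And>m. norm (qpoch (const4 q) a m $ i $ j $ k $ l) \<le> K"
    using assms(2)[of i j k l] by (auto simp: Bseq_def)
  have "q_binomial_term a (const4 z) m = const4 (z ^ m / qpoch q q m) * qpoch (const4 q) a m" for m
    by (simp add: q_binomial_term_def divide_inverse mult_ac)
  then have nth: "q_binomial_term a (const4 z) m $ i $ j $ k $ l = z ^ m / qpoch q q m * qpoch (const4 q) a m $ i $ j $ k $ l" for m
    by (simp only: const4_mult_nth)
  have "summable (\<lambda>m. norm (z ^ m / qpoch q q m) * K)"
    using summable_power_over_qpoch[OF assms(1)] by (rule summable_mult2)
  then show "summable (\<lambda>m. norm (q_binomial_term a (const4 z) m $ i $ j $ k $ l))"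
    unfolding nth norm_mult
    by (rule summable_comparison_test') (use K in \<open>auto intro!: mult_mono simp: norm_mult\<close>)
qed

lemma const4_admissible: "norm z < 1 \<Longrightarrow> admissible (const4 z)"
  unfolding admissible_def by (rule const4_summable4_q_binomial_term) (simp_all add: qpoch_0_right)

lemma ord4_const4_summable4_q_binomial_term:
  assumes "norm z < 1" "ord4 1 a"
  shows "summable4 (q_binomial_term a (const4 z))"
proof (rule const4_summable4_q_binomial_term[OF assms(1)])
  fix i j k l
  have "(\<lambda>m. qpoch (const4 q) a m $ i $ j $ k $ l) \<longlonglongrightarrow> qpoch_inf q a $ i $ j $ k $ l"
    using admissible_qpoch_inf(1)[OF ord4_admissible[OF assms(2)]] by (simp add: tendsto4_def)
  then show "Bseq (\<lambda>m. qpoch (const4 q) a m $ i $ j $ k $ l)"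
    by (intro convergent_imp_Bseq) (auto simp: convergent_def)
qed

end

section \<open>Heine's transformation\<close>

lemma ord4_sums_nth:
  assumes "\<And>r. ord4 r (f r)" "ps4_sums f F"
  shows "F $ a $ b $ c $ d = (\<Sum>r\<le>a + b + c + d. f r $ a $ b $ c $ d)"
  using ord4_sums_mult_nth[OF assms, of 1] by simp

lemma ps4_mult_nth_0_neq:
  "F $ 0 $ 0 $ 0 $ 0 \<noteq> 0 \<Longrightarrow> G $ 0 $ 0 $ 0 $ 0 \<noteq> 0 \<Longrightarrow> (F * G :: ps4) $ 0 $ 0 $ 0 $ 0 \<noteq> 0"
  by simp

text \<open>For X = x_j/x_i and U = s_j/s_i this is the contribution of one pair to a term of
  \<open>macd.S\<close>, with r the exponent of X; Heine's transformation produces it from the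
  symmetric \<open>phi21\<close>.\<close>

definition heine_term :: "complex \<Rightarrow> complex \<Rightarrow> nat \<Rightarrow> ps4 \<Rightarrow> ps4 \<Rightarrow> nat \<Rightarrow> ps4" where
  "heine_term q t k X U r = qpoch (const4 q) (const4 t * U) r *
     const4 (qpoch q t (k + r) * (q / t) ^ r / qpoch q q r) *
     inverse (qpoch (const4 q) (const4 q * U) (k + r)) * X ^ r"

lemma ord4_heine_term: "ord4 1 X \<Longrightarrow> ord4 r (heine_term q t k X U r)"
  unfolding heine_term_def by (intro ord4_mult_left ord4_power)

text \<open>Two uses of the q-binomial theorem around an interchange of sums. The first expands the
  quotient of (A;q)_m and (C;q)_m in powers of A, with parameter C/A = t U, so that nothing is
  divided by X. The second sums over m at the argument q^(k + r) t.\<close>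

lemma heine:
  fixes q t :: complex and X U :: ps4
  assumes q: "norm q < 1" and t: "t \<noteq> 0" "norm t < 1" and X: "ord4 1 X" and U: "ord4 1 U"
  shows "qpoch_inf q (const4 t) * qpoch_inf q (const4 q * X * U) *
      inverse (qpoch_inf q (const4 (q / t) * X) * qpoch_inf q (const4 (q / t) * U)) *
      phi21 q (const4 (q / t) * X) (const4 (q / t) * U) (const4 q * X * U) (const4 (q ^ k * t)) =
    qpoch_inf q (const4 q * U) * inverse (qpoch_inf q (const4 (q / t) * U)) *
      ps4_suminf (heine_term q t k X U)"
proof -
  define A where "A = const4 (q / t) * X"
  define B where "B = const4 (q / t) * U"
  define C where "C = const4 q * X * U"
  define E where "E = qpoch_inf q"
  define z where "z = q ^ k * t"
  note q_binomial_term_def = q_binomial_term_def[OF q]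
  have qt: "const4 (q / t) * const4 t = const4 q"
    using t by (simp flip: const4_hom)
  have ordA: "ord4 1 A" and ordB: "ord4 1 B" and ordC: "ord4 1 C" and ordqU: "ord4 1 (const4 q * U)"
    unfolding A_def B_def C_def using X U by (auto intro: ord4_mult_left)
  have z: "norm (q ^ r * z) < 1" for r
  proof -
    have "norm (q ^ r * z) = norm q ^ (r + k) * norm t"
      by (simp add: z_def norm_mult norm_power power_add)
    also have "\<dots> \<le> 1 * norm t"
      using q by (intro mult_right_mono power_le_one) auto
    finally show ?thesis using t by simp
  qed
  have E0: "E Z $ 0 $ 0 $ 0 $ 0 \<noteq> 0" if "admissible q Z" for Z
    unfolding E_def using admissible_qpoch_inf(2)[OF q that] .
  have admA: "admissible q A" and admB: "admissible q B" and admC: "admissible q C" and admqU: "admissible q (const4 q * U)"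
    using ordA ordB ordC ordqU ord4_admissible[OF q] by auto
  define trm where "trm m = qpoch (const4 q) A m * qpoch (const4 q) B m *
       inverse (qpoch (const4 q) (const4 q) m * qpoch (const4 q) C m) * const4 z ^ m" for m
  \<comment> \<open>Multiplied by \<open>W\<close>, the quotient of (A;q)_m by (C;q)_m becomes that
    of the infinite products at q^m C and q^m A, the form required by
    \<open>q_binomial\<close>.\<close>
  define W where "W = E C * inverse (E A)"
  have W0: "W $ 0 $ 0 $ 0 $ 0 \<noteq> 0"
    unfolding W_def using E0 admA admC by (intro ps4_mult_nth_0_neq ps4_inverse_nth_0) auto
  define g where "g = q_binomial_term q (const4 t * U) A"
  define Y where "Y m = qpoch (const4 q) B m * const4 (z ^ m / qpoch q q m)" for m
  define H where "H m = ps4_suminf (q_binomial_term q (const4 t * U) (const4 q ^ m * A))" for m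
  have ordqA: "ord4 1 (const4 q ^ m * A)" for m
    using ordA by (rule ord4_mult_left)
  have H_sums: "ps4_sums (q_binomial_term q (const4 t * U) (const4 q ^ m * A)) (H m)" for m
    unfolding H_def by (intro summable4_imp_sums ord4_summable4_q_binomial_term q ordqA)
  have step1: "W * (qpoch (const4 q) A m * inverse (qpoch (const4 q) C m)) = H m" for m
  proof -
    define Em where "Em = E (const4 q ^ m * A)"
    have Em0: "Em $ 0 $ 0 $ 0 $ 0 \<noteq> 0"
      unfolding Em_def by (intro E0 ord4_admissible[OF q] ordqA)
    have A1: "qpoch (const4 q) A m $ 0 $ 0 $ 0 $ 0 \<noteq> 0" and C1: "qpoch (const4 q) C m $ 0 $ 0 $ 0 $ 0 \<noteq> 0"
      using qpoch_nth_0[OF ordA] qpoch_nth_0[OF ordC] by simp_all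
    have "Em * H m = E (const4 t * U * (const4 q ^ m * A))"
      unfolding Em_def H_def E_def using ordqA[of m]
      by (intro q_binomial[OF q] ord4_admissible[OF q] ord4_summable4_q_binomial_term[OF q] ord4_mult_left ordA)
    also have "const4 t * U * (const4 q ^ m * A) = const4 q ^ m * C"
      unfolding A_def C_def qt[symmetric] by (simp only: mult_ac)
    finally have "E C = qpoch (const4 q) C m * (Em * H m)"
      unfolding E_def using qpoch_inf_shift[OF q admC, of m] by simp
    moreover have "inverse (E A) = inverse (qpoch (const4 q) A m) * inverse Em"
    proof -
      have "E A = qpoch (const4 q) A m * Em"
        unfolding E_def Em_def by (rule qpoch_inf_shift[OF q admA])
      then show ?thesis by (simp add: ps4_inverse_mult A1 Em0)
    qed
    ultimately have "W * (qpoch (const4 q) A m * inverse (qpoch (const4 q) C m)) =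
        (qpoch (const4 q) C m * inverse (qpoch (const4 q) C m)) * (Em * inverse Em) *
        (qpoch (const4 q) A m * inverse (qpoch (const4 q) A m)) * H m"
      unfolding W_def by (simp only: mult_ac)
    then show ?thesis using Em0 A1 C1 by (simp add: ps4_mult_inverse)
  qed
  have step2: "W * trm m = H m * Y m" for m
  proof -
    have C1: "qpoch (const4 q) C m $ 0 $ 0 $ 0 $ 0 \<noteq> 0"
      using qpoch_nth_0[OF ordC] by simp
    have q1: "const4 (qpoch q q m) $ 0 $ 0 $ 0 $ 0 \<noteq> 0"
      using qq_neq_0[OF q] by (simp add: const4_def)
    have inv: "inverse (qpoch (const4 q) (const4 q) m * qpoch (const4 q) C m) =
        const4 (inverse (qpoch q q m)) * inverse (qpoch (const4 q) C m)"
      unfolding qpoch_const4 ps4_inverse_mult[OF q1 C1] const4_inverse[OF qq_neq_0[OF q]] ..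
    have "const4 (z ^ m / qpoch q q m) = const4 (inverse (qpoch q q m)) * const4 z ^ m"
      by (simp add: divide_inverse mult_ac)
    then have "H m * Y m = H m * (qpoch (const4 q) B m * (const4 (inverse (qpoch q q m)) * const4 z ^ m))"
      by (simp add: Y_def)
    then show ?thesis
      unfolding step1[symmetric] trm_def inv by (simp only: mult_ac)
  qed
  define \<Lambda> where "\<Lambda> r = ps4_suminf (q_binomial_term q B (const4 (q ^ r * z)))" for r
  have \<Lambda>_abs: "summable4 (q_binomial_term q B (const4 (q ^ r * z)))" for r
    using z ordB by (intro ord4_const4_summable4_q_binomial_term[OF q])
  then have \<Lambda>_sums: "ps4_sums (q_binomial_term q B (const4 (q ^ r * z))) (\<Lambda> r)" for r
    unfolding \<Lambda>_def by (intro summable4_imp_sums)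
  have g_ord: "ord4 r (g r)" for r
    unfolding g_def by (intro ord4_q_binomial_term q ordA)
  define \<Psi> where "\<Psi> = ps4_suminf (\<lambda>r. g r * \<Lambda> r)"
  have \<Psi>_sums: "ps4_sums (\<lambda>r. g r * \<Lambda> r) \<Psi>"
    unfolding \<Psi>_def by (intro summable4_imp_sums ord4_imp_summable4 ord4_mult_right g_ord)
  have exchange: "q_binomial_term q (const4 t * U) (const4 q ^ m * A) r * Y m = g r * q_binomial_term q B (const4 (q ^ r * z)) m" for m r
    unfolding g_def q_binomial_term_def Y_def
    by (simp add: divide_inverse power_mult_distrib mult_ac flip: power_mult)
  have step3: "ps4_sums (\<lambda>m. H m * Y m) \<Psi>"
    unfolding ps4_sums_def
  proof (intro allI)
    fix a b c d
    have "(H m * Y m) $ a $ b $ c $ d = (\<Sum>r\<le>a + b + c + d. (g r * q_binomial_term q B (const4 (q ^ r * z)) m) $ a $ b $ c $ d)" for m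
      unfolding exchange[symmetric]
      by (rule ord4_sums_mult_nth[OF _ H_sums]) (intro ord4_q_binomial_term q ordqA)
    moreover have "(\<lambda>m. \<Sum>r\<le>a + b + c + d. (g r * q_binomial_term q B (const4 (q ^ r * z)) m) $ a $ b $ c $ d) sums
        (\<Sum>r\<le>a + b + c + d. (g r * \<Lambda> r) $ a $ b $ c $ d)"
      using ps4_sums_mult[OF \<Lambda>_sums] unfolding ps4_sums_def by (intro sums_sum) blast
    moreover have "\<Psi> $ a $ b $ c $ d = (\<Sum>r\<le>a + b + c + d. (g r * \<Lambda> r) $ a $ b $ c $ d)"
      by (intro ord4_sums_nth[OF _ \<Psi>_sums] ord4_mult_right g_ord)
    ultimately show "(\<lambda>m. (H m * Y m) $ a $ b $ c $ d) sums (\<Psi> $ a $ b $ c $ d)"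
      by simp
  qed
  \<comment> \<open>The inner sum is a quotient of infinite products at q^(k + r) q U and q^(k + r)
    t; shifting both back to q U and t leaves the finite factorials of length k + r.\<close>
  have step4: "E (const4 t) * \<Lambda> r = const4 (qpoch q t (k + r)) * E (const4 q * U) *
      inverse (qpoch (const4 q) (const4 q * U) (k + r))" for r
  proof -
    have "E (const4 (q ^ r * z)) * \<Lambda> r = E (B * const4 (q ^ r * z))"
      unfolding E_def \<Lambda>_def
      by (intro q_binomial[OF q] const4_admissible[OF q] z ord4_admissible[OF q] \<Lambda>_abs ord4_mult_right ordB)
    also have "B * const4 (q ^ r * z) = const4 q ^ (k + r) * (const4 q * U)"
    proof -
      have "B * const4 (q ^ r * z) = (const4 (q / t) * const4 t) * U * const4 q ^ (k + r)"
        by (simp add: B_def z_def power_add mult_ac)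
      then show ?thesis unfolding qt by (simp only: mult_ac)
    qed
    finally have 1: "E (const4 (q ^ r * z)) * \<Lambda> r = E (const4 q ^ (k + r) * (const4 q * U))" .
    have "E (const4 t) = qpoch (const4 q) (const4 t) (k + r) * E (const4 q ^ (k + r) * const4 t)"
      unfolding E_def by (intro qpoch_inf_shift[OF q] const4_admissible[OF q] t)
    also have "const4 q ^ (k + r) * const4 t = const4 (q ^ r * z)"
      by (simp add: z_def power_add mult_ac)
    finally have 2: "E (const4 t) * \<Lambda> r = const4 (qpoch q t (k + r)) * E (const4 q ^ (k + r) * (const4 q * U))"
      unfolding qpoch_const4 1[symmetric] by (simp only: mult_ac)
    have u0: "qpoch (const4 q) (const4 q * U) (k + r) $ 0 $ 0 $ 0 $ 0 \<noteq> 0"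
      using qpoch_nth_0[OF ordqU] by simp
    have "E (const4 q * U) * inverse (qpoch (const4 q) (const4 q * U) (k + r)) =
        (qpoch (const4 q) (const4 q * U) (k + r) * inverse (qpoch (const4 q) (const4 q * U) (k + r))) *
        E (const4 q ^ (k + r) * (const4 q * U))"
      unfolding E_def qpoch_inf_shift[OF q admqU, of "k + r"] by (simp only: mult_ac)
    then show ?thesis
      unfolding 2 using ps4_mult_inverse[OF u0] by (simp add: mult.assoc)
  qed
  have step5: "E (const4 t) * \<Psi> = E (const4 q * U) * ps4_suminf (heine_term q t k X U)"
  proof -
    have "ps4_sums (\<lambda>r. E (const4 t) * (g r * \<Lambda> r)) (E (const4 t) * \<Psi>)"
      by (intro ps4_sums_mult \<Psi>_sums)
    moreover have "E (const4 t) * (g r * \<Lambda> r) = E (const4 q * U) * heine_term q t k X U r" for r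
    proof -
      have "E (const4 t) * (g r * \<Lambda> r) = g r * (E (const4 t) * \<Lambda> r)"
        by (simp only: mult_ac)
      also have "\<dots> = E (const4 q * U) * heine_term q t k X U r"
        unfolding step4 g_def q_binomial_term_def heine_term_def A_def
        by (simp add: divide_inverse power_mult_distrib mult_ac)
      finally show ?thesis .
    qed
    moreover have "ps4_sums (\<lambda>r. E (const4 q * U) * heine_term q t k X U r) (E (const4 q * U) * ps4_suminf (heine_term q t k X U))"
      by (intro ps4_sums_mult summable4_imp_sums ord4_imp_summable4 ord4_heine_term X)
    ultimately show ?thesis using ps4_sums_unique by simp
  qed
  have phi: "W * phi21 q A B C (const4 z) = \<Psi>"
  proof -
    have "ps4_sums (\<lambda>m. inverse W * (W * trm m)) (inverse W * \<Psi>)"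
      unfolding step2 by (intro ps4_sums_mult step3)
    moreover have inv: "inverse W * (W * F) = F" for F
      using ps4_mult_inverse[OF W0] by (metis mult.assoc mult.commute mult_1)
    ultimately have "ps4_sums trm (inverse W * \<Psi>)" by simp
    then have "phi21 q A B C (const4 z) = inverse W * \<Psi>"
      unfolding phi21_def trm_def[abs_def] by (rule ps4_suminf_eq)
    then show ?thesis using inv[of \<Psi>] by (simp only: mult.left_commute)
  qed
  have "E (const4 t) * E C * inverse (E A * E B) * phi21 q A B C (const4 z) =
      inverse (E B) * (E (const4 t) * (W * phi21 q A B C (const4 z)))"
    unfolding W_def ps4_inverse_mult[OF E0[OF admA] E0[OF admB]] by (simp only: mult_ac)
  also have "\<dots> = E (const4 q * U) * inverse (E B) * ps4_suminf (heine_term q t k X U)"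
    unfolding phi step5 by (simp only: mult_ac)
  finally show ?thesis unfolding E_def A_def B_def C_def z_def .
qed

section \<open>Expansion at the origin\<close>

lemma expand_poly_nth: "expand_poly p $ a $ b = coeff (coeff p a) b"
  by (simp add: expand_poly_def coeff_map_poly)

lemma expand_poly_mult: "expand_poly (p * r) = expand_poly p * expand_poly r"
proof (intro fps_ext)
  fix a b
  show "expand_poly (p * r) $ a $ b = (expand_poly p * expand_poly r) $ a $ b"
    by (simp add: expand_poly_nth fps_mult_nth fps_sum_nth coeff_mult coeff_sum atLeast0AtMost)
qed

lemma expand_poly_add: "expand_poly (p + r) = expand_poly p + expand_poly r"
  by (intro fps_ext) (simp add: expand_poly_nth)

lemma expand_poly_nth_0: "expand_poly p $ 0 $ 0 = poly (poly p 0) 0"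
  by (simp add: expand_poly_nth poly_0_coeff_0)

lemma fps2_mult_inverse:
  fixes F :: "complex fps fps"
  assumes "F $ 0 $ 0 \<noteq> 0"
  shows "F * inverse F = 1"
proof -
  have "F $ 0 * inverse (F $ 0) = 1"
    using assms by (simp add: inverse_mult_eq_1')
  then show ?thesis
    using fps_right_inverse[of F] by (simp add: fps_inverse_def)
qed

text \<open>\<open>expands f F\<close>: the rational function \<open>f\<close> is regular at the origin, where its expansion is \<open>F\<close>.\<close>

definition expands :: "ratfun \<Rightarrow> complex fps fps \<Rightarrow> bool" where
  "expands f F \<longleftrightarrow> (\<exists>n d. poly (poly d 0) 0 \<noteq> 0 \<and> f * to_fract d = to_fract n \<and> F * expand_poly d = expand_poly n)"

text \<open>The given fraction is the reduced one extended by a cofactor \<open>e\<close>. Since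
  \<open>e\<close> divides \<open>d\<close>, it is nonzero at the origin, so its expansion is
  invertible and cancels.\<close>

lemma expands_imp_expand_eq:
  assumes "expands f F"
  shows "expand f = F"
proof -
  obtain n d where d: "poly (poly d 0) 0 \<noteq> 0" and f: "f * to_fract d = to_fract n"
    and F: "F * expand_poly d = expand_poly n"
    using assms by (auto simp: expands_def)
  define n' where "n' = ratfun_num f"
  define d' where "d' = ratfun_denom f"
  obtain e where e: "d = d' * e"
    using ratfun_denom_dvd[OF f] unfolding d'_def by (rule dvdE)
  have "f = to_fract n' / to_fract d'"
    unfolding n'_def d'_def ratfun_num_def ratfun_denom_def Fract_conv_to_fract[symmetric] by simp
  moreover have "d' \<noteq> 0"
    by (simp add: d'_def ratfun_denom_def)
  ultimately have f': "f * to_fract d' = to_fract n'" by simp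
  have "to_fract n' * to_fract e = to_fract n"
    unfolding f[symmetric] f'[symmetric] e by (simp add: mult.assoc)
  then have n: "n = n' * e" by (simp flip: to_fract_mult)
  have d0: "expand_poly d' $ 0 $ 0 \<noteq> 0" and e0: "expand_poly e $ 0 $ 0 \<noteq> 0"
    using d by (simp_all add: e expand_poly_nth_0)
  have "F * expand_poly d' = F * expand_poly d' * (expand_poly e * inverse (expand_poly e))"
    using fps2_mult_inverse[OF e0] by simp
  also have "\<dots> = (F * expand_poly d) * inverse (expand_poly e)"
    by (simp add: e expand_poly_mult mult.assoc)
  also have "\<dots> = expand_poly n' * (expand_poly e * inverse (expand_poly e))"
    by (simp add: F n expand_poly_mult mult.assoc)
  also have "\<dots> = expand_poly n'"
    using fps2_mult_inverse[OF e0] by simp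
  finally have Fd: "F * expand_poly d' = expand_poly n'" .
  have "expand f = F * (expand_poly d' * inverse (expand_poly d'))"
    unfolding expand_def n'_def[symmetric] d'_def[symmetric] Fd[symmetric] by (simp only: mult.assoc)
  then show ?thesis
    using fps2_mult_inverse[OF d0] by simp
qed

lemma expands_poly: "expands (to_fract p) (expand_poly p)"
proof -
  have "expand_poly 1 = 1"
    by (intro fps_ext) (auto simp: expand_poly_nth)
  then show ?thesis
    unfolding expands_def by (intro exI[of _ p] exI[of _ 1]) simp
qed

lemma expands_mult:
  assumes "expands f F" "expands g G"
  shows "expands (f * g) (F * G)"
proof -
  obtain n d where 1: "poly (poly d 0) 0 \<noteq> 0" "f * to_fract d = to_fract n" "F * expand_poly d = expand_poly n"
    using assms(1) by (auto simp: expands_def)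
  obtain n' d' where 2: "poly (poly d' 0) 0 \<noteq> 0" "g * to_fract d' = to_fract n'" "G * expand_poly d' = expand_poly n'"
    using assms(2) by (auto simp: expands_def)
  have "f * g * to_fract (d * d') = to_fract (n * n')"
    unfolding to_fract_mult 1(2)[symmetric] 2(2)[symmetric] by (simp only: mult_ac)
  moreover have "F * G * expand_poly (d * d') = expand_poly (n * n')"
    unfolding expand_poly_mult 1(3)[symmetric] 2(3)[symmetric] by (simp only: mult_ac)
  moreover have "poly (poly (d * d') 0) 0 \<noteq> 0" using 1 2 by simp
  ultimately show ?thesis unfolding expands_def by blast
qed

lemma expands_add:
  assumes "expands f F" "expands g G"
  shows "expands (f + g) (F + G)"
proof -
  obtain n d where 1: "poly (poly d 0) 0 \<noteq> 0" "f * to_fract d = to_fract n" "F * expand_poly d = expand_poly n"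
    using assms(1) by (auto simp: expands_def)
  obtain n' d' where 2: "poly (poly d' 0) 0 \<noteq> 0" "g * to_fract d' = to_fract n'" "G * expand_poly d' = expand_poly n'"
    using assms(2) by (auto simp: expands_def)
  have "(f + g) * to_fract (d * d') = to_fract (n * d' + n' * d)"
    unfolding to_fract_mult to_fract_add 1(2)[symmetric] 2(2)[symmetric] distrib_right by (simp only: mult_ac)
  moreover have "(F + G) * expand_poly (d * d') = expand_poly (n * d' + n' * d)"
    unfolding expand_poly_mult expand_poly_add 1(3)[symmetric] 2(3)[symmetric] distrib_right by (simp only: mult_ac)
  moreover have "poly (poly (d * d') 0) 0 \<noteq> 0" using 1 2 by simp
  ultimately show ?thesis unfolding expands_def by blast
qed

lemma expands_inverse:
  assumes "expands f F" "F $ 0 $ 0 \<noteq> 0"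
  shows "expands (inverse f) (inverse F)"
proof -
  obtain n d where 1: "poly (poly d 0) 0 \<noteq> 0" "f * to_fract d = to_fract n" "F * expand_poly d = expand_poly n"
    using assms(1) by (auto simp: expands_def)
  have "(F * expand_poly d) $ 0 $ 0 \<noteq> 0"
    using assms(2) 1(1) by (simp add: expand_poly_nth_0)
  then have n: "poly (poly n 0) 0 \<noteq> 0"
    unfolding 1(3) expand_poly_nth_0 .
  then have "n \<noteq> 0" by auto
  then have "f \<noteq> 0" using 1(2) by auto
  then have "inverse f * to_fract n = to_fract d"
    unfolding 1(2)[symmetric] by (simp add: mult.assoc[symmetric])
  moreover have "inverse F * expand_poly n = expand_poly d"
    unfolding 1(3)[symmetric] mult.assoc[symmetric] mult.commute[of "inverse F"] fps2_mult_inverse[OF assms(2)] by simp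
  ultimately show ?thesis using n unfolding expands_def by blast
qed

definition const2 :: "complex \<Rightarrow> complex fps fps" where
  "const2 c = fps_const (fps_const c)"

lemma expands_const: "expands (ratfun_const c) (const2 c)"
proof -
  have "const2 c = expand_poly [:[:c:]:]"
    by (intro fps_ext) (auto simp: expand_poly_nth const2_def coeff_pCons split: nat.splits)
  then show ?thesis unfolding ratfun_const_def by (simp add: expands_poly)
qed

lemma expands_u: "expands u_rat fps_X"
proof -
  have "fps_X = expand_poly [:0, 1:]"
    by (intro fps_ext) (auto simp: expand_poly_nth fps_X_nth coeff_pCons split: nat.splits)
  then show ?thesis by (metis expands_poly)
qed

lemma expands_v: "expands v_rat (fps_const fps_X)"
proof -
  have "fps_const fps_X = expand_poly [:[:0, 1:]:]"
    by (intro fps_ext) (auto simp: expand_poly_nth fps_X_nth coeff_pCons split: nat.splits)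
  then show ?thesis by (simp add: expands_poly)
qed

lemma expands_power: "expands f F \<Longrightarrow> expands (f ^ n) (F ^ n)"
proof (induction n)
  case 0
  have "const2 1 = 1" by (simp add: const2_def)
  then show ?case using expands_const[of 1] by simp
qed (simp add: expands_mult)

lemma expands_diff:
  assumes "expands f F" "expands g G"
  shows "expands (f - g) (F - G)"
proof -
  have "const2 (-1) = -1" by (simp add: const2_def fps_const_neg[symmetric] del: fps_const_neg)
  then have "expands (ratfun_const (-1) * g) (- 1 * G)"
    using expands_mult[OF expands_const[of "-1"] assms(2)] by simp
  then show ?thesis using expands_add[OF assms(1)] by fastforce
qed

lemma expands_qpoch:
  assumes "expands f F"
  shows "expands (qpoch (ratfun_const q) f n) (qpoch (const2 q) F n)"
proof (induction n)
  case 0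
  then show ?case using expands_power[OF assms, of 0] by simp
next
  case (Suc n)
  have "expands (1 - ratfun_const q ^ n * f) (1 - const2 q ^ n * F)"
    using expands_power[OF assms, of 0]
    by (intro expands_diff expands_mult expands_power expands_const assms) simp
  with Suc show ?case by (simp add: qpoch_Suc expands_mult)
qed

lemma expands_sum: "(\<And>i. i \<in> I \<Longrightarrow> expands (f i) (F i)) \<Longrightarrow> expands (sum f I) (sum F I)"
proof (induction I rule: infinite_finite_induct)
  case empty
  have "const2 0 = 0" by (simp add: const2_def)
  then show ?case using expands_const[of 0] by simp
next
  case (infinite A)
  have "const2 0 = 0" by (simp add: const2_def)
  then show ?case using expands_const[of 0] infinite by simp
qed (simp add: expands_add)

lemma qpoch_fps2_nth_0: "F $ 0 $ 0 = 0 \<Longrightarrow> qpoch (const2 q) F n $ 0 $ 0 = 1"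
  by (induction n) (simp_all add: qpoch_Suc)

lemma expand_p3_coeff:
  fixes q t :: complex
  assumes "q \<noteq> 0" "norm q < 1" "t \<noteq> 0" "norm t < 1"
  defines "U \<equiv> fps_X" and "V \<equiv> fps_const fps_X"
  shows "expand (p3_coeff q t A B) = (\<Sum>j\<le>min A B. \<Sum>k\<le>j. const2 (p3_term_const q t A B j k) *
     ((U * V) ^ k * qpoch (const2 q) (const2 t * U) (A - j) * qpoch (const2 q) (const2 t * (U * V)) (j - k) *
      qpoch (const2 q) (const2 t * V) (B - j)) *
     inverse (qpoch (const2 q) (const2 q * U) (A - j + k) * qpoch (const2 q) (const2 q * (U * V)) j *
      qpoch (const2 q) (const2 q * V) (B - j + k)))"
proof (rule expands_imp_expand_eq)
  have U: "expands u_rat U" and V: "expands v_rat V"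
    unfolding U_def V_def by (rule expands_u expands_v)+
  have 0: "qpoch (const2 q) (const2 q * U) a $ 0 $ 0 = 1" "qpoch (const2 q) (const2 q * (U * V)) a $ 0 $ 0 = 1"
    "qpoch (const2 q) (const2 q * V) a $ 0 $ 0 = 1" for a
    by (rule qpoch_fps2_nth_0, simp add: U_def V_def)+
  show "expands (p3_coeff q t A B) (\<Sum>j\<le>min A B. \<Sum>k\<le>j. const2 (p3_term_const q t A B j k) *
     ((U * V) ^ k * qpoch (const2 q) (const2 t * U) (A - j) * qpoch (const2 q) (const2 t * (U * V)) (j - k) *
      qpoch (const2 q) (const2 t * V) (B - j)) *
     inverse (qpoch (const2 q) (const2 q * U) (A - j + k) * qpoch (const2 q) (const2 q * (U * V)) j *
      qpoch (const2 q) (const2 q * V) (B - j + k)))"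
    unfolding p3_coeff_explicit[OF assms(1-4)]
    by (intro expands_sum expands_mult expands_inverse expands_power expands_qpoch expands_const U V)
      (simp add: 0)
qed

section \<open>The series $p_3$ and $\varphi_3$\<close>

definition s_embed :: "complex fps fps \<Rightarrow> ps4" where
  "s_embed w = fps_const (fps_const w)"

lemma s_embed_hom: "s_embed (v * w) = s_embed v * s_embed w" "s_embed (v - w) = s_embed v - s_embed w" "s_embed 1 = 1"
  by (simp_all add: s_embed_def)

lemma s_embed_power: "s_embed (w ^ n) = s_embed w ^ n"
  by (induction n) (simp_all add: s_embed_hom)

lemma const4_eq_s_embed: "const4 c = s_embed (const2 c)"
  by (simp add: const4_def s_embed_def const2_def)

lemma const2_mult: "const2 (x * y) = const2 x * const2 y"
  by (simp add: const2_def)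

lemma s_embed_inverse: "F $ 0 $ 0 \<noteq> 0 \<Longrightarrow> inverse (s_embed F) = s_embed (inverse F)"
  by (intro ps4_inverse_unique) (simp add: fps2_mult_inverse s_embed_hom(3) flip: s_embed_hom(1))

lemma fps2_inverse_mult:
  fixes F G :: "complex fps fps"
  assumes "F $ 0 $ 0 \<noteq> 0" "G $ 0 $ 0 \<noteq> 0"
  shows "inverse (F * G) = inverse F * inverse G"
proof -
  have "(F * G) $ 0 $ 0 \<noteq> 0" using assms by simp
  then have "F * G * inverse (F * G) = 1" by (rule fps2_mult_inverse)
  have "inverse (F * G) = (F * inverse F) * (G * inverse G) * inverse (F * G)"
    using assms by (simp add: fps2_mult_inverse)
  also have "\<dots> = inverse F * inverse G * (F * G * inverse (F * G))"
    by (simp only: mult_ac)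
  finally show ?thesis using \<open>F * G * inverse (F * G) = 1\<close> by simp
qed

definition heine_coeff :: "complex \<Rightarrow> complex \<Rightarrow> nat \<Rightarrow> complex fps fps \<Rightarrow> nat \<Rightarrow> complex fps fps" where
  "heine_coeff q t k U r = qpoch (const2 q) (const2 t * U) r * const2 (qpoch q t (k + r) * (q / t) ^ r / qpoch q q r) *
     inverse (qpoch (const2 q) (const2 q * U) (k + r))"

lemma heine_term_s_embed:
  assumes "U $ 0 $ 0 = 0"
  shows "heine_term q t k X (s_embed U) r = s_embed (heine_coeff q t k U r) * X ^ r"
proof -
  have qpoch: "qpoch (s_embed a) (s_embed b) n = s_embed (qpoch a b n)" for a b n
    by (rule qpoch_hom[symmetric]) (simp_all add: s_embed_hom)
  have "qpoch (const2 q) (const2 q * U) (k + r) $ 0 $ 0 = 1"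
    using assms by (intro qpoch_fps2_nth_0) simp
  then show ?thesis
    unfolding heine_term_def heine_coeff_def const4_eq_s_embed s_embed_hom(1)[symmetric] qpoch
    by (simp add: s_embed_inverse s_embed_hom)
qed

lemma heine_term_s_embed_fun:
  "U $ 0 $ 0 = 0 \<Longrightarrow> heine_term q t k X (s_embed U) = (\<lambda>r. s_embed (heine_coeff q t k U r) * X ^ r)"
  by (rule ext) (rule heine_term_s_embed)

lemma s_embed_mult_nth: "(s_embed w * F) $ a $ b = w * F $ a $ b"
  by (simp add: s_embed_def)

lemma s_embed_nth: "s_embed w $ a = (if a = 0 then fps_const w else 0)"
  by (simp add: s_embed_def)

text \<open>This and the next two lemmas write the series for the pairs (1,2), (2,3), (1,3) as
  coefficient arrays in x_2/x_1 and x_3/x_2: they live on one axis, on the other, and on the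
  diagonal.\<close>

lemma suminf_x: "ps4_suminf (\<lambda>r. s_embed (f r) * fps_X ^ r) = Abs_fps (\<lambda>a. fps_const (f a))"
proof (rule ps4_suminf_eq, unfold ps4_sums_def, intro allI)
  fix a b c d :: nat
  have 1: "(s_embed (f r) * fps_X ^ r) $ a $ b $ c $ d = (if r = a then (if b = 0 then f r $ c $ d else 0) else 0)" for r
    by (auto simp: s_embed_mult_nth fps_X_power_nth)
  have 2: "Abs_fps (\<lambda>a. fps_const (f a)) $ a $ b $ c $ d = (if b = 0 then f a $ c $ d else 0)"
    by simp
  show "(\<lambda>r. (s_embed (f r) * fps_X ^ r) $ a $ b $ c $ d) sums (Abs_fps (\<lambda>a. fps_const (f a)) $ a $ b $ c $ d)"
    unfolding 1 2 by (rule sums_single)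
qed

lemma suminf_y: "ps4_suminf (\<lambda>r. s_embed (f r) * (fps_const fps_X) ^ r) = fps_const (Abs_fps f)"
proof (rule ps4_suminf_eq, unfold ps4_sums_def, intro allI)
  fix a b c d :: nat
  have 1: "(s_embed (f r) * (fps_const fps_X) ^ r) $ a $ b $ c $ d = (if r = b then (if a = 0 then f r $ c $ d else 0) else 0)" for r
    by (auto simp: s_embed_nth fps_X_power_nth)
  have 2: "fps_const (Abs_fps f) $ a $ b $ c $ d = (if a = 0 then f b $ c $ d else 0)"
    by simp
  show "(\<lambda>r. (s_embed (f r) * (fps_const fps_X) ^ r) $ a $ b $ c $ d) sums (fps_const (Abs_fps f) $ a $ b $ c $ d)"
    unfolding 1 2 by (rule sums_single)
qed

lemma suminf_xy: "ps4_suminf (\<lambda>r. s_embed (f r) * (fps_X * fps_const fps_X) ^ r) =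
    Abs_fps (\<lambda>a. Abs_fps (\<lambda>b. if a = b then f a else 0))"
proof (rule ps4_suminf_eq, unfold ps4_sums_def, intro allI)
  fix a b c d :: nat
  have 1: "(s_embed (f r) * (fps_X * fps_const fps_X) ^ r) $ a $ b $ c $ d = (if r = a then (if a = b then f r $ c $ d else 0) else 0)" for r
    by (auto simp: s_embed_mult_nth fps_X_power_nth power_mult_distrib fps_X_power_mult_nth)
  have 2: "Abs_fps (\<lambda>a. Abs_fps (\<lambda>b. if a = b then f a else 0)) $ a $ b $ c $ d = (if a = b then f a $ c $ d else 0)"
    by simp
  show "(\<lambda>r. (s_embed (f r) * (fps_X * fps_const fps_X) ^ r) $ a $ b $ c $ d) sums
      (Abs_fps (\<lambda>a. Abs_fps (\<lambda>b. if a = b then f a else 0)) $ a $ b $ c $ d)"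
    unfolding 1 2 by (rule sums_single)
qed

lemma ratio_simps:
  "x_ratio 1 2 = fps_X" "x_ratio 2 3 = fps_const fps_X" "x_ratio 1 3 = fps_X * fps_const fps_X"
  "s_ratio 1 2 = s_embed fps_X" "s_ratio 2 3 = s_embed (fps_const fps_X)" "s_ratio 1 3 = s_embed (fps_X * fps_const fps_X)"
proof -
  have "{1..<2::nat} = {1}" "{1..<3::nat} = {1, 2}" "{2..<3::nat} = {2}" by auto
  then show "x_ratio 1 2 = fps_X" "x_ratio 2 3 = fps_const fps_X" "x_ratio 1 3 = fps_X * fps_const fps_X"
    "s_ratio 1 2 = s_embed fps_X" "s_ratio 2 3 = s_embed (fps_const fps_X)" "s_ratio 1 3 = s_embed (fps_X * fps_const fps_X)"
    by (simp_all add: x_ratio_def s_ratio_def s_embed_def)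
qed

lemma ord4_ratio:
  assumes "(i, j) \<in> pairs3"
  shows "ord4 1 (x_ratio i j)" "ord4 1 (s_ratio i j)"
proof -
  have "ord4 1 F" if "F $ 0 $ 0 $ 0 $ 0 = 0" for F
    using that by (simp add: ord4_def)
  then show "ord4 1 (x_ratio i j)" "ord4 1 (s_ratio i j)"
    using assms by (auto simp: pairs3_eq ratio_simps[simplified] s_embed_def)
qed

lemma triple_product_nth:
  fixes f g h :: "nat \<Rightarrow> 'a :: comm_ring_1"
  shows "(Abs_fps (\<lambda>a. fps_const (f a)) * Abs_fps (\<lambda>a. Abs_fps (\<lambda>b. if a = b then g a else 0)) *
      fps_const (Abs_fps h)) $ A $ B = (\<Sum>m\<le>min A B. f (A - m) * g m * h (B - m))"
proof -
  let ?G = "Abs_fps (\<lambda>a. Abs_fps (\<lambda>b. if a = b then g a else 0)) * fps_const (Abs_fps h)"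
  have G: "?G $ m $ B = (if m \<le> B then g m * h (B - m) else 0)" for m
  proof -
    have "?G $ m $ B = (\<Sum>i=0..B. (if m = i then g m else 0) * h (B - i))"
      by (simp add: fps_mult_nth[of "Abs_fps _" "Abs_fps h"])
    also have "\<dots> = (\<Sum>i=0..B. if i = m then g m * h (B - i) else 0)"
      by (intro sum.cong) auto
    finally show ?thesis by simp
  qed
  have "(Abs_fps (\<lambda>a. fps_const (f a)) * ?G) $ A $ B = (\<Sum>i=0..A. f i * ?G $ (A - i) $ B)"
    by (simp add: fps_mult_nth[of "Abs_fps (\<lambda>a. fps_const (f a))"] fps_sum_nth)
  also have "\<dots> = (\<Sum>m\<le>A. f (A - m) * ?G $ m $ B)"
    by (rule sum.reindex_bij_witness[of _ "\<lambda>m. A - m" "\<lambda>i. A - i"]) auto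
  also have "\<dots> = (\<Sum>m\<le>min A B. f (A - m) * ?G $ m $ B)"
  proof (intro sum.mono_neutral_right ballI)
    fix m assume "m \<in> {..A} - {..min A B}"
    then show "f (A - m) * ?G $ m $ B = 0" unfolding G by simp
  qed auto
  also have "\<dots> = (\<Sum>m\<le>min A B. f (A - m) * g m * h (B - m))"
    unfolding G by (intro sum.cong) (simp_all add: mult.assoc)
  finally show ?thesis by (simp only: mult.assoc)
qed

section \<open>Summation over k: p_3 and phi_3 as single series\<close>

context
  fixes q t :: complex
  assumes q: "q \<noteq> 0" "norm q < 1" and t: "t \<noteq> 0" "norm t < 1"
begin

definition outer_const :: "nat \<Rightarrow> complex" where
  "outer_const k = qpoch q (q / t) k * qpoch q (q / t) k / (qpoch q q k * qpoch q t k)"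

text \<open>The k-th summand for p_3 itself; Heine's transformation makes the summand for phi_3 out
  of it together with the prefactor of phi_3.\<close>

definition reduced_term :: "nat \<Rightarrow> ps4" where
  "reduced_term k = const4 (outer_const k) * (const4 q * x_ratio 1 3 * s_ratio 1 3) ^ k *
     (\<Prod>(i,j)\<in>pairs3. ps4_suminf (heine_term q t k (x_ratio i j) (s_ratio i j)))"

lemma reduced_term_nth:
  fixes A B k
  defines "U \<equiv> fps_X" and "V \<equiv> fps_const fps_X"
  defines "g m \<equiv> const2 (outer_const k * q ^ k) * (U * V) ^ k *
    (heine_coeff q t k U (A - k - m) * heine_coeff q t k (U * V) m * heine_coeff q t k V (B - k - m))"
  shows "reduced_term k $ A $ B = (if k \<le> min A B then \<Sum>m\<le>min A B - k. g m else 0)"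
proof -
  define G where "G = Abs_fps (\<lambda>a. fps_const (heine_coeff q t k U a)) *
    Abs_fps (\<lambda>a. Abs_fps (\<lambda>b. if a = b then heine_coeff q t k (U * V) a else 0)) *
      fps_const (Abs_fps (heine_coeff q t k V))"
  have "(\<Prod>(i,j)\<in>pairs3. ps4_suminf (heine_term q t k (x_ratio i j) (s_ratio i j))) = G"
    unfolding G_def U_def V_def
    by (simp add: pairs3_eq ratio_simps[simplified] heine_term_s_embed_fun suminf_x suminf_y[unfolded fps_const_power] suminf_xy mult.assoc)
  moreover have "const4 (outer_const k) * (const4 q * x_ratio 1 3 * s_ratio 1 3) ^ k =
      s_embed (const2 (outer_const k * q ^ k) * (U * V) ^ k) * (fps_X ^ k * fps_const (fps_X ^ k))"
  proof -
    have "const2 (outer_const k * q ^ k) = const2 (outer_const k) * const2 q ^ k"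
      by (simp add: const2_def fps_const_power)
    moreover have "s_embed (fps_const (fps_X ^ k)) = s_embed (fps_const fps_X) ^ k"
      by (simp only: s_embed_power[symmetric] fps_const_power)
    ultimately show ?thesis
      unfolding ratio_simps const4_eq_s_embed
      by (simp add: s_embed_hom s_embed_power U_def V_def power_mult_distrib fps_const_power mult_ac)
  qed
  ultimately have "reduced_term k = s_embed (const2 (outer_const k * q ^ k) * (U * V) ^ k) *
      (fps_X ^ k * (fps_const (fps_X ^ k) * G))"
    by (simp add: reduced_term_def mult.assoc)
  then have "reduced_term k $ A $ B = (if k \<le> min A B then const2 (outer_const k * q ^ k) * (U * V) ^ k * G $ (A - k) $ (B - k) else 0)"
    by (auto simp: s_embed_mult_nth fps_X_power_mult_nth)
  moreover have "min (A - k) (B - k) = min A B - k" by simp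
  ultimately show ?thesis
    unfolding G_def triple_product_nth by (simp add: g_def sum_distrib_left)
qed

lemma reduced_term_sums: "ps4_sums reduced_term (p3 q t)"
  unfolding ps4_sums_def
proof (intro allI)
  fix A B c d :: nat
  define U :: "complex fps fps" where "U = fps_X"
  define V :: "complex fps fps" where "V = fps_const fps_X"
  define g where "g k m = const2 (outer_const k * q ^ k) * (U * V) ^ k *
    (heine_coeff q t k U (A - k - m) * heine_coeff q t k (U * V) m * heine_coeff q t k V (B - k - m))" for k m
  have nth: "reduced_term k $ A $ B = (if k \<le> min A B then \<Sum>m\<le>min A B - k. g k m else 0)" for k
    unfolding g_def U_def V_def by (rule reduced_term_nth)
  have poch0: "qpoch (const2 q) (const2 q * U) n $ 0 $ 0 = 1" "qpoch (const2 q) (const2 q * (U * V)) n $ 0 $ 0 = 1"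
    "qpoch (const2 q) (const2 q * V) n $ 0 $ 0 = 1" for n
    by (rule qpoch_fps2_nth_0, simp add: U_def V_def)+
  have "(\<Sum>k\<le>min A B. reduced_term k $ A $ B) = (\<Sum>k\<le>min A B. \<Sum>m\<le>min A B - k. g k m)"
    by (intro sum.cong) (auto simp: nth)
  \<comment> \<open>The exponent m of the pair (1,3) is j - k in the double sum, so the triangle is
    regrouped by j = k + m.\<close>
  also have "\<dots> = (\<Sum>(k, m)\<in>{(k, m). k + m \<le> min A B}. g k m)"
    by (subst sum.Sigma) (auto intro!: sum.cong)
  also have "\<dots> = (\<Sum>j\<le>min A B. \<Sum>k\<le>j. g k (j - k))"
    by (rule sum.triangle_reindex_eq)
  also have "\<dots> = expand (p3_coeff q t A B)"
    unfolding expand_p3_coeff[OF q t] U_def[symmetric] V_def[symmetric]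
  proof (intro sum.cong refl)
    fix j k assume jk: "j \<in> {..min A B}" "k \<in> {..j}"
    then have idx: "A - k - (j - k) = A - j" "B - k - (j - k) = B - j" "k + (j - k) = j"
      "k + (A - j) = A - j + k" "k + (B - j) = B - j + k" by auto
    have c: "const2 (p3_term_const q t A B j k) = const2 (outer_const k * q ^ k) *
        (const2 (qpoch q t (A - j + k) * (q / t) ^ (A - j) / qpoch q q (A - j)) *
         const2 (qpoch q t j * (q / t) ^ (j - k) / qpoch q q (j - k)) *
         const2 (qpoch q t (B - j + k) * (q / t) ^ (B - j) / qpoch q q (B - j)))"
    proof -
      have "A + B - j - k = (A - j) + (j - k) + (B - j)" using jk by auto
      then show ?thesis
        unfolding const2_mult[symmetric] p3_term_const_def outer_const_def
        by (simp add: power_add divide_inverse mult_ac)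
    qed
    have "inverse (qpoch (const2 q) (const2 q * U) (A - j + k) * qpoch (const2 q) (const2 q * (U * V)) j * qpoch (const2 q) (const2 q * V) (B - j + k)) =
      inverse (qpoch (const2 q) (const2 q * U) (A - j + k)) * inverse (qpoch (const2 q) (const2 q * (U * V)) j) *
      inverse (qpoch (const2 q) (const2 q * V) (B - j + k))"
      by (simp add: fps2_inverse_mult poch0)
    then show "g k (j - k) = const2 (p3_term_const q t A B j k) *
     ((U * V) ^ k * qpoch (const2 q) (const2 t * U) (A - j) * qpoch (const2 q) (const2 t * (U * V)) (j - k) *
      qpoch (const2 q) (const2 t * V) (B - j)) *
     inverse (qpoch (const2 q) (const2 q * U) (A - j + k) * qpoch (const2 q) (const2 q * (U * V)) j *
      qpoch (const2 q) (const2 q * V) (B - j + k))"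
      unfolding g_def heine_coeff_def idx c by (simp only: mult_ac)
  qed
  finally have eq: "p3 q t $ A $ B = (\<Sum>k\<le>min A B. reduced_term k $ A $ B)"
    by (simp add: p3_def)
  have "(\<lambda>k. reduced_term k $ A $ B $ c $ d) sums (\<Sum>k\<le>min A B. reduced_term k $ A $ B $ c $ d)"
    by (intro sums_finite) (auto simp: nth)
  then show "(\<lambda>k. reduced_term k $ A $ B $ c $ d) sums (p3 q t $ A $ B $ c $ d)"
    by (simp add: eq fps_sum_nth)
qed

definition phi3_term :: "nat \<Rightarrow> ps4" where
  "phi3_term k = const4 (qpoch q (q / t) k * qpoch q (q / t) k / (qpoch q q k * qpoch q t k)) *
          (const4 q * x_ratio 1 3 * s_ratio 1 3) ^ k *
          (\<Prod>(i,j)\<in>pairs3.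
             qpoch_inf q (const4 t) * qpoch_inf q (const4 q * x_ratio i j * s_ratio i j) *
             inverse (qpoch_inf q (const4 (q / t) * x_ratio i j) *
                      qpoch_inf q (const4 (q / t) * s_ratio i j)) *
             phi21 q (const4 (q / t) * x_ratio i j) (const4 (q / t) * s_ratio i j)
               (const4 q * x_ratio i j * s_ratio i j) (const4 (q ^ k * t)))"

lemma phi3_term_sums: "ps4_sums phi3_term (phi3 q t)"
proof -
  have "phi3_term k = (\<Prod>(i,j)\<in>pairs3. qpoch_inf q (const4 q * s_ratio i j) *
        inverse (qpoch_inf q (const4 (q / t) * s_ratio i j))) * reduced_term k" for k
  proof -
    have "(\<Prod>(i,j)\<in>pairs3.
             qpoch_inf q (const4 t) * qpoch_inf q (const4 q * x_ratio i j * s_ratio i j) *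
             inverse (qpoch_inf q (const4 (q / t) * x_ratio i j) *
                      qpoch_inf q (const4 (q / t) * s_ratio i j)) *
             phi21 q (const4 (q / t) * x_ratio i j) (const4 (q / t) * s_ratio i j)
               (const4 q * x_ratio i j * s_ratio i j) (const4 (q ^ k * t))) =
        (\<Prod>(i,j)\<in>pairs3. (qpoch_inf q (const4 q * s_ratio i j) *
        inverse (qpoch_inf q (const4 (q / t) * s_ratio i j))) * ps4_suminf (heine_term q t k (x_ratio i j) (s_ratio i j)))"
    proof (rule prod.cong[OF refl], clarify)
      fix i j :: nat assume "(i, j) \<in> pairs3"
      then show "qpoch_inf q (const4 t) * qpoch_inf q (const4 q * x_ratio i j * s_ratio i j) *
             inverse (qpoch_inf q (const4 (q / t) * x_ratio i j) *
                      qpoch_inf q (const4 (q / t) * s_ratio i j)) *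
             phi21 q (const4 (q / t) * x_ratio i j) (const4 (q / t) * s_ratio i j)
               (const4 q * x_ratio i j * s_ratio i j) (const4 (q ^ k * t)) =
          qpoch_inf q (const4 q * s_ratio i j) *
            inverse (qpoch_inf q (const4 (q / t) * s_ratio i j)) * ps4_suminf (heine_term q t k (x_ratio i j) (s_ratio i j))"
        by (intro heine q t ord4_ratio)
    qed
    also have "\<dots> = (\<Prod>(i,j)\<in>pairs3. qpoch_inf q (const4 q * s_ratio i j) *
        inverse (qpoch_inf q (const4 (q / t) * s_ratio i j))) *
        (\<Prod>(i,j)\<in>pairs3. ps4_suminf (heine_term q t k (x_ratio i j) (s_ratio i j)))"
      by (simp add: prod.distrib case_prod_unfold)
    finally show ?thesis
      unfolding phi3_term_def reduced_term_def outer_const_def by (simp only: mult_ac)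
  qed
  then have "phi3_term = (\<lambda>k. (\<Prod>(i,j)\<in>pairs3. qpoch_inf q (const4 q * s_ratio i j) *
        inverse (qpoch_inf q (const4 (q / t) * s_ratio i j))) * reduced_term k)"
    by (rule ext)
  then show ?thesis
    unfolding phi3_def by (simp only:) (rule ps4_sums_mult[OF reduced_term_sums])
qed

end

section \<open>Duality\<close>

lemma swap_xs_nth: "swap_xs F $ a $ b $ c $ d = F $ c $ d $ a $ b"
  by (simp add: swap_xs_def)

lemma sum4_swap:
  "(\<Sum>i\<in>A. \<Sum>j\<in>B. \<Sum>k\<in>C. \<Sum>l\<in>D. f i j k l) = (\<Sum>k\<in>C. \<Sum>l\<in>D. \<Sum>i\<in>A. \<Sum>j\<in>B. f i j k l)"
proof -
  have 1: "(\<Sum>j\<in>B. \<Sum>k\<in>C. \<Sum>l\<in>D. f i j k l) = (\<Sum>k\<in>C. \<Sum>l\<in>D. \<Sum>j\<in>B. f i j k l)" for i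
    by (subst sum.swap) (intro sum.cong refl sum.swap)
  show ?thesis
    unfolding 1 by (subst sum.swap) (intro sum.cong refl sum.swap)
qed

lemma swap_xs_mult: "swap_xs (F * G) = swap_xs F * swap_xs G"
proof (rule ps4_eqI)
  fix a b c d
  show "swap_xs (F * G) $ a $ b $ c $ d = (swap_xs F * swap_xs G) $ a $ b $ c $ d"
    unfolding swap_xs_nth ps4_mult_nth by (rule sum4_swap)
qed

lemma swap_xs_diff: "swap_xs (F - G) = swap_xs F - swap_xs G"
  by (rule ps4_eqI) (simp add: swap_xs_nth)

lemma swap_xs_const4: "swap_xs (const4 c) = const4 c"
  by (rule ps4_eqI) (auto simp: swap_xs_nth const4_def)

lemma swap_xs_1: "swap_xs 1 = 1"
  using swap_xs_const4[of 1] by simp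

lemma swap_xs_power: "swap_xs (F ^ n) = swap_xs F ^ n"
  by (induction n) (simp_all add: swap_xs_1 swap_xs_mult)

lemma swap_xs_inverse:
  assumes "F $ 0 $ 0 $ 0 $ 0 \<noteq> 0"
  shows "swap_xs (inverse F) = inverse (swap_xs F)"
  using arg_cong[OF ps4_mult_inverse[OF assms], of swap_xs]
  by (intro ps4_inverse_unique[symmetric]) (simp add: swap_xs_mult swap_xs_1)

lemma swap_xs_qpoch: "swap_xs (qpoch a z n) = qpoch (swap_xs a) (swap_xs z) n"
  by (rule qpoch_hom) (simp_all add: swap_xs_mult swap_xs_diff swap_xs_1)

text \<open>Both operations act on coefficients: \<open>ps4_lim\<close> treats each sequence of
  coefficients separately, and the swap only permutes these sequences.\<close>

lemma swap_xs_lim: "swap_xs (ps4_lim F) = ps4_lim (\<lambda>n. swap_xs (F n))"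
  by (rule ps4_eqI) (simp add: swap_xs_nth ps4_lim_def)

lemma swap_xs_qpoch_inf: "swap_xs (qpoch_inf q z) = qpoch_inf q (swap_xs z)"
  unfolding qpoch_inf_def swap_xs_lim swap_xs_qpoch swap_xs_const4 ..

lemma swap_xs_sum: "swap_xs (\<Sum>i\<in>I. F i) = (\<Sum>i\<in>I. swap_xs (F i))"
  by (rule ps4_eqI) (simp add: swap_xs_nth ps4_sum_nth del: fps_sum_nth)

lemma swap_xs_suminf: "swap_xs (ps4_suminf F) = ps4_suminf (\<lambda>n. swap_xs (F n))"
  unfolding ps4_suminf_def swap_xs_lim swap_xs_sum ..

text \<open>The swap passes through \<open>inverse\<close> because the constant term of the
  denominator is (q;q)_m, which is nonzero; c has positive order and contributes 1.\<close>

lemma swap_xs_phi21: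
  assumes "norm q < 1" "ord4 1 c"
  shows "swap_xs (phi21 q a b c z) = phi21 q (swap_xs a) (swap_xs b) (swap_xs c) (swap_xs z)"
proof -
  have "(qpoch (const4 q) (const4 q) m * qpoch (const4 q) c m) $ 0 $ 0 $ 0 $ 0 \<noteq> 0" for m
    unfolding qpoch_const4 ps4_mult_nth_0 qpoch_nth_0[OF assms(2)]
    using qq_neq_0[OF assms(1)] by (simp add: const4_def)
  then show ?thesis
    unfolding phi21_def swap_xs_suminf swap_xs_mult
    by (simp add: swap_xs_inverse swap_xs_mult swap_xs_qpoch swap_xs_const4 swap_xs_power)
qed

lemma phi21_commute: "phi21 q a b c z = phi21 q b a c z"
  unfolding phi21_def by (simp only: mult.commute[of "qpoch _ a _"])

lemma swap_xs_ratio: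
  assumes "(i, j) \<in> pairs3"
  shows "swap_xs (x_ratio i j) = s_ratio i j" "swap_xs (s_ratio i j) = x_ratio i j"
proof -
  have 1: "swap_xs fps_X = s_embed fps_X" "swap_xs (fps_const fps_X) = s_embed (fps_const fps_X)"
    by (rule ps4_eqI; auto simp: swap_xs_nth s_embed_def fps_X_nth)+
  then have 2: "swap_xs (s_embed fps_X) = fps_X" "swap_xs (s_embed (fps_const fps_X)) = fps_const fps_X"
    by (rule_tac [!] ps4_eqI) (simp_all add: swap_xs_nth flip: 1)
  show "swap_xs (x_ratio i j) = s_ratio i j" "swap_xs (s_ratio i j) = x_ratio i j"
    using assms by (auto simp: pairs3_eq ratio_simps[simplified] swap_xs_mult s_embed_hom 1 2)
qed

lemma swap_xs_ps4_sums: "ps4_sums f F \<Longrightarrow> ps4_sums (\<lambda>n. swap_xs (f n)) (swap_xs F)"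
  unfolding ps4_sums_def swap_xs_nth by blast

context
  fixes q t :: complex
  assumes q: "q \<noteq> 0" "norm q < 1" and t: "t \<noteq> 0" "norm t < 1"
begin

text \<open>The swap exchanges X and U in the factor \<open>f X U\<close> of each pair, which is
  symmetric in them because \<open>phi21\<close> is symmetric in its upper parameters; the outer
  power contains x_3/x_1 and s_3/s_1 symmetrically.\<close>

lemma swap_xs_phi3_term: "swap_xs (phi3_term q t k) = phi3_term q t k"
proof -
  define f where "f X U = qpoch_inf q (const4 t) * qpoch_inf q (const4 q * X * U) *
             inverse (qpoch_inf q (const4 (q / t) * X) * qpoch_inf q (const4 (q / t) * U)) *
             phi21 q (const4 (q / t) * X) (const4 (q / t) * U) (const4 q * X * U) (const4 (q ^ k * t))" for X U
  have swap_f: "swap_xs (f X U) = f (swap_xs U) (swap_xs X)" if "ord4 1 X" "ord4 1 U" for X U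
  proof -
    have inv: "(qpoch_inf q (const4 (q / t) * X) * qpoch_inf q (const4 (q / t) * U)) $ 0 $ 0 $ 0 $ 0 \<noteq> 0"
      using that q by (intro ps4_mult_nth_0_neq admissible_qpoch_inf(2) ord4_admissible ord4_mult_left)
    have ord: "ord4 1 (const4 q * X * U)"
      using that by (intro ord4_mult_left)
    show ?thesis
      unfolding f_def swap_xs_mult swap_xs_inverse[OF inv] swap_xs_phi21[OF q(2) ord] swap_xs_qpoch_inf
        swap_xs_const4 phi21_commute[of q "const4 (q / t) * swap_xs X"]
      by (simp only: mult_ac)
  qed
  have "swap_xs (f (x_ratio i j) (s_ratio i j)) = f (x_ratio i j) (s_ratio i j)" if "(i, j) \<in> pairs3" for i j
    using that swap_f[OF ord4_ratio] swap_xs_ratio by simp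
  then have "swap_xs (\<Prod>(i,j)\<in>pairs3. f (x_ratio i j) (s_ratio i j)) = (\<Prod>(i,j)\<in>pairs3. f (x_ratio i j) (s_ratio i j))"
    by (simp add: pairs3_eq swap_xs_mult)
  moreover have "(1, 3) \<in> pairs3" by (simp add: pairs3_eq)
  ultimately show ?thesis
    unfolding phi3_term_def[OF q t] f_def[symmetric]
    by (simp only: swap_xs_mult swap_xs_power swap_xs_const4 swap_xs_ratio mult_ac)
qed

lemma phi3_duality: "phi3 q t = swap_xs (phi3 q t)"
  using swap_xs_ps4_sums[OF phi3_term_sums[OF q t]] phi3_term_sums[OF q t]
  unfolding swap_xs_phi3_term by (intro ps4_sums_unique)

end

theorem theorem1p8:
  fixes q t :: complex
  assumes "q \<noteq> 0" and "norm q < 1" and "t \<noteq> 0" and "norm t < 1"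
  shows
    "ps4_sums
       (\<lambda>k. const4 (qpoch q (q / t) k * qpoch q (q / t) k / (qpoch q q k * qpoch q t k)) *
          (const4 q * x_ratio 1 3 * s_ratio 1 3) ^ k *
          (\<Prod>(i,j)\<in>pairs3.
             qpoch_inf q (const4 t) * qpoch_inf q (const4 q * x_ratio i j * s_ratio i j) *
             inverse (qpoch_inf q (const4 (q / t) * x_ratio i j) *
                      qpoch_inf q (const4 (q / t) * s_ratio i j)) *
             phi21 q (const4 (q / t) * x_ratio i j) (const4 (q / t) * s_ratio i j)
               (const4 q * x_ratio i j * s_ratio i j) (const4 (q ^ k * t))))
       (phi3 q t)
     \<and> p3_coeff q t 0 0 = 1
     \<and> (\<forall>a b. regular_at_origin (p3_coeff q t a b) \<and>
       (\<forall>\<pi>. prime_elem \<pi> \<longrightarrow>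
          pole_order (p3_coeff q t a b) \<pi> \<le> 1 \<and>
          (pole_order (p3_coeff q t a b) \<pi> > 0 \<longrightarrow>
             (\<exists>(i,j)\<in>pairs3. \<exists>k. \<pi> dvd pole_divisor q i j k \<and> pole_divisor q i j k dvd \<pi>))))
     \<and> phi3 q t = swap_xs (phi3 q t)"
  using phi3_term_sums[OF assms, unfolded phi3_term_def[OF assms, abs_def]] p3_coeff_0_0[OF assms]
    p3_coeff_regular[OF assms] p3_coeff_poles[OF assms] phi3_duality[OF assms]
  by (intro conjI allI impI)

end
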